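(* Let $n=2r+1$ with $r\ge1$, let $L>1$ and let $\epsilon$ be a primitive $2L$-th root of unity. Let $k\in\mathbb N^*$ and $a_1,\dots,a_k\in\mathbb C^*$ be such that $\frac{a_i}{a_j}\notin\epsilon^{2\mathbb Z}$ for all $i<j$. Then $\Delta_D$ endows the tensor product $$V\begin{pmatrix}\boxed1\\ \vdots\\ \boxed{r+1}\end{pmatrix}_{a_1,\epsilon}\otimes V\begin{pmatrix}\boxed1\\ \vdots\\ \boxed{r+1}\end{pmatrix}_{a_2,\epsilon}\otimes\cdots\otimes V\begin{pmatrix}\boxed1\\ \vdots\\ \boxed{r+1}\end{pmatrix}_{a_k,\epsilon}$$ with a well-defined structure of $\mathcal U_\epsilon(sl_{n+1}^{tor})'$-module. Furthermore it is irreducible and finite-dimensional of dimension $\left[L\cdot\binom{n+1}{r+1}\right]^k$ (the $k$-th power of the integer $L\binom{n+1}{r+1}$).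
   Context: Here $n=2r+1$, $r\ge1$. $I=\{0,\dots,n\}$ is identified with $\mathbb Z/(n+1)\mathbb Z$; $C=(C_{i,j})_{i,j\in I}$ is the Cartan matrix of type $A_n^{(1)}$ ($C_{i,i}=2$, $C_{i,i\pm1}=-1$, $C_{i,j}=0$ otherwise). Choose $\tau\in\mathbb C$ with $e^\tau=\epsilon$ and put $\epsilon^x=e^{\tau x}$ for $x\in\mathbb Q$. $\mathfrak h'=\mathbb Qh_0\oplus\dots\oplus\mathbb Qh_n$; $\alpha_i,\Lambda_i\in(\mathfrak h')^*$: $\alpha_i(h_j)=C_{j,i}$, $\Lambda_i(h_j)=\delta_{i,j}$ (indices mod $n+1$). $\mathcal U_\epsilon(sl_{n+1}^{tor})'$ is the quantum toroidal algebra at $\epsilon$ without derivation element and without divided powers: the $\mathbb C$-algebra with generators $x_{i,r}^\pm$ ($i\in I,r\in\mathbb Z$), $k_h$ ($h\in\mathfrak h'$), $h_{i,m}$ ($i\in I$, $m\in\mathbb Z\setminus\{0\}$). Put $x_i^\pm(z)=\sum_{r\in\mathbb Z}x_{i,r}^\pm z^r$, $\delta(z)=\sum_{s\in\mathbb Z}z^s$, $k_i^{\pm1}=k_{\pm h_i}$, $\phi_i^\pm(z)=\sum_{m\ge0}\phi^\pm_{i,\pm m}z^{\pm m}=k_i^{\pm1}\exp(\pm(\epsilon-\epsilon^{-1})\sum_{m\ge1}h_{i,\pm m}z^{\pm m})$. Relations: $k_hk_{h'}=k_{h+h'}$, $k_0=1$; the $k_h$ and all coefficients of all $\phi_i^\pm(z)$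 commute; $k_hx_j^\pm(z)k_{-h}=\epsilon^{\pm\alpha_j(h)}x_j^\pm(z)$; $(w-\epsilon^{\pm C_{ij}}z)\phi_i^{\sigma}(z)x_j^\pm(w)=(\epsilon^{\pm C_{ij}}w-z)x_j^\pm(w)\phi_i^{\sigma}(z)$ for $\sigma=+,-$; $[x_i^+(z),x_j^-(w)]=\frac{\delta_{i,j}}{\epsilon-\epsilon^{-1}}(\delta(\frac wz)\phi_i^+(w)-\delta(\frac zw)\phi_i^-(z))$; $(w-\epsilon^{\pm C_{ij}}z)x_i^\pm(z)x_j^\pm(w)=(\epsilon^{\pm C_{ij}}w-z)x_j^\pm(w)x_i^\pm(z)$; for $j=i\pm1$: $x_i^\pm(z_1)x_i^\pm(z_2)x_j^\pm(w)-(\epsilon+\epsilon^{-1})x_i^\pm(z_1)x_j^\pm(w)x_i^\pm(z_2)+x_j^\pm(w)x_i^\pm(z_1)x_i^\pm(z_2)+(z_1\leftrightarrow z_2)=0$; $[x_i^\pm(z),x_j^\pm(w)]=0$ for $i\ne j,j\pm1$. Let $\psi(z)=\frac{\epsilon-\epsilon^{-1}z}{1-z}$; rational functions describing $\phi_i^+$ (resp. $\phi_i^-$) are expanded at $z=0$ (resp. $z=\infty$). For $a\in\mathbb C^*$, the module $V\begin{pmatrix}\boxed1\\ \vdots\\ \boxed{r+1}\end{pmatrix}_{a,\epsilon}$ (a specialization at $q=\epsilon$, followed by a quotient, of a module over $\mathcal U_q(sl_{n+1}^{tor})$; it is irreducible of dimension $L\binom{n+1}{r+1}$) has basis $T_b$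 where $b\in a\epsilon^{2\mathbb Z}$ (a set with $L$ elements) and $T=(1\le i_1<\cdots<i_{r+1}\le n+1)$ is a column tableau. For $i\in\{1,\dots,n\}$: $\tilde e_iT$ is obtained by replacing $i+1$ by $i$ in $T$ (and is $0$ if $i+1\notin T$ or $i\in T$); $\tilde f_iT$ is obtained by replacing $i$ by $i+1$ (and is $0$ if $i\notin T$ or $i+1\in T$). $\tilde e_0T=(i_2,\dots,i_{r+1},n+1)$ if $i_1=1$, $i_{r+1}\ne n+1$, else $0$; $\tilde f_0T=(1,i_1,\dots,i_r)$ if $i_1\ne1$, $i_{r+1}=n+1$, else $0$; $(0)_b=0$. The action is: for $1\le i\le n$, $x_i^+(z)T_b=\delta(b\epsilon^{i-2p+2}z)(\tilde e_iT)_b$ if $i_p=i+1$ for some $p$ and $0$ otherwise; $x_i^-(z)T_b=\delta(b\epsilon^{i-2p+2}z)(\tilde f_iT)_b$ if $i_p=i$ for some $p$ and $0$ otherwise; $\phi_i^\pm(z)T_b=\psi(b\epsilon^{i-2p+2}z)T_b$ if $i_p=i$ and $i+1\notin T$, $=\psi(b\epsilon^{i-2p+4}z)^{-1}T_b$ if $i_p=i+1$ and $i\notin T$, $=T_b$ otherwise; and $x_0^+(z)T_b=\delta(bz)(\tilde e_0T)_{b\epsilon^{-2}}$, $x_0^-(z)T_b=\delta(b\epsilon^2z)(\tilde f_0T)_{b\epsilon^2}$, $\phi_0^\pm(z)T_b=\psi(b\epsilon^2z)T_b$ if $i_{r+1}=n+1,i_1\ne1$, $=\psi(b\epsilon^2z)^{-1}T_b$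 if $i_1=1,i_{r+1}\ne n+1$, $=T_b$ otherwise; $k_hT_b=\epsilon^{\sum_p(\Lambda_{i_p}-\Lambda_{i_p-1})(h)}T_b$. Drinfeld coproduct: $\Delta_D(x_i^+(z))=x_i^+(z)\otimes1+\phi_i^-(z)\otimes x_i^+(z)$, $\Delta_D(x_i^-(z))=x_i^-(z)\otimes\phi_i^+(z)+1\otimes x_i^-(z)$, $\Delta_D(\phi_i^\pm(z))=\phi_i^\pm(z)\otimes\phi_i^\pm(z)$, $\Delta_D(k_h)=k_h\otimes k_h$, iterated for $k$ factors. On tensors of basis vectors $b_1\otimes\cdots\otimes b_k$ with $\phi_i^\pm(z)b_s=f_{i,s}(z)b_s$, $f_{i,s}$ rational, this means $x_i^+(z)$ acts by $\sum_u\big(\prod_{s<u}f_{i,s}(z)\big)b_1\otimes\cdots\otimes x_i^+(z)b_u\otimes\cdots\otimes b_k$ and $x_i^-(z)$ by $\sum_u\big(\prod_{s>u}f_{i,s}(z)\big)b_1\otimes\cdots\otimes x_i^-(z)b_u\otimes\cdots\otimes b_k$, where $f(z)\delta(cz):=f(c^{-1})\delta(cz)$; it is well-defined if no pole occurs. *)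

theory Defs
  imports
    "HOL-Analysis.Analysis"
    "HOL-Library.Poly_Mapping"
    "HOL-Computational_Algebra.Computational_Algebra"
    "HOL-Computational_Algebra.Field_as_Ring"
    "HOL-Algebra.QuotRing"
begin

section \<open>Free algebras and free vector spaces over the complex numbers\<close>

datatype 'g word = Word (letters: "'g list")

text \<open>The product of \<^typ>\<open>'a \<Rightarrow>\<^sub>0 complex\<close> is the convolution product
  over an additively written monoid \<^typ>\<open>'a\<close>. For the (noncommutative) monoid of words under
  concatenation, \<^typ>\<open>'g word \<Rightarrow>\<^sub>0 complex\<close> is therefore the free associative unital
  algebra on \<^typ>\<open>'g\<close>.\<close>

instantiation word :: (type) monoid_add
begin

definition zero_word :: "'a word" where "0 = Word []"

definition plus_word :: "'a word \<Rightarrow> 'a word \<Rightarrow> 'a word"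
  where "u + v = Word (letters u @ letters v)"

instance
  by standard (simp_all add: zero_word_def plus_word_def)

end

type_synonym 'g free_alg = "'g word \<Rightarrow>\<^sub>0 complex"

definition gen :: "'g \<Rightarrow> 'g free_alg"
  where "gen g = Poly_Mapping.single (Word [g]) 1"

definition scal :: "complex \<Rightarrow> 'g free_alg"
  where "scal c = Poly_Mapping.single 0 c"

definition free_alg_on :: "'g set \<Rightarrow> 'g free_alg ring"
  where "free_alg_on G =
    \<lparr>carrier = {p. Poly_Mapping.keys p \<subseteq> Word ` lists G},
     mult = times, one = 1, zero = 0, add = plus\<rparr>"

text \<open>The algebra with generators \<^term>\<open>G\<close> and relations \<^term>\<open>p = 0\<close> for
  \<^term>\<open>p \<in> R\<close>; note that \<^const>\<open>genideal\<close> is the two-sided ideal.\<close>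

definition presented_alg :: "'g set \<Rightarrow> 'g free_alg set \<Rightarrow> 'g free_alg set ring"
  where "presented_alg G R = free_alg_on G Quot genideal (free_alg_on G) R"

definition alg_class :: "'g set \<Rightarrow> 'g free_alg set \<Rightarrow> 'g free_alg \<Rightarrow> 'g free_alg set"
  where "alg_class G R p = genideal (free_alg_on G) R +>\<^bsub>free_alg_on G\<^esub> p"

definition cscale :: "complex \<Rightarrow> ('b \<Rightarrow>\<^sub>0 complex) \<Rightarrow> ('b \<Rightarrow>\<^sub>0 complex)"
  where "cscale c v = Poly_Mapping.map (times c) v"

lemma lookup_cscale [simp]: "Poly_Mapping.lookup (cscale c v) b = c * Poly_Mapping.lookup v b"
  by (simp add: cscale_def Poly_Mapping.map.rep_eq when_def)

global_interpretation cvec: vector_space cscale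
  by standard (auto intro!: poly_mapping_eqI simp: lookup_add algebra_simps)

definition free_space :: "'b set \<Rightarrow> ('b \<Rightarrow>\<^sub>0 complex) set"
  where "free_space B = {v. Poly_Mapping.keys v \<subseteq> B}"

text \<open>Left modules over a complex algebra \<^term>\<open>U\<close> whose scalars are embedded by
  \<^term>\<open>\<iota>\<close>; the underlying vector space is a subspace \<^term>\<open>W\<close> of
  \<^typ>\<open>'b \<Rightarrow>\<^sub>0 complex\<close>.\<close>

definition is_left_module ::
    "'u ring \<Rightarrow> (complex \<Rightarrow> 'u) \<Rightarrow> ('b \<Rightarrow>\<^sub>0 complex) set \<Rightarrow>
     ('u \<Rightarrow> ('b \<Rightarrow>\<^sub>0 complex) \<Rightarrow> ('b \<Rightarrow>\<^sub>0 complex)) \<Rightarrow> bool"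
  where "is_left_module U \<iota> W act \<longleftrightarrow>
    cvec.subspace W \<and>
    (\<forall>u\<in>carrier U. \<forall>v\<in>W. act u v \<in> W) \<and>
    (\<forall>u\<in>carrier U. \<forall>v\<in>W. \<forall>w\<in>W. act u (v + w) = act u v + act u w) \<and>
    (\<forall>u\<in>carrier U. \<forall>u'\<in>carrier U. \<forall>v\<in>W. act (u \<oplus>\<^bsub>U\<^esub> u') v = act u v + act u' v) \<and>
    (\<forall>u\<in>carrier U. \<forall>u'\<in>carrier U. \<forall>v\<in>W. act (u \<otimes>\<^bsub>U\<^esub> u') v = act u (act u' v)) \<and>
    (\<forall>v\<in>W. act \<one>\<^bsub>U\<^esub> v = v) \<and>
    (\<forall>c. \<forall>v\<in>W. act (\<iota> c) v = cscale c v)"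

definition is_irreducible ::
    "'u ring \<Rightarrow> ('b \<Rightarrow>\<^sub>0 complex) set \<Rightarrow>
     ('u \<Rightarrow> ('b \<Rightarrow>\<^sub>0 complex) \<Rightarrow> ('b \<Rightarrow>\<^sub>0 complex)) \<Rightarrow> bool"
  where "is_irreducible U W act \<longleftrightarrow>
    W \<noteq> {0} \<and>
    (\<forall>N. cvec.subspace N \<and> N \<subseteq> W \<and> (\<forall>u\<in>carrier U. \<forall>v\<in>N. act u v \<in> N)
      \<longrightarrow> N = {0} \<or> N = W)"


section \<open>The quantum toroidal algebra at \<open>\<epsilon>\<close>\<close>

datatype sign = Pos | Neg

fun sg :: "sign \<Rightarrow> int" where
  "sg Pos = 1"
| "sg Neg = -1"

text \<open>\<open>X s i m\<close>, \<open>K h\<close> and \<open>H i m\<close> are the generators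
  $x^{\pm}_{i,m}$, $k_h$ and $h_{i,m}$. The index set $I$ is \<open>{..n}\<close>, and
  $h = \sum_i q_i h_i \in \mathfrak h'$ is encoded by its coordinates
  $q_i$, supported in \<open>{..n}\<close>.\<close>

datatype tor_gen = X sign nat int | K "nat \<Rightarrow>\<^sub>0 rat" | H nat int

definition tor_gens :: "nat \<Rightarrow> tor_gen set"
  where "tor_gens n =
    {X s i m | s i m. i \<le> n} \<union> {K h | h. Poly_Mapping.keys h \<subseteq> {..n}} \<union>
    {H i m | i m. i \<le> n \<and> m \<noteq> 0}"

definition adjacent :: "nat \<Rightarrow> nat \<Rightarrow> nat \<Rightarrow> bool"
  where "adjacent n i j \<longleftrightarrow> j = (i + 1) mod (n + 1) \<or> i = (j + 1) mod (n + 1)"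

definition cartan :: "nat \<Rightarrow> nat \<Rightarrow> nat \<Rightarrow> int"
  where "cartan n i j = (if i = j then 2 else if adjacent n i j then -1 else 0)"

text \<open>$\alpha_j(h)$ and $\Lambda_i(h)$ (index modulo $n+1$), and
  $\epsilon^x = e^{\tau x}$ for rational $x$.\<close>

definition alpha :: "nat \<Rightarrow> nat \<Rightarrow> (nat \<Rightarrow>\<^sub>0 rat) \<Rightarrow> rat"
  where "alpha n j h = (\<Sum>i\<le>n. Poly_Mapping.lookup h i * of_int (cartan n i j))"

definition Lam :: "nat \<Rightarrow> nat \<Rightarrow> (nat \<Rightarrow>\<^sub>0 rat) \<Rightarrow> rat"
  where "Lam n i h = Poly_Mapping.lookup h (i mod (n + 1))"

definition eps_pow :: "complex \<Rightarrow> rat \<Rightarrow> complex"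
  where "eps_pow \<tau> x = exp (\<tau> * of_rat x)"

text \<open>\<open>phi_nat \<epsilon> s i m\<close> is the coefficient of $z^{\pm m}$ in
  $k_i^{\pm 1}\exp(\pm(\epsilon-\epsilon^{-1})\sum_{m\ge 1} h_{i,\pm m} z^{\pm m})$. The exponent
  has no constant term, so only its powers up to the \<open>m\<close>-th contribute.\<close>

definition phi_exponent :: "complex \<Rightarrow> sign \<Rightarrow> nat \<Rightarrow> tor_gen free_alg fps"
  where "phi_exponent \<epsilon> s i = Abs_fps (\<lambda>m. if m = 0 then 0
    else scal (of_int (sg s) * (\<epsilon> - inverse \<epsilon>)) * gen (H i (sg s * int m)))"

definition phi_nat :: "complex \<Rightarrow> sign \<Rightarrow> nat \<Rightarrow> nat \<Rightarrow> tor_gen free_alg"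
  where "phi_nat \<epsilon> s i m =
    gen (K (Poly_Mapping.single i (of_int (sg s)))) *
    (\<Sum>N\<le>m. scal (1 / fact N) * fps_nth (phi_exponent \<epsilon> s i ^ N) m)"

text \<open>The coefficient of $z^m$ in $\phi_i^{\pm}(z)$ for an arbitrary integer \<open>m\<close>.\<close>

definition phi :: "complex \<Rightarrow> sign \<Rightarrow> nat \<Rightarrow> int \<Rightarrow> tor_gen free_alg"
  where "phi \<epsilon> s i m = (if 0 \<le> sg s * m then phi_nat \<epsilon> s i (nat (sg s * m)) else 0)"

abbreviation xg :: "sign \<Rightarrow> nat \<Rightarrow> int \<Rightarrow> tor_gen free_alg"
  where "xg s i m \<equiv> gen (X s i m)"

abbreviation kg :: "(nat \<Rightarrow>\<^sub>0 rat) \<Rightarrow> tor_gen free_alg"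
  where "kg h \<equiv> gen (K h)"

text \<open>The relations between currents, coefficient by coefficient (left hand side minus right hand
  side): \<open>a\<close>, \<open>b\<close> are the exponents of $z$, $w$ (of $z_1$, $z_2$, followed by
  \<open>c\<close> for $w$, in the Serre relations). In \<open>x_plus_minus\<close> the coefficient of
  $z^a w^b$ in $\delta(w/z)\phi^+_i(w)$ is $\phi^+_{i,a+b}$, and in $\delta(z/w)\phi^-_i(z)$ it is
  $\phi^-_{i,a+b}$.\<close>

inductive_set tor_relators :: "nat \<Rightarrow> complex \<Rightarrow> complex \<Rightarrow> tor_gen free_alg set"
  for n :: nat and \<epsilon> \<tau> :: complex
where
  k_zero: "kg 0 - 1 \<in> tor_relators n \<epsilon> \<tau>"
| k_add: "\<lbrakk>Poly_Mapping.keys h \<subseteq> {..n}; Poly_Mapping.keys h' \<subseteq> {..n}\<rbrakk> \<Longrightarrow>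
    kg h * kg h' - kg (h + h') \<in> tor_relators n \<epsilon> \<tau>"
| k_k: "\<lbrakk>Poly_Mapping.keys h \<subseteq> {..n}; Poly_Mapping.keys h' \<subseteq> {..n}\<rbrakk> \<Longrightarrow>
    kg h * kg h' - kg h' * kg h \<in> tor_relators n \<epsilon> \<tau>"
| k_phi: "\<lbrakk>Poly_Mapping.keys h \<subseteq> {..n}; i \<le> n\<rbrakk> \<Longrightarrow>
    kg h * phi \<epsilon> s i a - phi \<epsilon> s i a * kg h \<in> tor_relators n \<epsilon> \<tau>"
| phi_phi: "\<lbrakk>i \<le> n; j \<le> n\<rbrakk> \<Longrightarrow>
    phi \<epsilon> s i a * phi \<epsilon> s' j b - phi \<epsilon> s' j b * phi \<epsilon> s i a
    \<in> tor_relators n \<epsilon> \<tau>"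
| k_x: "\<lbrakk>Poly_Mapping.keys h \<subseteq> {..n}; j \<le> n\<rbrakk> \<Longrightarrow>
    kg h * xg s j b * kg (- h) - scal (eps_pow \<tau> (of_int (sg s) * alpha n j h)) * xg s j b
    \<in> tor_relators n \<epsilon> \<tau>"
| phi_x: "\<lbrakk>i \<le> n; j \<le> n; q = \<epsilon> powi (sg s * cartan n i j)\<rbrakk> \<Longrightarrow>
    (phi \<epsilon> s' i a * xg s j (b - 1) - scal q * (phi \<epsilon> s' i (a - 1) * xg s j b))
    - (scal q * (xg s j (b - 1) * phi \<epsilon> s' i a) - xg s j b * phi \<epsilon> s' i (a - 1))
    \<in> tor_relators n \<epsilon> \<tau>"
| x_plus_minus: "\<lbrakk>i \<le> n; j \<le> n\<rbrakk> \<Longrightarrow>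
    (xg Pos i a * xg Neg j b - xg Neg j b * xg Pos i a)
    - (if i = j
       then scal (1 / (\<epsilon> - inverse \<epsilon>)) * (phi \<epsilon> Pos i (a + b) - phi \<epsilon> Neg i (a + b))
       else 0)
    \<in> tor_relators n \<epsilon> \<tau>"
| x_x: "\<lbrakk>i \<le> n; j \<le> n; q = \<epsilon> powi (sg s * cartan n i j)\<rbrakk> \<Longrightarrow>
    (xg s i a * xg s j (b - 1) - scal q * (xg s i (a - 1) * xg s j b))
    - (scal q * (xg s j (b - 1) * xg s i a) - xg s j b * xg s i (a - 1))
    \<in> tor_relators n \<epsilon> \<tau>"
| serre: "\<lbrakk>i \<le> n; j \<le> n; adjacent n i j\<rbrakk> \<Longrightarrow>
    (xg s i a * xg s i b * xg s j c
      - scal (\<epsilon> + inverse \<epsilon>) * (xg s i a * xg s j c * xg s i b)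
      + xg s j c * xg s i a * xg s i b)
    + (xg s i b * xg s i a * xg s j c
      - scal (\<epsilon> + inverse \<epsilon>) * (xg s i b * xg s j c * xg s i a)
      + xg s j c * xg s i b * xg s i a)
    \<in> tor_relators n \<epsilon> \<tau>"
| x_x_far: "\<lbrakk>i \<le> n; j \<le> n; i \<noteq> j; \<not> adjacent n i j\<rbrakk> \<Longrightarrow>
    xg s i a * xg s j b - xg s j b * xg s i a \<in> tor_relators n \<epsilon> \<tau>"

definition U_tor :: "nat \<Rightarrow> complex \<Rightarrow> complex \<Rightarrow> tor_gen free_alg set ring"
  where "U_tor n \<epsilon> \<tau> = presented_alg (tor_gens n) (tor_relators n \<epsilon> \<tau>)"

definition tor_class ::
    "nat \<Rightarrow> complex \<Rightarrow> complex \<Rightarrow> tor_gen free_alg \<Rightarrow> tor_gen free_alg set"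
  where "tor_class n \<epsilon> \<tau> p = alg_class (tor_gens n) (tor_relators n \<epsilon> \<tau>) p"


section \<open>Rational functions and their expansions\<close>

text \<open>A rational function is written in lowest terms \<open>num / den\<close>. The expansion at
  $z = \infty$, as a power series in $z^{-1}$, is computed from
  $z^{-d}\,\mathit{num}(z)$ and $z^{-d}\,\mathit{den}(z)$ where \<open>d\<close> is the degree of
  \<open>den\<close>; it is meaningful if \<open>num\<close> has degree at most \<open>d\<close>, and the
  expansion at $z = 0$ is meaningful if \<open>den\<close> does not vanish there.\<close>

definition rat_num :: "complex poly fract \<Rightarrow> complex poly"
  where "rat_num f = fst (quot_of_fract f)"

definition rat_den :: "complex poly fract \<Rightarrow> complex poly"
  where "rat_den f = snd (quot_of_fract f)"

definition no_pole_at :: "complex poly fract \<Rightarrow> complex \<Rightarrow> bool"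
  where "no_pole_at f z \<longleftrightarrow> poly (rat_den f) z \<noteq> 0"

definition rat_val :: "complex poly fract \<Rightarrow> complex \<Rightarrow> complex"
  where "rat_val f z = poly (rat_num f) z / poly (rat_den f) z"

fun expansion :: "sign \<Rightarrow> complex poly fract \<Rightarrow> complex fps" where
  "expansion Pos f = fps_of_poly (rat_num f) / fps_of_poly (rat_den f)"
| "expansion Neg f =
     fps_X ^ (degree (rat_den f) - degree (rat_num f)) * fps_of_poly (reflect_poly (rat_num f))
     / fps_of_poly (reflect_poly (rat_den f))"

text \<open>\<open>psi_at \<epsilon> c\<close> is $\psi(cz)$ as a rational function of $z$.\<close>

definition psi_at :: "complex \<Rightarrow> complex \<Rightarrow> complex poly fract"
  where "psi_at \<epsilon> c = Fract [:\<epsilon>, - (inverse \<epsilon> * c):] [:1, - c:]"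


section \<open>The modules attached to column tableaux\<close>

definition column_tableaux :: "nat \<Rightarrow> nat \<Rightarrow> nat list set"
  where "column_tableaux n l = {T. length T = l \<and> sorted_wrt (<) T \<and> set T \<subseteq> {1..n+1}}"

type_synonym box = "nat list \<times> complex"

definition V_basis :: "nat \<Rightarrow> complex \<Rightarrow> complex \<Rightarrow> box set"
  where "V_basis r \<epsilon> a =
    column_tableaux (2*r+1) (r+1) \<times> {a * \<epsilon> powi (2 * m) | m :: int. True}"

text \<open>The index \<open>p\<close>, counted from 1, with \<open>i\<^sub>p = j\<close>.\<close>

definition pos :: "nat list \<Rightarrow> nat \<Rightarrow> nat"
  where "pos T j = (THE p. 1 \<le> p \<and> p \<le> length T \<and> T ! (p - 1) = j)"

definition e_til :: "nat \<Rightarrow> nat \<Rightarrow> nat list \<Rightarrow> nat list option"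
  where "e_til n i T =
    (if i = 0 then
       (if hd T = 1 \<and> last T \<noteq> n + 1 then Some (tl T @ [n + 1]) else None)
     else
       (if i + 1 \<in> set T \<and> i \<notin> set T
        then Some (map (\<lambda>j. if j = i + 1 then i else j) T) else None))"

definition f_til :: "nat \<Rightarrow> nat \<Rightarrow> nat list \<Rightarrow> nat list option"
  where "f_til n i T =
    (if i = 0 then
       (if hd T \<noteq> 1 \<and> last T = n + 1 then Some (1 # butlast T) else None)
     else
       (if i \<in> set T \<and> i + 1 \<notin> set T
        then Some (map (\<lambda>j. if j = i then i + 1 else j) T) else None))"

text \<open>\<open>box_x n \<epsilon> s i (T, b) = Some (c, v)\<close> encodes $x_i^{\pm}(z) T_b = \delta(cz)\, v$ with
  \<open>v\<close> a basis vector, and \<^const>\<open>None\<close> encodes $x_i^{\pm}(z) T_b = 0$.\<close>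

fun box_x :: "nat \<Rightarrow> complex \<Rightarrow> sign \<Rightarrow> nat \<Rightarrow> box \<Rightarrow> (complex \<times> box) option" where
  "box_x n \<epsilon> Pos i (T, b) =
     (case e_til n i T of
        None \<Rightarrow> None
      | Some T' \<Rightarrow>
          if i = 0 then Some (b, (T', b * \<epsilon> powi (-2)))
          else Some (b * \<epsilon> powi (int i - 2 * int (pos T (i + 1)) + 2), (T', b)))"
| "box_x n \<epsilon> Neg i (T, b) =
     (case f_til n i T of
        None \<Rightarrow> None
      | Some T' \<Rightarrow>
          if i = 0 then Some (b * \<epsilon> powi 2, (T', b * \<epsilon> powi 2))
          else Some (b * \<epsilon> powi (int i - 2 * int (pos T i) + 2), (T', b)))"

fun box_phi :: "nat \<Rightarrow> complex \<Rightarrow> nat \<Rightarrow> box \<Rightarrow> complex poly fract" where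
  "box_phi n \<epsilon> i (T, b) =
     (if i = 0 then
        (if last T = n + 1 \<and> hd T \<noteq> 1 then psi_at \<epsilon> (b * \<epsilon> powi 2)
         else if hd T = 1 \<and> last T \<noteq> n + 1 then inverse (psi_at \<epsilon> (b * \<epsilon> powi 2))
         else 1)
      else
        (if i \<in> set T \<and> i + 1 \<notin> set T
         then psi_at \<epsilon> (b * \<epsilon> powi (int i - 2 * int (pos T i) + 2))
         else if i + 1 \<in> set T \<and> i \<notin> set T
         then inverse (psi_at \<epsilon> (b * \<epsilon> powi (int i - 2 * int (pos T (i + 1)) + 4)))
         else 1))"

fun box_k :: "nat \<Rightarrow> complex \<Rightarrow> (nat \<Rightarrow>\<^sub>0 rat) \<Rightarrow> box \<Rightarrow> complex" where
  "box_k n \<tau> h (T, b) = eps_pow \<tau> (\<Sum>j\<leftarrow>T. Lam n j h - Lam n (j - 1) h)"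


section \<open>The Drinfeld coproduct on tensor products\<close>

text \<open>Since the factors come with bases, their tensor product is modelled as the free vector space
  on tuples of basis vectors: $b_1 \otimes \cdots \otimes b_k$ is the basis element indexed by the
  list \<open>[b\<^sub>1, \<dots>, b\<^sub>k]\<close>.\<close>

definition tensor_basis :: "nat \<Rightarrow> complex \<Rightarrow> complex list \<Rightarrow> box list set"
  where "tensor_basis r \<epsilon> as = listset (map (V_basis r \<epsilon>) as)"

definition tensor_V :: "nat \<Rightarrow> complex \<Rightarrow> complex list \<Rightarrow> (box list \<Rightarrow>\<^sub>0 complex) set"
  where "tensor_V r \<epsilon> as = free_space (tensor_basis r \<epsilon> as)"

text \<open>When $x_i^{\pm}(z)$ acts on the factor at position \<open>u\<close> (of \<open>k\<close>), $\phi_i^{\mp}(z)$ acts on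
  the factors at these positions.\<close>

fun spectators :: "sign \<Rightarrow> nat \<Rightarrow> nat \<Rightarrow> nat set" where
  "spectators Pos u k = {..<u}"
| "spectators Neg u k = {u<..<k}"

text \<open>The products $f(z)\delta(cz) = f(c^{-1})\delta(cz)$ only make sense if no factor of \<open>f\<close> has
  a pole at $c^{-1}$.\<close>

definition drinfeld_no_poles :: "nat \<Rightarrow> complex \<Rightarrow> box list set \<Rightarrow> bool"
  where "drinfeld_no_poles n \<epsilon> B \<longleftrightarrow>
    (\<forall>t\<in>B. \<forall>s. \<forall>i\<le>n. \<forall>u<length t. \<forall>c v. box_x n \<epsilon> s i (t ! u) = Some (c, v) \<longrightarrow>
      (\<forall>l\<in>spectators s u (length t). no_pole_at (box_phi n \<epsilon> i (t ! l)) (inverse c)))"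

text \<open>The coefficient of $z^m$ in $x_i^{\pm}(z)(b_1 \otimes \cdots \otimes b_k)$.\<close>

definition drinfeld_x ::
    "nat \<Rightarrow> complex \<Rightarrow> sign \<Rightarrow> nat \<Rightarrow> int \<Rightarrow> box list \<Rightarrow> (box list \<Rightarrow>\<^sub>0 complex)"
  where "drinfeld_x n \<epsilon> s i m t =
    (\<Sum>u<length t. case box_x n \<epsilon> s i (t ! u) of
        None \<Rightarrow> 0
      | Some (c, v) \<Rightarrow> Poly_Mapping.single (t[u := v])
          ((\<Prod>l\<in>spectators s u (length t). rat_val (box_phi n \<epsilon> i (t ! l)) (inverse c)) * c powi m))"

text \<open>The eigenvalue on $b_1 \otimes \cdots \otimes b_k$ of the coefficient of $z^{\pm m}$ in
  $\phi_i^{\pm}(z)$.\<close>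

definition drinfeld_phi :: "nat \<Rightarrow> complex \<Rightarrow> sign \<Rightarrow> nat \<Rightarrow> nat \<Rightarrow> box list \<Rightarrow> complex"
  where "drinfeld_phi n \<epsilon> s i m t =
    fps_nth (\<Prod>l<length t. expansion s (box_phi n \<epsilon> i (t ! l))) m"

definition drinfeld_k :: "nat \<Rightarrow> complex \<Rightarrow> (nat \<Rightarrow>\<^sub>0 rat) \<Rightarrow> box list \<Rightarrow> complex"
  where "drinfeld_k n \<tau> h t = (\<Prod>l<length t. box_k n \<tau> h (t ! l))"

text \<open>Module structures on the free vector space on \<^term>\<open>B\<close> in which
  $x_i^{\pm}(z)$, $\phi_i^{\pm}(z)$ and $k_h$ act through the Drinfeld coproduct. (The action of
  $h_{i,m}$ is determined by that of $\phi_i^{\pm}(z)$.)\<close>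

definition is_drinfeld_module ::
    "nat \<Rightarrow> complex \<Rightarrow> complex \<Rightarrow> box list set \<Rightarrow>
     (tor_gen free_alg set \<Rightarrow> (box list \<Rightarrow>\<^sub>0 complex) \<Rightarrow> (box list \<Rightarrow>\<^sub>0 complex)) \<Rightarrow> bool"
  where "is_drinfeld_module n \<epsilon> \<tau> B act \<longleftrightarrow>
    is_left_module (U_tor n \<epsilon> \<tau>) (\<lambda>c. tor_class n \<epsilon> \<tau> (scal c)) (free_space B) act \<and>
    (\<forall>t\<in>B.
      (\<forall>s. \<forall>i\<le>n. \<forall>m. act (tor_class n \<epsilon> \<tau> (xg s i m)) (Poly_Mapping.single t 1)
          = drinfeld_x n \<epsilon> s i m t) \<and>
      (\<forall>s. \<forall>i\<le>n. \<forall>m. act (tor_class n \<epsilon> \<tau> (phi_nat \<epsilon> s i m)) (Poly_Mapping.single t 1)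
          = Poly_Mapping.single t (drinfeld_phi n \<epsilon> s i m t)) \<and>
      (\<forall>h. Poly_Mapping.keys h \<subseteq> {..n} \<longrightarrow>
          act (tor_class n \<epsilon> \<tau> (kg h)) (Poly_Mapping.single t 1)
          = Poly_Mapping.single t (drinfeld_k n \<tau> h t)))"

definition primitive_root :: "nat \<Rightarrow> complex \<Rightarrow> bool"
  where "primitive_root N \<epsilon> \<longleftrightarrow> N > 0 \<and> \<epsilon> ^ N = 1 \<and> (\<forall>m. 0 < m \<and> m < N \<longrightarrow> \<epsilon> ^ m \<noteq> 1)"

end

theory Submission
  imports Defs
begin

text \<open>
  The module attached to a column tableau becomes transparent once a basis vector $T_b$ is drawn as a
  closed path. On the nodes $i$ of the cyclic diagram put the height
  $y_i = b\,\epsilon^{i - 2\,\#\{x \in T : x \le i\}}$. Neighbouring heights differ by a factor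
  $\epsilon^{\pm 1}$, according to whether $i+1$ belongs to $T$ (\<open>height_nxt\<close>); the path closes up because
  $T$ contains exactly half of the $n + 1 = 2r + 2$ entries. In this picture all nodes, including
  the node 0, behave alike: $x_i^+$ turns a local maximum of the path at $i$ into a local minimum by
  dividing $y_i$ by $\epsilon^2$, it acts at the spectral point given by $y_i$, and $x_i^-$ is the
  inverse move (\<open>box_x_iff\<close>). The eigenvalue of $\phi_i$ is a single factor of the type of $\psi$ at a local
  extremum and 1 elsewhere, and one move multiplies it by
  $(q - cz)/(1 - qcz)$ with $q = \epsilon^{\pm C_{ij}}$ (\<open>phi_step\<close>).

  The points where $x_i^\pm$ acts on the factor with parameter $a$ lie in
  $a\,\epsilon^{i + 2\mathbb Z}$. By the hypothesis on the quotients $a_i/a_j$ they never meet the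
  poles and zeros of the eigenvalues of $\phi_i$ on the other factors (\<open>spectator_regular\<close>), so that the coproduct
  makes sense with nonzero coefficients. A current is then a sum of components, one for each tensor
  factor, and each relation is checked for a fixed choice of factors. Components at
  distinct factors commute up to an explicit scalar that does not depend on the order of the factors
  (\<open>xx_exchange_same\<close>, \<open>xx_exchange_opp\<close>); components at one factor are governed by the combinatorics of
  the moves. This leaves rational identities in two or three spectral points
  (\<open>xx_relation\<close>, \<open>serre_local\<close>). The commutator $[x_i^+, x_i^-]$ is diagonal, and
  comparing it with $\phi_i^+ - \phi_i^-$ is the partial fraction decomposition of the
  eigenvalue of $\phi_i$ (\<open>relation_opp_eq\<close>). The generators $h_{i,m}$ act through the logarithm of the
  eigenvalues, and all this gives an action of the presented algebra (\<open>drinfeld_module_exists\<close>).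

  For irreducibility, interpolation in the mode $m$ isolates the part of a current that acts at one
  spectral point $c$; since the points on distinct factors differ, this part moves a single box.
  Moving the box and then moving it back is a diagonal operator that detects whether the path has an
  extremum of the given kind at $i$ with the given value. A closed path is determined by its local extrema
  (\<open>box_separation\<close>), so these operators separate the basis, and a vector of minimal support in a
  nonzero submodule is a multiple of a basis vector. (The eigenvalues of $\phi_i$ alone do not always
  separate the basis: for $L = 2$ those of a maximum and of a minimum may differ only by a sign.) Finally, any
  two paths of one module are joined by moves (\<open>V_connected\<close>), so the submodule contains every
  basis vector.
\<close>

section \<open>The rational function psi and its expansions\<close>

text \<open>Numerator and denominator are coprime because $e^2 \ne 1$; both are multiplied by
  $-1/c$ to make the denominator monic.\<close>

lemma quot_of_fract_psi_at:
  assumes "e \<noteq> 0" "e ^ 2 \<noteq> 1" "c \<noteq> 0"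
  shows "quot_of_fract (psi_at e c) = ([:- (e / c), 1 / e:], [:- (1 / c), 1:])"
proof -
  let ?p = "[:- (e / c), 1 / e:]" and ?q = "[:- (1 / c), 1:]"
  have "coprime ?p ?q"
  proof (rule coprimeI)
    fix d assume "d dvd ?p" "d dvd ?q"
    then have "d dvd ?p - smult (1 / e) ?q"
      by (intro dvd_diff dvd_smult)
    also have "?p - smult (1 / e) ?q = [:(1 - e ^ 2) / (e * c):]"
      using assms by (simp add: field_simps power2_eq_square)
    finally have "d dvd [:(1 - e ^ 2) / (e * c):]" .
    moreover have "is_unit [:(1 - e ^ 2) / (e * c):]"
      using assms by (simp add: is_unit_const_poly_iff dvd_field_iff)
    ultimately show "is_unit d"
      by (rule dvd_unit_imp_unit)
  qed
  then have nf: "(?p, ?q) \<in> normalized_fracts"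
    by (simp add: normalized_fracts_def unit_factor_pCons)
  have "psi_at e c = quot_to_fract (?p, ?q)"
    using assms by (simp add: psi_at_def quot_to_fract_def eq_fract) (simp add: divide_inverse)
  then show ?thesis
    using quot_of_fract_quot_to_fract'[OF nf] by simp
qed

lemma no_pole_psi_at:
  assumes "e \<noteq> 0" "e ^ 2 \<noteq> 1" "c \<noteq> 0"
  shows "no_pole_at (psi_at e c) z \<longleftrightarrow> c * z \<noteq> 1"
  using assms
  by (auto simp: no_pole_at_def rat_den_def quot_of_fract_psi_at field_simps)

lemma rat_val_psi_at:
  assumes "e \<noteq> 0" "e ^ 2 \<noteq> 1" "c \<noteq> 0"
  shows "rat_val (psi_at e c) z = (e - inverse e * c * z) / (1 - c * z)"
proof -
  have "(- (e / c) + z * (1 / e)) / (- (1 / c) + z) = 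
    (- c * (- (e / c) + z * (1 / e))) / (- c * (- (1 / c) + z))"
    using assms by (subst mult_divide_mult_cancel_left) auto
  also have "- c * (- (e / c) + z * (1 / e)) = e - inverse e * c * z"
    using assms by (simp add: algebra_simps divide_inverse)
  also have "- c * (- (1 / c) + z) = 1 - c * z"
    using assms by (simp add: algebra_simps)
  finally show ?thesis
    using assms by (simp add: rat_val_def rat_den_def rat_num_def quot_of_fract_psi_at)
qed

text \<open>The two expansions of $1/(1 - cz)$. Away from its pole, $\psi$ is a constant plus a
  multiple of this function, so both expansions of $\psi$ are the same combination of two geometric
  series.\<close>

definition geom :: "sign \<Rightarrow> complex \<Rightarrow> complex fps" where
  "geom s c = (case s of
     Pos \<Rightarrow> Abs_fps (\<lambda>m. c ^ m)
   | Neg \<Rightarrow> Abs_fps (\<lambda>m. if m = 0 then 0 else - (inverse c ^ m)))"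

lemma geom_Pos: "geom Pos c * (1 - fps_const c * fps_X) = 1"
proof (rule fps_ext)
  fix m
  have "geom Pos c * (1 - fps_const c * fps_X) = geom Pos c - fps_X * (fps_const c * geom Pos c)"
    by (simp only: algebra_simps mult_1_left mult_1_right)
  then show "fps_nth (geom Pos c * (1 - fps_const c * fps_X)) m = fps_nth 1 m"
    by (cases m) (simp_all add: geom_def)
qed

lemma geom_Neg:
  assumes "c \<noteq> 0" shows "geom Neg c * (fps_X - fps_const c) = fps_X"
proof (rule fps_ext)
  fix m
  have "geom Neg c * (fps_X - fps_const c) = fps_X * geom Neg c - fps_const c * geom Neg c"
    by (simp only: algebra_simps mult_1_left mult_1_right)
  then show "fps_nth (geom Neg c * (fps_X - fps_const c)) m = fps_nth fps_X m"
    using assms by (cases m) (auto simp: geom_def)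
qed

text \<open>Partial fractions for $1/((1 - cz)(1 - dz))$, valid for either expansion.\<close>

lemma geom_mult:
  assumes "c \<noteq> 0" "d \<noteq> 0" "c \<noteq> d"
  shows "geom s c * geom s d = fps_const (c / (c - d)) * geom s c + fps_const (d / (d - c)) * geom s d"
proof -
  let ?g = "geom s c" and ?h = "geom s d" and ?C = "fps_const c" and ?D = "fps_const d"
  have "(?C - ?D) * (?g * ?h) = ?C * ?g - ?D * ?h"
  proof (cases s)
    case Pos
    have "?g * (1 - ?C * fps_X) = 1" "?h * (1 - ?D * fps_X) = 1"
      using Pos geom_Pos by auto
    moreover have "fps_X * ((?C - ?D) * (?g * ?h)) - fps_X * (?C * ?g - ?D * ?h) =
        (1 - ?h) * (?g * (1 - ?C * fps_X) - 1) + (?g - 1) * (?h * (1 - ?D * fps_X) - 1)"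
      by (simp only: algebra_simps mult_1_left mult_1_right)
    ultimately show ?thesis by simp
  next
    case Neg
    have "?g * (fps_X - ?C) = fps_X" "?h * (fps_X - ?D) = fps_X"
      using Neg geom_Neg assms by auto
    moreover have "(?C - ?D) * (?g * ?h) - (?C * ?g - ?D * ?h) =
        (1 - ?h) * (?g * (fps_X - ?C) - fps_X) + (?g - 1) * (?h * (fps_X - ?D) - fps_X)"
      by (simp only: algebra_simps mult_1_left mult_1_right)
    ultimately show ?thesis by simp
  qed
  then have "fps_const (1 / (c - d)) * ((?C - ?D) * (?g * ?h)) = fps_const (1 / (c - d)) * (?C * ?g - ?D * ?h)"
    by simp
  moreover have "fps_const (1 / (c - d)) * (?C - ?D) = 1"
    using assms by simp
  moreover have "d / (d - c) = - (1 / (c - d) * d)"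
    using assms by (simp add: divide_simps) (simp add: algebra_simps)
  ultimately show ?thesis
    by (simp add: right_diff_distrib flip: mult.assoc fps_const_neg)
qed

lemma expansion_psi_at:
  assumes "e \<noteq> 0" "e ^ 2 \<noteq> 1" "c \<noteq> 0"
  shows "expansion s (psi_at e c) = fps_const (inverse e) + fps_const (e - inverse e) * geom s c"
proof -
  let ?p = "[:- (e / c), 1 / e:]" and ?q = "[:- (1 / c), 1:]"
  let ?E = "fps_const e" and ?E' = "fps_const (inverse e)" and ?C = "fps_const c"
    and ?C' = "fps_const (inverse c)"
  have EE: "?E * ?E' = 1" "?C * ?C' = 1"
    using assms by simp_all
  have sum: "fps_const (inverse e) + fps_const (e - inverse e) * geom s c = 
      ?E' + (?E - ?E') * geom s c"
    by simp
  show ?thesis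
  proof (cases s)
    case Pos
    have q: "fps_of_poly ?q = fps_X - ?C'" and p: "fps_of_poly ?p = ?E' * fps_X - ?E * ?C'"
      by (simp_all add: fps_of_poly_pCons divide_inverse flip: fps_const_neg)
    have "geom s c * (1 - ?C * fps_X) = 1"
      using Pos geom_Pos by simp
    moreover have "(?E' + (?E - ?E') * geom s c) * (fps_X - ?C') - (?E' * fps_X - ?E * ?C') =
        (?E' - ?E) * (?C' * (geom s c * (1 - ?C * fps_X) - 1) + 
          geom s c * fps_X * (?C * ?C' - 1))"
      by (simp only: algebra_simps mult_1_left mult_1_right)
    ultimately have eq: "(?E' + (?E - ?E') * geom s c) * fps_of_poly ?q = fps_of_poly ?p"
      unfolding p q using EE by simp
    have nz: "fps_of_poly ?q \<noteq> 0" by simp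
    have "fps_of_poly ?p / fps_of_poly ?q = ?E' + (?E - ?E') * geom s c"
      unfolding eq[symmetric] by (rule nonzero_mult_div_cancel_right[OF nz])
    then show ?thesis
      unfolding sum by (simp only: Pos expansion.simps rat_num_def rat_den_def 
          quot_of_fract_psi_at[OF assms] fst_conv snd_conv)
  next
    case Neg
    have q: "fps_of_poly (reflect_poly ?q) = 1 - ?C' * fps_X" 
      and p: "fps_of_poly (reflect_poly ?p) = ?E' - ?E * ?C' * fps_X"
      using assms 
      by (simp_all add: reflect_poly_pCons fps_of_poly_pCons divide_inverse mult.commute[of fps_X] 
          flip: fps_const_neg)
    have "geom s c * (fps_X - ?C) = fps_X"
      using Neg geom_Neg assms by simp
    moreover have "(?E' + (?E - ?E') * geom s c) * (1 - ?C' * fps_X) - (?E' - ?E * ?C' * fps_X) =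
        (?E' - ?E) * (?C' * (geom s c * (fps_X - ?C) - fps_X) + geom s c * (?C * ?C' - 1))"
      by (simp only: algebra_simps mult_1_left mult_1_right)
    ultimately have eq: "(?E' + (?E - ?E') * geom s c) * fps_of_poly (reflect_poly ?q) = 
        fps_of_poly (reflect_poly ?p)"
      unfolding p q using EE by simp
    have nz: "fps_of_poly (reflect_poly ?q) \<noteq> 0" by simp
    have "fps_of_poly (reflect_poly ?p) / fps_of_poly (reflect_poly ?q) = ?E' + (?E - ?E') * geom s c"
      unfolding eq[symmetric] by (rule nonzero_mult_div_cancel_right[OF nz])
    moreover have "degree ?q - degree ?p = 0"
      using assms by simp
    ultimately show ?thesis
      unfolding sum by (simp only: Neg expansion.simps rat_num_def rat_den_def 
          quot_of_fract_psi_at[OF assms] fst_conv snd_conv power_0 mult_1_left)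
  qed
qed

lemma inverse_psi_at:
  assumes "e \<noteq> 0" "c \<noteq> 0" "d = e ^ 2 * c"
  shows "inverse (psi_at e d) = psi_at (inverse e) c"
  using assms by (simp add: psi_at_def eq_fract power2_eq_square)

lemma rat_val_1 [simp]: "rat_val 1 z = 1"
  by (simp add: rat_val_def rat_num_def rat_den_def)

lemma no_pole_at_1 [simp]: "no_pole_at 1 z"
  by (simp add: no_pole_at_def rat_den_def)

lemma expansion_1 [simp]: "expansion s 1 = 1"
  by (cases s) (simp_all add: rat_num_def rat_den_def)

section \<open>Linear operators on free vector spaces\<close>

definition lin :: "('b \<Rightarrow> ('c \<Rightarrow>\<^sub>0 complex)) \<Rightarrow> ('b \<Rightarrow>\<^sub>0 complex) \<Rightarrow> ('c \<Rightarrow>\<^sub>0 complex)"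
  where "lin f v = (\<Sum>t\<in>Poly_Mapping.keys v. cscale (Poly_Mapping.lookup v t) (f t))"

lemma cscale_0 [simp]: "cscale 0 v = 0" "cscale c 0 = 0"
  and cscale_1 [simp]: "cscale 1 v = v"
  and cscale_add: "cscale (c + d) v = cscale c v + cscale d v"
  and cscale_add_right: "cscale c (v + w) = cscale c v + cscale c w"
  and cscale_cscale [simp]: "cscale c (cscale d v) = cscale (c * d) v"
  and cscale_minus: "cscale (- c) v = - cscale c v"
  and cscale_diff: "cscale (c - d) v = cscale c v - cscale d v"
  and cscale_single [simp]: "cscale c (Poly_Mapping.single t d) = Poly_Mapping.single t (c * d)"
  by (auto intro!: poly_mapping_eqI simp: lookup_add lookup_minus lookup_single when_def algebra_simps)

lemma cscale_sum: "cscale c (sum f A) = (\<Sum>x\<in>A. cscale c (f x))"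
  by (induction A rule: infinite_finite_induct) (auto simp: cscale_add_right)

lemma lin_superset:
  assumes "finite S" "Poly_Mapping.keys v \<subseteq> S"
  shows "lin f v = (\<Sum>t\<in>S. cscale (Poly_Mapping.lookup v t) (f t))"
  unfolding lin_def using assms
  by (intro sum.mono_neutral_left) (auto simp: in_keys_iff)

lemma lin_add: "lin f (v + w) = lin f v + lin f w"
proof -
  let ?S = "Poly_Mapping.keys v \<union> Poly_Mapping.keys w"
  have "Poly_Mapping.keys (v + w) \<subseteq> ?S" by (rule keys_add)
  then show ?thesis
    by (simp add: lin_superset[of ?S] lookup_add cscale_add sum.distrib)
qed

lemma lin_cscale: "lin f (cscale c v) = cscale c (lin f v)"
proof -
  have "Poly_Mapping.keys (cscale c v) \<subseteq> Poly_Mapping.keys v" by (auto simp: in_keys_iff)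
  then show ?thesis
    by (simp add: lin_superset[of "Poly_Mapping.keys v"] cscale_sum)
qed

lemma lin_single [simp]: "lin f (Poly_Mapping.single t c) = cscale c (f t)"
  by (simp add: lin_superset[of "{t}"])

lemma lin_0 [simp]: "lin f 0 = 0"
  by (simp add: lin_def)

lemma lin_sum: "lin f (sum g A) = (\<Sum>x\<in>A. lin f (g x))"
  by (induction A rule: infinite_finite_induct) (auto simp: lin_add)

lemma lin_minus: "lin f (- v) = - lin f v"
  using lin_cscale[of f "-1" v] by (simp add: cscale_minus)

lemma lin_diff: "lin f (v - w) = lin f v - lin f w"
  using lin_add[of f v "- w"] by (simp add: lin_minus)

lemma lin_fun_sum: "lin (\<lambda>t. \<Sum>x\<in>A. f x t) v = (\<Sum>x\<in>A. lin (f x) v)"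
  unfolding lin_def cscale_sum by (rule sum.swap)

lemma poly_mapping_decompose:
  "v = (\<Sum>t\<in>Poly_Mapping.keys v. Poly_Mapping.single t (Poly_Mapping.lookup v t))"
  by (rule poly_mapping_eqI) 
    (auto simp: lookup_sum lookup_single when_def in_keys_iff intro: sum.neutral)

lemma lin_ident: "lin (\<lambda>t. Poly_Mapping.single t 1) v = v"
  using poly_mapping_decompose[of v] by (simp add: lin_def)

lemma free_space_0: "0 \<in> free_space B"
  and free_space_add: "v \<in> free_space B \<Longrightarrow> w \<in> free_space B \<Longrightarrow> v + w \<in> free_space B"
  and free_space_cscale: "v \<in> free_space B \<Longrightarrow> cscale c v \<in> free_space B"
  and free_space_single: "t \<in> B \<Longrightarrow> Poly_Mapping.single t c \<in> free_space B"
  using keys_add[of v w] by (auto simp: free_space_def in_keys_iff lookup_single when_def split: if_splits)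

lemma free_space_sum: "(\<And>x. x \<in> A \<Longrightarrow> f x \<in> free_space B) \<Longrightarrow> sum f A \<in> free_space B"
  by (induction A rule: infinite_finite_induct) (auto simp: free_space_0 free_space_add)

lemma free_space_subspace: "cvec.subspace (free_space B)"
  by (simp add: cvec.subspace_def free_space_0 free_space_add free_space_cscale)

lemma lin_free_space:
  assumes "\<And>t. t \<in> B \<Longrightarrow> f t \<in> free_space B'" "v \<in> free_space B"
  shows "lin f v \<in> free_space B'"
  unfolding lin_def using assms
  by (intro free_space_sum free_space_cscale) (auto simp: free_space_def)

lemma lin_0_on:
  assumes "\<And>t. t \<in> B \<Longrightarrow> f t = 0" "v \<in> free_space B"
  shows "lin f v = 0"
  unfolding lin_def using assms by (intro sum.neutral) (auto simp: free_space_def)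

section \<open>Representations of free and presented algebras\<close>

definition word_op :: "('g \<Rightarrow> 'b \<Rightarrow> ('b \<Rightarrow>\<^sub>0 complex)) \<Rightarrow> 'g list \<Rightarrow> ('b \<Rightarrow>\<^sub>0 complex) \<Rightarrow> ('b \<Rightarrow>\<^sub>0 complex)"
  where "word_op F ws v = foldr (\<lambda>g. lin (F g)) ws v"

definition alg_op :: "('g \<Rightarrow> 'b \<Rightarrow> ('b \<Rightarrow>\<^sub>0 complex)) \<Rightarrow> 'g free_alg \<Rightarrow> ('b \<Rightarrow>\<^sub>0 complex) \<Rightarrow> ('b \<Rightarrow>\<^sub>0 complex)"
  where "alg_op F p v = lin (\<lambda>w. word_op F (letters w) v) p"

lemma word_op_add: "word_op F ws (v + w) = word_op F ws v + word_op F ws w"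
  and word_op_cscale: "word_op F ws (cscale c v) = cscale c (word_op F ws v)"
  by (induction ws) (auto simp: word_op_def lin_add lin_cscale)

lemma word_op_append: "word_op F (us @ ws) v = word_op F us (word_op F ws v)"
  by (simp add: word_op_def)

lemma alg_op_add: "alg_op F (p + q) v = alg_op F p v + alg_op F q v"
  and alg_op_diff: "alg_op F (p - q) v = alg_op F p v - alg_op F q v"
  and alg_op_0: "alg_op F 0 v = 0"
  and alg_op_sum: "alg_op F (sum f A) v = (\<Sum>x\<in>A. alg_op F (f x) v)"
  by (simp_all add: alg_op_def lin_add lin_diff lin_sum)

lemma alg_op_add_right: "alg_op F p (v + w) = alg_op F p v + alg_op F p w"
  and alg_op_cscale: "alg_op F p (cscale c v) = cscale c (alg_op F p v)"
  by (simp_all add: alg_op_def lin_def word_op_add word_op_cscale cscale_add_right sum.distrib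
      cscale_sum mult.commute)

lemma alg_op_0_right [simp]: "alg_op F p 0 = 0"
  using alg_op_cscale[of F p 0 0] by simp

lemma alg_op_sum_right: "alg_op F p (sum f A) = (\<Sum>x\<in>A. alg_op F p (f x))"
  by (induction A rule: infinite_finite_induct) (auto simp: alg_op_add_right)

lemma alg_op_single: "alg_op F (Poly_Mapping.single w c) v = cscale c (word_op F (letters w) v)"
  by (simp add: alg_op_def)

lemma alg_op_gen [simp]: "alg_op F (gen g) v = lin (F g) v"
  by (simp add: gen_def alg_op_single word_op_def)

lemma alg_op_scal [simp]: "alg_op F (scal c) v = cscale c v"
  by (simp add: scal_def alg_op_single word_op_def zero_word_def)

lemma one_eq_scal: "1 = (scal 1 :: 'g free_alg)"
  by (simp add: scal_def single_one)

lemma alg_op_1 [simp]: "alg_op F 1 v = v"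
  by (simp add: one_eq_scal)

lemma alg_op_mult: "alg_op F (p * q) v = alg_op F p (alg_op F q v)"
proof -
  let ?s = Poly_Mapping.single and ?l = Poly_Mapping.lookup and ?k = Poly_Mapping.keys
  have 1: "alg_op F (?s u c * ?s w d) v = alg_op F (?s u c) (alg_op F (?s w d) v)" for u w c d
    by (simp add: mult_single alg_op_single plus_word_def word_op_append word_op_cscale)
  have "alg_op F (p * q) v =
    alg_op F ((\<Sum>u\<in>?k p. ?s u (?l p u)) * (\<Sum>w\<in>?k q. ?s w (?l q w))) v"
    using poly_mapping_decompose[of p] poly_mapping_decompose[of q] by simp
  also have "\<dots> = (\<Sum>u\<in>?k p. \<Sum>w\<in>?k q. alg_op F (?s u (?l p u)) (alg_op F (?s w (?l q w)) v))"
    by (simp add: sum_product alg_op_sum 1)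
  also have "\<dots> = alg_op F (\<Sum>u\<in>?k p. ?s u (?l p u)) (alg_op F (\<Sum>w\<in>?k q. ?s w (?l q w)) v)"
    by (subst sum.swap) (simp add: alg_op_sum alg_op_sum_right)
  finally show ?thesis
    using poly_mapping_decompose[of p] poly_mapping_decompose[of q] by simp
qed

lemma alg_op_decompose: "alg_op F p v = lin (\<lambda>t. alg_op F p (Poly_Mapping.single t 1)) v"
proof -
  have "alg_op F p v = alg_op F p (\<Sum>t\<in>Poly_Mapping.keys v. cscale (Poly_Mapping.lookup v t) (Poly_Mapping.single t 1))"
    using poly_mapping_decompose[of v] by simp
  then show ?thesis by (simp only: alg_op_sum_right alg_op_cscale lin_def)
qed

lemma free_alg_on_simps [simp]:
  "mult (free_alg_on G) = times" "one (free_alg_on G) = 1" "zero (free_alg_on G) = 0"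
  "add (free_alg_on G) = plus"
  by (simp_all add: free_alg_on_def)

lemma carrier_free_alg_on:
  "p \<in> carrier (free_alg_on G) \<longleftrightarrow> (\<forall>w\<in>Poly_Mapping.keys p. set (letters w) \<subseteq> G)"
proof -
  have "w \<in> Word ` lists G \<longleftrightarrow> set (letters w) \<subseteq> G" for w
    by (cases w) (auto simp: image_iff)
  then show ?thesis by (auto simp: free_alg_on_def)
qed

lemma carrier_add: "p \<in> carrier (free_alg_on G) \<Longrightarrow> q \<in> carrier (free_alg_on G) \<Longrightarrow> p + q \<in> carrier (free_alg_on G)"
  unfolding carrier_free_alg_on using keys_add[of p q] by blast

lemma carrier_uminus: "p \<in> carrier (free_alg_on G) \<Longrightarrow> - p \<in> carrier (free_alg_on G)"
  by (simp add: carrier_free_alg_on)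

lemma carrier_diff: "p \<in> carrier (free_alg_on G) \<Longrightarrow> q \<in> carrier (free_alg_on G) \<Longrightarrow> p - q \<in> carrier (free_alg_on G)"
  using carrier_add[of p G "- q"] carrier_uminus[of q G] by simp

lemma carrier_mult: "p \<in> carrier (free_alg_on G) \<Longrightarrow> q \<in> carrier (free_alg_on G) \<Longrightarrow> p * q \<in> carrier (free_alg_on G)"
  unfolding carrier_free_alg_on
proof
  fix w assume *: "\<forall>w\<in>Poly_Mapping.keys p. set (letters w) \<subseteq> G" "\<forall>w\<in>Poly_Mapping.keys q. set (letters w) \<subseteq> G"
    "w \<in> Poly_Mapping.keys (p * q)"
  then obtain u u' where "w = u + u'" "u \<in> Poly_Mapping.keys p" "u' \<in> Poly_Mapping.keys q"
    using keys_mult[of p q] by auto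
  then show "set (letters w) \<subseteq> G" using * by (auto simp: plus_word_def)
qed

lemma carrier_scal: "scal c \<in> carrier (free_alg_on G)"
  by (simp add: carrier_free_alg_on scal_def zero_word_def)

lemma carrier_0: "0 \<in> carrier (free_alg_on G)" and carrier_1: "1 \<in> carrier (free_alg_on G)"
  using carrier_scal[of 0 G] carrier_scal[of 1 G] by (simp_all add: scal_def single_one)

lemma carrier_gen: "g \<in> G \<Longrightarrow> gen g \<in> carrier (free_alg_on G)"
  by (simp add: carrier_free_alg_on gen_def)

lemma carrier_sum: "(\<And>x. x \<in> A \<Longrightarrow> f x \<in> carrier (free_alg_on G)) \<Longrightarrow> sum f A \<in> carrier (free_alg_on G)"
  by (induction A rule: infinite_finite_induct) (auto simp: carrier_0 carrier_add)

lemmas carrier_intros = carrier_add carrier_diff carrier_mult carrier_scal carrier_0 carrier_1 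
  carrier_gen carrier_sum carrier_uminus

lemma free_alg_ring: "ring (free_alg_on G)"
proof (rule ringI)
  show "abelian_group (free_alg_on G)"
  proof (rule abelian_groupI)
    fix x assume "x \<in> carrier (free_alg_on G)"
    then show "\<exists>y\<in>carrier (free_alg_on G). y \<oplus>\<^bsub>free_alg_on G\<^esub> x = \<zero>\<^bsub>free_alg_on G\<^esub>"
      by (intro bexI[of _ "- x"]) (auto intro: carrier_intros)
  qed (auto intro: carrier_intros simp: add_ac)
  show "monoid (free_alg_on G)"
    by (rule monoidI) (auto intro: carrier_intros simp: mult.assoc)
qed (auto simp: algebra_simps)

lemma alg_op_free_space:
  assumes "\<And>g t. g \<in> G \<Longrightarrow> t \<in> B \<Longrightarrow> F g t \<in> free_space B" 
    and "p \<in> carrier (free_alg_on G)" "v \<in> free_space B"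
  shows "alg_op F p v \<in> free_space B"
proof -
  have "word_op F ws v \<in> free_space B" if "set ws \<subseteq> G" for ws
    using that assms(3) by (induction ws) (auto simp: word_op_def intro: lin_free_space assms(1))
  then show ?thesis
    unfolding alg_op_def lin_def using assms(2)
    by (intro free_space_sum free_space_cscale) (auto simp: carrier_free_alg_on)
qed

text \<open>An action of the free algebra in which all relators act by zero descends to the quotient, because
  the annihilator of the module is a two-sided ideal that contains the relators.\<close>

locale presentation =
  fixes G :: "'g set" and R :: "'g free_alg set"
  assumes R: "R \<subseteq> carrier (free_alg_on G)"
begin

abbreviation "FA \<equiv> free_alg_on G"
abbreviation "U \<equiv> presented_alg G R"
abbreviation "cl \<equiv> alg_class G R"

sublocale free: ring FA by (rule free_alg_ring)

sublocale ideal "genideal FA R" FA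
  using free.genideal_ideal[OF R] .

lemma cl_hom: "cl \<in> ring_hom FA U"
  unfolding presented_alg_def using rcos_ring_hom by (simp add: alg_class_def[abs_def])

lemma cl_carrier: "p \<in> carrier FA \<Longrightarrow> cl p \<in> carrier U"
  and cl_mult: "p \<in> carrier FA \<Longrightarrow> q \<in> carrier FA \<Longrightarrow> cl (p * q) = cl p \<otimes>\<^bsub>U\<^esub> cl q"
  and cl_add: "p \<in> carrier FA \<Longrightarrow> q \<in> carrier FA \<Longrightarrow> cl (p + q) = cl p \<oplus>\<^bsub>U\<^esub> cl q"
  and cl_one: "cl 1 = \<one>\<^bsub>U\<^esub>"
  using ring_hom_closed[OF cl_hom] ring_hom_mult[OF cl_hom] ring_hom_add[OF cl_hom] ring_hom_one[OF cl_hom]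
  by simp_all

lemma carrier_U: "u \<in> carrier U \<Longrightarrow> \<exists>p\<in>carrier FA. u = cl p"
  by (auto simp: presented_alg_def FactRing_def A_RCOSETS_def' alg_class_def)

lemma cl_self: "p \<in> carrier FA \<Longrightarrow> p \<in> cl p"
  unfolding alg_class_def using a_rcos_self by simp

lemma cl_memD: "q \<in> cl p \<Longrightarrow> \<exists>i\<in>genideal FA R. q = i + p"
  by (auto simp: alg_class_def a_r_coset_def')

text \<open>The action of a coset, through an arbitrary representative.\<close>

definition quot_act :: "('g \<Rightarrow> 'b \<Rightarrow> ('b \<Rightarrow>\<^sub>0 complex)) \<Rightarrow> 'g free_alg set \<Rightarrow> ('b \<Rightarrow>\<^sub>0 complex) \<Rightarrow> ('b \<Rightarrow>\<^sub>0 complex)"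
  where "quot_act F u v = alg_op F (SOME p. p \<in> u) v"

context
  fixes F :: "'g \<Rightarrow> 'b \<Rightarrow> ('b \<Rightarrow>\<^sub>0 complex)" and B :: "'b set"
  assumes F: "\<And>g t. g \<in> G \<Longrightarrow> t \<in> B \<Longrightarrow> F g t \<in> free_space B"
    and rel: "\<And>p t. p \<in> R \<Longrightarrow> t \<in> B \<Longrightarrow> alg_op F p (Poly_Mapping.single t 1) = 0"
begin

lemma annihilator_ideal: "ideal {p \<in> carrier FA. \<forall>v\<in>free_space B. alg_op F p v = 0} FA"
proof (rule idealI[OF free_alg_ring])
  let ?I = "{p \<in> carrier FA. \<forall>v\<in>free_space B. alg_op F p v = 0}"
  show "subgroup ?I (add_monoid FA)"
  proof (rule group.subgroupI[OF free.a_group])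
    show "?I \<noteq> {}" using carrier_0[of G] by (auto simp: alg_op_0)
    fix p assume p: "p \<in> ?I"
    have "inv\<^bsub>add_monoid FA\<^esub> p = - p"
      using free.minus_equality[of "- p" p] p carrier_uminus[of p G] by (simp add: a_inv_def)
    moreover have "alg_op F (- p) v = - alg_op F p v" for v
      using alg_op_diff[of F 0 p v] by (simp add: alg_op_0)
    ultimately show "inv\<^bsub>add_monoid FA\<^esub> p \<in> ?I"
      using p carrier_uminus[of p G] by simp
  qed (auto simp: alg_op_add intro: carrier_intros)
qed (auto simp: alg_op_mult intro: carrier_intros alg_op_free_space F)

lemma genideal_acts_trivially:
  assumes "p \<in> genideal FA R" "v \<in> free_space B"
  shows "alg_op F p v = 0"
proof -
  have "alg_op F p v = 0" if "p \<in> R" "v \<in> free_space B" for p v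
    unfolding alg_op_decompose[of F p v] by (rule lin_0_on[OF _ that(2)]) (rule rel[OF that(1)])
  then have "R \<subseteq> {p \<in> carrier FA. \<forall>v\<in>free_space B. alg_op F p v = 0}"
    using R by auto
  from free.genideal_minimal[OF annihilator_ideal this] show ?thesis
    using assms by auto
qed

lemma quot_act_cl:
  assumes "p \<in> carrier FA" "v \<in> free_space B"
  shows "quot_act F (cl p) v = alg_op F p v"
proof -
  have "(SOME q. q \<in> cl p) \<in> cl p" using cl_self[OF assms(1)] by (rule someI)
  then obtain i where "i \<in> genideal FA R" "(SOME q. q \<in> cl p) = i + p"
    using cl_memD by blast
  then show ?thesis
    using genideal_acts_trivially assms(2) by (simp add: quot_act_def alg_op_add)
qed

lemma quot_act_module: "is_left_module U (\<lambda>c. cl (scal c)) (free_space B) (quot_act F)"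
proof -
  note inv = alg_op_free_space[of G B F, OF F]
  show ?thesis
    unfolding is_left_module_def
  proof (intro conjI ballI allI)
    show "cvec.subspace (free_space B)" by (rule free_space_subspace)
    show "quot_act F \<one>\<^bsub>U\<^esub> v = v" if "v \<in> free_space B" for v
      using that by (simp add: cl_one[symmetric] quot_act_cl carrier_1)
    show "quot_act F (cl (scal c)) v = cscale c v" if "v \<in> free_space B" for c v
      using that by (simp add: quot_act_cl carrier_scal)
  next
    fix u v assume u: "u \<in> carrier U" and v: "v \<in> free_space B"
    obtain p where p: "p \<in> carrier FA" "u = cl p" using carrier_U[OF u] by blast
    show "quot_act F u v \<in> free_space B"
      using inv[OF _ _ p(1) v] by (simp add: p(2) quot_act_cl[OF p(1) v])
    show "quot_act F u (v + w) = quot_act F u v + quot_act F u w" if w: "w \<in> free_space B" for w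
      unfolding p(2) quot_act_cl[OF p(1) v] quot_act_cl[OF p(1) w] 
        quot_act_cl[OF p(1) free_space_add[OF v w]] by (rule alg_op_add_right)
    fix u' assume u': "u' \<in> carrier U"
    obtain q where q: "q \<in> carrier FA" "u' = cl q" using carrier_U[OF u'] by blast
    show "quot_act F (u \<oplus>\<^bsub>U\<^esub> u') v = quot_act F u v + quot_act F u' v"
      unfolding p(2) q(2) cl_add[OF p(1) q(1), symmetric] quot_act_cl[OF p(1) v] quot_act_cl[OF q(1) v]
        quot_act_cl[OF carrier_add[OF p(1) q(1)] v] by (rule alg_op_add)
    have qv: "alg_op F q v \<in> free_space B" using inv[OF _ _ q(1) v] by simp
    show "quot_act F (u \<otimes>\<^bsub>U\<^esub> u') v = quot_act F u (quot_act F u' v)"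
      unfolding p(2) q(2) cl_mult[OF p(1) q(1), symmetric] quot_act_cl[OF q(1) v]
        quot_act_cl[OF p(1) qv] quot_act_cl[OF carrier_mult[OF p(1) q(1)] v] by (rule alg_op_mult)
  qed
qed

end
end

section \<open>Tableaux as closed paths of heights\<close>

lemma strict_sorted_nth_less_iff:
  fixes T :: "nat list"
  assumes "sorted_wrt (<) T" "p < length T" "q < length T"
  shows "T ! p \<le> T ! q \<longleftrightarrow> p \<le> q"
  using assms
  by (metis linorder_neqE_nat nle_le not_less order_less_imp_le sorted_wrt_iff_nth_less)

lemma pos_eq_card:
  assumes "sorted_wrt (<) T" "j \<in> set T"
  shows "pos T j = card {x \<in> set T. x \<le> j}"
proof -
  obtain q where q: "q < length T" "T ! q = j"
    using assms by (auto simp: in_set_conv_nth)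
  have "{x \<in> set T. x \<le> j} = (!) T ` {..q}"
  proof (intro equalityI subsetI)
    fix x assume "x \<in> {x \<in> set T. x \<le> j}"
    then obtain p where "p < length T" "x = T ! p" "T ! p \<le> T ! q"
      using q by (auto simp: in_set_conv_nth)
    then show "x \<in> (!) T ` {..q}"
      using strict_sorted_nth_less_iff[OF assms(1)] q by auto
  next
    fix x assume "x \<in> (!) T ` {..q}"
    then show "x \<in> {x \<in> set T. x \<le> j}"
      using strict_sorted_nth_less_iff[OF assms(1)] q by auto
  qed
  moreover have "inj_on ((!) T) {..q}"
    using assms(1) q by (auto simp: inj_on_def nth_eq_iff_index_eq strict_sorted_iff)
  ultimately have card: "card {x \<in> set T. x \<le> j} = Suc q"
    by (simp add: card_image)
  have "pos T j = Suc q"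
    unfolding pos_def
  proof (rule the_equality)
    show "1 \<le> Suc q \<and> Suc q \<le> length T \<and> T ! (Suc q - 1) = j"
      using q by simp
    fix p assume p: "1 \<le> p \<and> p \<le> length T \<and> T ! (p - 1) = j"
    then have "p - 1 < length T" "T ! (p - 1) = T ! q" using q by auto
    then have "p - 1 = q"
      using assms(1) q nth_eq_iff_index_eq[of T "p - 1" q] by (simp add: strict_sorted_iff)
    then show "p = Suc q" using p by linarith
  qed
  with card show ?thesis by simp
qed

lemma card_le_exchange:
  fixes S :: "nat set"
  assumes "finite S" "a \<notin> S" "b \<in> S"
  shows "int (card {x \<in> insert a (S - {b}). x \<le> j}) =
    int (card {x \<in> S. x \<le> j}) + of_bool (a \<le> j) - of_bool (b \<le> j)"
proof -
  define A where "A = {x \<in> S - {b}. x \<le> j}"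
  have 1: "{x \<in> insert a (S - {b}). x \<le> j} = (if a \<le> j then insert a A else A)"
    by (auto simp: A_def)
  have 2: "{x \<in> S. x \<le> j} = (if b \<le> j then insert b A else A)"
    using assms by (auto simp: A_def)
  have "finite A" "a \<notin> A" "b \<notin> A"
    using assms by (auto simp: A_def)
  then show ?thesis
    unfolding 1 2 by simp
qed

text \<open>The successor of a node on the cyclic diagram.\<close>

definition nxt :: "nat \<Rightarrow> nat \<Rightarrow> nat"
  where "nxt n i = (i + 1) mod (n + 1)"

text \<open>Entries of a tableau are read modulo $n + 1$: the entry $n + 1$ occupies the node 0.\<close>

definition occ :: "nat \<Rightarrow> box \<Rightarrow> nat \<Rightarrow> bool"
  where "occ n B i \<longleftrightarrow> (if i = 0 then n + 1 else i) \<in> set (fst B)"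

text \<open>The position $p$ of the moved entry in a spectral point is replaced by a count that makes sense at
  every node: an entry $i + 1$ that can be lowered has position $\#\{x \in T : x \le i\} + 1$.\<close>

definition height :: "complex \<Rightarrow> box \<Rightarrow> nat \<Rightarrow> complex"
  where "height \<epsilon> B i = snd B * \<epsilon> powi (int i - 2 * int (card {x \<in> set (fst B). x \<le> i}))"

lemma nxt_le [simp]: "nxt n i \<le> n"
  by (simp add: nxt_def less_Suc_eq_le[symmetric])

lemma nxt_eq: "i \<le> n \<Longrightarrow> nxt n i = (if i = n then 0 else i + 1)"
  by (auto simp: nxt_def)

lemma occ_0: "occ n B 0 \<longleftrightarrow> n + 1 \<in> set (fst B)"
  by (simp add: occ_def)

lemma occ_pos: "i \<noteq> 0 \<Longrightarrow> occ n B i \<longleftrightarrow> i \<in> set (fst B)"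
  by (simp add: occ_def)

lemma occ_nxt: "i \<le> n \<Longrightarrow> occ n B (nxt n i) \<longleftrightarrow> i + 1 \<in> set (fst B)"
  by (auto simp: nxt_eq occ_def)

text \<open>The path has a local maximum (\<open>Pos\<close>) or minimum (\<open>Neg\<close>) at \<open>i\<close>.\<close>

definition movable :: "nat \<Rightarrow> sign \<Rightarrow> box \<Rightarrow> nat \<Rightarrow> bool"
  where "movable n s B i \<longleftrightarrow> occ n B i = (s = Neg) \<and> occ n B (nxt n i) = (s = Pos)"

text \<open>The spectral point of a move: the height before \<open>Pos\<close> and after \<open>Neg\<close>, so that a move
  and its inverse act at the same point.\<close>

definition weight_pt :: "complex \<Rightarrow> sign \<Rightarrow> box \<Rightarrow> nat \<Rightarrow> complex"
  where "weight_pt \<epsilon> s B i = height \<epsilon> B i * \<epsilon> powi (1 - sg s)"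

definition moves_to :: "nat \<Rightarrow> complex \<Rightarrow> sign \<Rightarrow> nat \<Rightarrow> box \<Rightarrow> box \<Rightarrow> bool"
  where "moves_to n \<epsilon> s i B v \<longleftrightarrow>
    (\<forall>j\<le>n. occ n v j = (if j = i then s = Pos else if j = nxt n i then s = Neg else occ n B j)) \<and>
    (\<forall>j\<le>n. height \<epsilon> v j = (if j = i then height \<epsilon> B i * \<epsilon> powi (- 2 * sg s) else height \<epsilon> B j))"

text \<open>Only the moves at the node 0 change the parameter $b$.\<close>

definition shifted :: "complex \<Rightarrow> sign \<Rightarrow> nat \<Rightarrow> complex \<Rightarrow> complex"
  where "shifted \<epsilon> s i b = (if i = 0 then b * \<epsilon> powi (- 2 * sg s) else b)"

locale tableau_boxes =
  fixes r n L :: nat and \<epsilon> :: complex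
  assumes r: "r \<ge> 1" and n: "n = 2 * r + 1"
    and L: "L > 1" and eps: "primitive_root (2 * L) \<epsilon>"
begin

lemma eps_nz: "\<epsilon> \<noteq> 0"
proof
  assume "\<epsilon> = 0"
  then show False using eps L by (simp add: primitive_root_def power_0_left)
qed

lemma eps_sq: "\<epsilon> ^ 2 \<noteq> 1"
  using eps L by (auto simp: primitive_root_def)

lemma inv_eps_sq: "inverse \<epsilon> ^ 2 \<noteq> 1"
  using eps_sq by (metis inverse_1 inverse_inverse_eq power_inverse)

lemma eps_neq: "\<epsilon> \<noteq> inverse \<epsilon>"
  using eps_sq eps_nz by (auto simp: field_simps power2_eq_square)

abbreviation tabs :: "nat list set" where "tabs \<equiv> column_tableaux n (r + 1)"

lemma tabsD:
  assumes "T \<in> tabs"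
  shows "length T = r + 1" "T \<noteq> []" "distinct T" "sorted_wrt (<) T" "\<And>x. x \<in> set T \<Longrightarrow> 1 \<le> x \<and> x \<le> n + 1"
    "card (set T) = r + 1"
  using assms by (auto simp: column_tableaux_def strict_sorted_iff distinct_card)

lemma hd_tab_iff:
  assumes "T \<in> tabs"
  shows "hd T = 1 \<longleftrightarrow> 1 \<in> set T"
  using tabsD[OF assms] by (cases T) force+

lemma last_tab_iff:
  assumes "T \<in> tabs"
  shows "last T = n + 1 \<longleftrightarrow> n + 1 \<in> set T"
proof -
  have "T = butlast T @ [last T]"
    using tabsD(2)[OF assms] by simp
  then have "\<forall>x\<in>set (butlast T). x < last T"
    using tabsD(4)[OF assms] by (metis sorted_wrt_append list.set_intros(1))
  moreover have "set T = insert (last T) (set (butlast T))"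
    using tabsD(2)[OF assms] by (metis append_butlast_last_id list.simps(15) rotate1.simps(2) set_rotate1)
  ultimately show ?thesis
    using tabsD(5)[OF assms] by fastforce
qed

text \<open>In terms of the set of entries, the node 0 is no exception: one entry is exchanged for
  another one. The same holds for the inverse move below.\<close>

lemma e_til_Some:
  assumes T: "T \<in> tabs" and i: "i \<le> n" and occ: "\<not> occ n (T, b) i" "occ n (T, b) (nxt n i)"
  obtains T' where "e_til n i T = Some T'" "T' \<in> tabs"
    "set T' = insert (if i = 0 then n + 1 else i) (set T - {i + 1})"
proof (cases "i = 0")
  case True
  have T1: "1 \<in> set T" "n + 1 \<notin> set T"
    using occ i True by (simp_all add: occ_nxt occ_0)
  then have hl: "hd T = 1" "last T \<noteq> n + 1"
    using hd_tab_iff[OF T] last_tab_iff[OF T] by auto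
  obtain T0 where T0: "T = 1 # T0"
    using hl tabsD(2)[OF T] by (cases T) auto
  have "x < n + 1" if "x \<in> set T0" for x
  proof -
    have "x \<in> set T" using that T0 by simp
    then show ?thesis using tabsD(5)[OF T, of x] T1 by (cases "x = n + 1") auto
  qed
  then have "T0 @ [n + 1] \<in> tabs"
    using T unfolding T0 column_tableaux_def by (auto simp: sorted_wrt_append)
  moreover have "set (T0 @ [n + 1]) = insert (n + 1) (set T - {1})"
    using tabsD(3)[OF T] T0 by auto
  ultimately show ?thesis
    using that[of "T0 @ [n + 1]"] True hl T0 by (simp add: e_til_def)
next
  case False
  have T1: "i + 1 \<in> set T" "i \<notin> set T"
    using occ i False by (simp_all add: occ_nxt occ_pos)
  let ?f = "\<lambda>j. if j = i + 1 then i else j"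
  have set: "set (map ?f T) = insert i (set T - {i + 1})"
    using T1 by auto
  have "sorted_wrt (<) (map ?f T)"
    unfolding sorted_wrt_map
  proof (rule sorted_wrt_mono_rel[OF _ tabsD(4)[OF T]])
    fix x y assume "x \<in> set T" "y \<in> set T" "x < y"
    moreover from this have "x \<noteq> i" "y \<noteq> i"
      using T1 by auto
    ultimately show "?f x < ?f y"
      by auto
  qed
  moreover have "set (map ?f T) \<subseteq> {1..n + 1}"
    unfolding set using tabsD(5)[OF T] False i by auto
  ultimately have "map ?f T \<in> tabs"
    using tabsD(1)[OF T] unfolding column_tableaux_def by simp
  then show ?thesis
    using that[of "map ?f T"] False set T1 by (simp add: e_til_def)
qed

lemma f_til_Some:
  assumes T: "T \<in> tabs" and i: "i \<le> n" and occ: "occ n (T, b) i" "\<not> occ n (T, b) (nxt n i)"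
  obtains T' where "f_til n i T = Some T'" "T' \<in> tabs"
    "set T' = insert (i + 1) (set T - {if i = 0 then n + 1 else i})"
proof (cases "i = 0")
  case True
  have T1: "1 \<notin> set T" "n + 1 \<in> set T"
    using occ i True by (simp_all add: occ_nxt occ_0)
  then have hl: "hd T \<noteq> 1" "last T = n + 1"
    using hd_tab_iff[OF T] last_tab_iff[OF T] by auto
  obtain T0 where T0: "T = T0 @ [n + 1]"
    using hl tabsD(2)[OF T] append_butlast_last_id[of T] by metis
  have "1 < x" if "x \<in> set T0" for x
  proof -
    have "x \<in> set T" using that T0 by simp
    then show ?thesis using tabsD(5)[OF T, of x] T1 by (cases "x = 1") auto
  qed
  then have "1 # T0 \<in> tabs"
    using T unfolding T0 column_tableaux_def by (auto simp: sorted_wrt_append)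
  moreover have "set (1 # T0) = insert 1 (set T - {n + 1})"
    using tabsD(3)[OF T] T0 by auto
  ultimately show ?thesis
    using that[of "1 # T0"] True hl T0 by (simp add: f_til_def)
next
  case False
  have T1: "i \<in> set T" "i + 1 \<notin> set T"
    using occ i False by (simp_all add: occ_nxt occ_pos)
  let ?f = "\<lambda>j. if j = i then i + 1 else j"
  have set: "set (map ?f T) = insert (i + 1) (set T - {i})"
    using T1 by auto
  have "sorted_wrt (<) (map ?f T)"
    unfolding sorted_wrt_map
  proof (rule sorted_wrt_mono_rel[OF _ tabsD(4)[OF T]])
    fix x y assume "x \<in> set T" "y \<in> set T" "x < y"
    moreover from this have "x \<noteq> i + 1" "y \<noteq> i + 1"
      using T1 by auto
    ultimately show "?f x < ?f y"
      by auto
  qed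
  moreover have "set (map ?f T) \<subseteq> {1..n + 1}"
    unfolding set using tabsD(5)[OF T] False i by auto
  ultimately have "map ?f T \<in> tabs"
    using tabsD(1)[OF T] unfolding column_tableaux_def by simp
  then show ?thesis
    using that[of "map ?f T"] False set T1 by (simp add: f_til_def)
qed

lemma e_til_None:
  assumes "T \<in> tabs" "i \<le> n" "\<not> (\<not> occ n (T, b) i \<and> occ n (T, b) (nxt n i))"
  shows "e_til n i T = None"
  using assms hd_tab_iff[of T] last_tab_iff[of T]
  by (cases "i = 0") (auto simp: e_til_def occ_nxt occ_0 occ_pos)

lemma f_til_None:
  assumes "T \<in> tabs" "i \<le> n" "\<not> (occ n (T, b) i \<and> \<not> occ n (T, b) (nxt n i))"
  shows "f_til n i T = None"
  using assms hd_tab_iff[of T] last_tab_iff[of T]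
  by (cases "i = 0") (auto simp: f_til_def occ_nxt occ_0 occ_pos)

lemma powi_add': "\<epsilon> powi (a + b) = \<epsilon> powi a * \<epsilon> powi b"
  using eps_nz by (simp add: power_int_add)

lemma powi_eq: "x = y \<Longrightarrow> b * \<epsilon> powi x = b * \<epsilon> powi y" by simp

lemma box_x_None:
  assumes "T \<in> tabs" "i \<le> n" "\<not> movable n s (T, b) i"
  shows "box_x n \<epsilon> s i (T, b) = None"
  using assms e_til_None[of T i b] f_til_None[of T i b] by (cases s) (auto simp: movable_def)

lemma card_le_0: "T \<in> tabs \<Longrightarrow> card {x \<in> set T. x \<le> 0} = 0"
  using tabsD(5)[of T 0] by (auto simp: card_eq_0_iff)

lemma card_le_top: "T \<in> tabs \<Longrightarrow> card {x \<in> set T. x \<le> n + 1} = r + 1"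
proof -
  assume T: "T \<in> tabs"
  then have "{x \<in> set T. x \<le> n + 1} = set T" using tabsD(5)[OF T] by auto
  then show ?thesis using tabsD(6)[OF T] by simp
qed

lemma card_le_Suc:
  "card {x \<in> set T. x \<le> Suc i} = card {x \<in> set T. x \<le> i} + of_bool (Suc i \<in> set T)"
proof (cases "Suc i \<in> set T")
  case True
  then have "{x \<in> set T. x \<le> Suc i} = insert (Suc i) {x \<in> set T. x \<le> i}" by auto
  then show ?thesis using True by simp
next
  case False
  then have "{x \<in> set T. x \<le> Suc i} = {x \<in> set T. x \<le> i}" by (auto simp: le_Suc_eq)
  then show ?thesis using False by simp
qed

lemma height_0: "T \<in> tabs \<Longrightarrow> height \<epsilon> (T, b) 0 = b"
  by (simp only: height_def fst_conv snd_conv card_le_0) simp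

text \<open>At the last node the exponent is $n + 1 - 2(r + 1) = 0$, so the path closes up.\<close>

lemma height_nxt:
  assumes "T \<in> tabs" "i \<le> n"
  shows "height \<epsilon> (T, b) (nxt n i) = 
    height \<epsilon> (T, b) i * (if occ n (T, b) (nxt n i) then inverse \<epsilon> else \<epsilon>)"
proof -
  have step: "b * \<epsilon> powi (int (Suc i) - 2 * int (card {x \<in> set T. x \<le> Suc i})) =
    height \<epsilon> (T, b) i * (if occ n (T, b) (nxt n i) then inverse \<epsilon> else \<epsilon>)"
  proof -
    have "\<epsilon> powi (int (Suc i) - 2 * int (card {x \<in> set T. x \<le> Suc i})) =
      \<epsilon> powi ((int i - 2 * int (card {x \<in> set T. x \<le> i})) + (if Suc i \<in> set T then - 1 else 1))"
      unfolding card_le_Suc by (rule arg_cong[of _ _ "\<lambda>x. \<epsilon> powi x"]) auto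
    then show ?thesis
      using assms by (auto simp: powi_add' height_def occ_nxt power_int_minus)
  qed
  show ?thesis
  proof (cases "i = n")
    case True
    have "int (Suc n) - 2 * int (card {x \<in> set T. x \<le> Suc n}) = 0"
      using card_le_top[OF assms(1)] n by simp
    then have "b = height \<epsilon> (T, b) n * (if occ n (T, b) (nxt n n) then inverse \<epsilon> else \<epsilon>)"
      using step unfolding True by simp
    then show ?thesis
      using True height_0[OF assms(1), of b] by (simp add: nxt_eq)
  next
    case False
    then show ?thesis
      using step assms by (simp add: nxt_eq height_def)
  qed
qed

text \<open>A basis vector is recovered from its path: the occupied nodes give the entries, and the
  height at 0 is $b$.\<close>

lemma box_eqI:
  assumes "T \<in> tabs" "T' \<in> tabs" "\<And>i. i \<le> n \<Longrightarrow> occ n (T, b) i = occ n (T', b') i"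
    and "height \<epsilon> (T, b) 0 = height \<epsilon> (T', b') 0"
  shows "(T, b) = (T', b')"
proof -
  have "x \<in> set T \<longleftrightarrow> x \<in> set T'" for x
  proof (cases "1 \<le> x \<and> x \<le> n + 1")
    case True
    then show ?thesis
      using assms(3)[of 0] assms(3)[of x] by (cases "x = n + 1") (auto simp: occ_0 occ_pos)
  next
    case False
    then show ?thesis using tabsD(5)[OF assms(1)] tabsD(5)[OF assms(2)] by blast
  qed
  then have "T = T'"
    using tabsD(4)[OF assms(1)] tabsD(4)[OF assms(2)]
    by (intro strict_sorted_equal) auto
  then show ?thesis
    using assms height_0 by simp
qed

text \<open>A move at \<open>i\<close> changes the path only at \<open>i\<close>. At the node 0 all
  positions shift by one, and the change of the parameter $b$ compensates for this in the
  other heights.\<close>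

lemma box_x_movable:
  assumes T: "T \<in> tabs" and i: "i \<le> n" and m: "movable n s (T, b) i"
  obtains T' where "box_x n \<epsilon> s i (T, b) = Some (weight_pt \<epsilon> s (T, b) i, (T', shifted \<epsilon> s i b))"
    "T' \<in> tabs" "moves_to n \<epsilon> s i (T, b) (T', shifted \<epsilon> s i b)"
proof -
  let ?i = "if i = 0 then n + 1 else i"
  have nn: "n \<noteq> 0" "n \<ge> 3" using n r by auto
  have 0: "0 \<notin> set T" "n + 2 \<notin> set T" using tabsD(5)[OF T] by force+
  show ?thesis
  proof (cases s)
    case Pos
    have occ: "\<not> occ n (T, b) i" "occ n (T, b) (nxt n i)"
      using m Pos by (auto simp: movable_def)
    obtain T' where T': "e_til n i T = Some T'" "T' \<in> tabs" "set T' = insert ?i (set T - {i + 1})"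
      using e_til_Some[OF T i occ] by metis
    have ab: "?i \<notin> set T" "i + 1 \<in> set T"
      using occ i by (auto simp: occ_nxt) (auto simp: occ_def)
    note ex = card_le_exchange[OF finite_set ab, folded T'(3)]
    have "moves_to n \<epsilon> s i (T, b) (T', shifted \<epsilon> s i b)"
      unfolding moves_to_def
    proof (intro conjI allI impI)
      fix j assume j: "j \<le> n"
      show "occ n (T', shifted \<epsilon> s i b) j =
        (if j = i then s = Pos else if j = nxt n i then s = Neg else occ n (T, b) j)"
        using j i nn Pos ab by (auto simp: occ_def T'(3) nxt_eq)
      have e: "int (card {x \<in> set T'. x \<le> j}) = int (card {x \<in> set T. x \<le> j}) + 
          (if i = 0 then (if j = 0 then 0 else - 1) else if j = i then 1 else 0)"
        unfolding ex using j i by auto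
      show "height \<epsilon> (T', shifted \<epsilon> s i b) j =
         (if j = i then height \<epsilon> (T, b) i * \<epsilon> powi (- 2 * sg s) else height \<epsilon> (T, b) j)"
      proof -
        have "height \<epsilon> (T', shifted \<epsilon> s i b) j =
            b * \<epsilon> powi (- 2 * sg s * of_bool (i = 0) + (int j - 2 * int (card {x \<in> set T'. x \<le> j})))"
          unfolding powi_add' by (simp add: height_def shifted_def)
        also have "\<dots> = b * \<epsilon> powi ((int j - 2 * int (card {x \<in> set T. x \<le> j})) + - 2 * sg s * of_bool (j = i))"
          using Pos by (intro powi_eq) (simp add: e)
        also have "\<dots> = (if j = i then height \<epsilon> (T, b) i * \<epsilon> powi (- 2 * sg s) else height \<epsilon> (T, b) j)"
          unfolding powi_add' by (simp add: height_def)
        finally show ?thesis .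
      qed
    qed
    moreover have "pos T (i + 1) = card {x \<in> set T. x \<le> i} + 1"
      using pos_eq_card[OF tabsD(4)[OF T] ab(2)] card_le_Suc[of T i] ab(2) by simp
    then have "box_x n \<epsilon> s i (T, b) = Some (weight_pt \<epsilon> s (T, b) i, (T', shifted \<epsilon> s i b))"
      using T' Pos height_0[OF T, of b] 
      by (auto simp: weight_pt_def shifted_def) (simp add: height_def)
    ultimately show ?thesis using that T' by blast
  next
    case Neg
    have occ: "occ n (T, b) i" "\<not> occ n (T, b) (nxt n i)"
      using m Neg by (auto simp: movable_def)
    obtain T' where T': "f_til n i T = Some T'" "T' \<in> tabs" "set T' = insert (i + 1) (set T - {?i})"
      using f_til_Some[OF T i occ] by metis
    have ab: "i + 1 \<notin> set T" "?i \<in> set T"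
      using occ i by (auto simp: occ_nxt) (auto simp: occ_def)
    note ex = card_le_exchange[OF finite_set ab, folded T'(3)]
    have "moves_to n \<epsilon> s i (T, b) (T', shifted \<epsilon> s i b)"
      unfolding moves_to_def
    proof (intro conjI allI impI)
      fix j assume j: "j \<le> n"
      show "occ n (T', shifted \<epsilon> s i b) j =
        (if j = i then s = Pos else if j = nxt n i then s = Neg else occ n (T, b) j)"
        using j i nn Neg ab 0 by (auto simp: occ_def T'(3) nxt_eq split: if_splits)
      have e: "int (card {x \<in> set T'. x \<le> j}) = int (card {x \<in> set T. x \<le> j}) + 
          (if i = 0 then (if j = 0 then 0 else 1) else if j = i then - 1 else 0)"
        unfolding ex using j i by auto
      show "height \<epsilon> (T', shifted \<epsilon> s i b) j =
         (if j = i then height \<epsilon> (T, b) i * \<epsilon> powi (- 2 * sg s) else height \<epsilon> (T, b) j)"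
      proof -
        have "height \<epsilon> (T', shifted \<epsilon> s i b) j =
            b * \<epsilon> powi (- 2 * sg s * of_bool (i = 0) + (int j - 2 * int (card {x \<in> set T'. x \<le> j})))"
          unfolding powi_add' by (simp add: height_def shifted_def)
        also have "\<dots> = b * \<epsilon> powi ((int j - 2 * int (card {x \<in> set T. x \<le> j})) + - 2 * sg s * of_bool (j = i))"
          using Neg by (intro powi_eq) (simp add: e)
        also have "\<dots> = (if j = i then height \<epsilon> (T, b) i * \<epsilon> powi (- 2 * sg s) else height \<epsilon> (T, b) j)"
          unfolding powi_add' by (simp add: height_def)
        finally show ?thesis .
      qed
    qed
    moreover have "i \<noteq> 0 \<Longrightarrow> pos T i = card {x \<in> set T. x \<le> i}"
      using pos_eq_card[OF tabsD(4)[OF T]] ab(2) by simp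
    then have "box_x n \<epsilon> s i (T, b) = Some (weight_pt \<epsilon> s (T, b) i, (T', shifted \<epsilon> s i b))"
      using T' Neg height_0[OF T, of b] 
      by (auto simp: weight_pt_def shifted_def) (simp add: height_def powi_add')
    ultimately show ?thesis using that T' by blast
  qed
qed

end

section \<open>Local properties of the moves\<close>

fun opp :: "sign \<Rightarrow> sign" where
  "opp Pos = Neg"
| "opp Neg = Pos"

lemma opp_opp [simp]: "opp (opp s) = s" by (cases s) auto
lemma sg_opp [simp]: "sg (opp s) = - sg s" by (cases s) auto
lemma opp_neq [simp]: "opp s \<noteq> s" "s \<noteq> opp s" by (cases s; simp)+

lemma adjacent_iff: "adjacent n i j \<longleftrightarrow> j = nxt n i \<or> i = nxt n j"
  by (simp add: adjacent_def nxt_def)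

lemma adjacent_sym: "adjacent n i j \<longleftrightarrow> adjacent n j i"
  by (auto simp: adjacent_def)

lemma cartan_sym: "cartan n i j = cartan n j i"
  by (simp add: cartan_def adjacent_sym)

lemma nxt_inj: "i \<le> n \<Longrightarrow> j \<le> n \<Longrightarrow> nxt n i = nxt n j \<longleftrightarrow> i = j"
  by (auto simp: nxt_eq)

lemma moves_toD:
  assumes "moves_to n \<epsilon> s i B v" "j \<le> n"
  shows "occ n v j = (if j = i then s = Pos else if j = nxt n i then s = Neg else occ n B j)"
    "height \<epsilon> v j = (if j = i then height \<epsilon> B i * \<epsilon> powi (- 2 * sg s) else height \<epsilon> B j)"
  using assms unfolding moves_to_def by blast+

context tableau_boxes
begin

abbreviation bx :: "sign \<Rightarrow> nat \<Rightarrow> box \<Rightarrow> (complex \<times> box) option" where "bx \<equiv> box_x n \<epsilon>"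

definition boxes :: "box set" where "boxes = tabs \<times> (- {0})"

lemma eps_sq_cancel: "\<epsilon> powi - 2 * \<epsilon>\<^sup>2 = 1" "\<epsilon>\<^sup>2 * \<epsilon> powi - 2 = 1"
  using eps_nz by (simp_all add: power_int_minus)

lemma n_ge: "n \<ge> 3" using n r by simp

lemma nxt_neq: "i \<le> n \<Longrightarrow> nxt n i \<noteq> i" "i \<le> n \<Longrightarrow> nxt n (nxt n i) \<noteq> i"
  using n_ge by (auto simp: nxt_eq)

lemma adjacent_neq: "adjacent n i j \<Longrightarrow> i \<le> n \<Longrightarrow> j \<le> n \<Longrightarrow> i \<noteq> j"
  using nxt_neq(1) by (metis adjacent_iff)

lemma boxes_eqI:
  assumes "B \<in> boxes" "B' \<in> boxes" "\<And>i. i \<le> n \<Longrightarrow> occ n B i = occ n B' i"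
    and "height \<epsilon> B 0 = height \<epsilon> B' 0"
  shows "B = B'"
  using assms box_eqI[of "fst B" "fst B'" "snd B" "snd B'"] by (auto simp: boxes_def)

lemma box_x_iff:
  assumes B: "B \<in> boxes" and i: "i \<le> n"
  shows "bx s i B = Some (c, v) \<longleftrightarrow>
    movable n s B i \<and> c = weight_pt \<epsilon> s B i \<and> v \<in> boxes \<and> moves_to n \<epsilon> s i B v"
proof (cases "movable n s B i")
  case True
  obtain T b where TB: "B = (T, b)" "T \<in> tabs" using B by (auto simp: boxes_def)
  obtain T' where T': "bx s i B = Some (weight_pt \<epsilon> s B i, (T', shifted \<epsilon> s i b))"
    "T' \<in> tabs" "moves_to n \<epsilon> s i B (T', shifted \<epsilon> s i b)"
    using box_x_movable[OF TB(2) i, of s b] True TB by metis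
  have v: "(T', shifted \<epsilon> s i b) \<in> boxes"
    using T' B TB eps_nz by (simp add: boxes_def shifted_def)
  have "v = (T', shifted \<epsilon> s i b)" if "v \<in> boxes" "moves_to n \<epsilon> s i B v"
    using boxes_eqI[OF that(1) v] moves_toD[OF that(2)] moves_toD[OF T'(3)] by simp
  then show ?thesis using True T' v by auto
next
  case False
  then show ?thesis using box_x_None[of "fst B" i s "snd B"] i B by (auto simp: boxes_def)
qed

lemma box_x_ex_iff:
  assumes "B \<in> boxes" "i \<le> n"
  shows "(\<exists>v. bx s i B = Some (c, v)) \<longleftrightarrow> movable n s B i \<and> c = weight_pt \<epsilon> s B i"
proof
  assume "movable n s B i \<and> c = weight_pt \<epsilon> s B i"
  then show "\<exists>v. bx s i B = Some (c, v)"
    using box_x_movable[of "fst B" i s "snd B"] assms by (auto simp: boxes_def) metis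
qed (use box_x_iff assms in blast)

lemma box_x_None_iff:
  assumes "B \<in> boxes" "i \<le> n"
  shows "bx s i B = None \<longleftrightarrow> \<not> movable n s B i"
  using box_x_ex_iff[OF assms, of s] by (metis not_None_eq surj_pair)

lemma slope:
  assumes "B \<in> boxes" "i \<le> n"
  shows "height \<epsilon> B (nxt n i) = height \<epsilon> B i * (if occ n B (nxt n i) then inverse \<epsilon> else \<epsilon>)"
  using height_nxt[of "fst B" i "snd B"] assms by (auto simp: boxes_def)

lemma box_x_boxes: "bx s i B = Some (c, v) \<Longrightarrow> B \<in> boxes \<Longrightarrow> i \<le> n \<Longrightarrow> v \<in> boxes"
  using box_x_iff by blast

text \<open>A move turns a maximum into a minimum at the same spectral point, and conversely.\<close>

lemma box_x_inverse:
  assumes B: "B \<in> boxes" "i \<le> n" and x: "bx s i B = Some (c, v)"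
  shows "bx (opp s) i v = Some (c, B)"
proof -
  note xs = box_x_iff[OF B, of s c v, THEN iffD1, OF x]
  have v: "v \<in> boxes" and mv: "moves_to n \<epsilon> s i B v" using xs by auto
  note D = moves_toD[OF mv]
  have nn: "nxt n i \<noteq> i" "nxt n i \<le> n" using nxt_neq B by auto
  have "movable n (opp s) v i"
    using D B nn by (cases s) (auto simp: movable_def)
  moreover have "c = weight_pt \<epsilon> (opp s) v i"
    using xs D(2)[of i] B by (cases s) (auto simp: weight_pt_def eps_sq_cancel mult.assoc)
  moreover have "moves_to n \<epsilon> (opp s) i v B"
    unfolding moves_to_def using D B nn xs eps_sq_cancel
    by (cases s) (auto simp: movable_def mult.assoc)
  ultimately show ?thesis
    using box_x_iff[OF v B(2)] B by blast
qed

lemma box_x_exclusive: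
  assumes "B \<in> boxes" "i \<le> n" "bx s i B = Some cv"
  shows "bx (opp s) i B = None"
proof -
  have "movable n s B i" using assms box_x_None_iff[OF assms(1,2), of s] by auto
  then show ?thesis using box_x_None_iff[OF assms(1,2)] by (cases s) (auto simp: movable_def)
qed

lemma box_x_twice:
  assumes "B \<in> boxes" "i \<le> n" "bx s i B = Some (c, v)"
  shows "bx s i v = None"
  using box_x_exclusive[OF _ assms(2) box_x_inverse[OF assms]] box_x_boxes[OF assms(3,1,2)] by simp

text \<open>Moves at nodes that are not adjacent involve disjoint pairs of nodes.\<close>

lemma box_x_far:
  assumes B: "B \<in> boxes" and ij: "i \<le> n" "j \<le> n" "i \<noteq> j" "\<not> adjacent n i j"
    and x: "bx s i B = Some (c, v)" and x': "bx s' j v = Some (c', w)"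
  obtains v' where "bx s' j B = Some (c', v')" "bx s i v' = Some (c, w)"
proof -
  note xs = box_x_iff[OF B ij(1), of s c v, THEN iffD1, OF x]
  have v: "v \<in> boxes" and mv: "moves_to n \<epsilon> s i B v" using xs by auto
  note xs' = box_x_iff[OF v ij(2), of s' c' w, THEN iffD1, OF x']
  have w: "w \<in> boxes" and mw: "moves_to n \<epsilon> s' j v w" using xs' by auto
  note D = moves_toD[OF mv] note D' = moves_toD[OF mw]
  have nn: "nxt n i \<noteq> i" "nxt n j \<noteq> j" "nxt n i \<noteq> j" "nxt n j \<noteq> i" "nxt n i \<noteq> nxt n j"
    using nxt_neq ij nxt_inj by (auto simp: adjacent_iff)
  have "movable n s' B j"
    using xs' D nn ij by (auto simp: movable_def)
  moreover have "c' = weight_pt \<epsilon> s' B j"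
    using xs' D(2)[of j] ij by (auto simp: weight_pt_def)
  ultimately obtain v' where x1: "bx s' j B = Some (c', v')"
    using box_x_ex_iff[OF B ij(2)] by metis
  note xs1 = box_x_iff[OF B ij(2), of s' c' v', THEN iffD1, OF x1]
  have v': "v' \<in> boxes" and mv': "moves_to n \<epsilon> s' j B v'" using xs1 by auto
  note D1 = moves_toD[OF mv']
  have "movable n s v' i"
    using xs D1 nn ij by (auto simp: movable_def)
  moreover have "c = weight_pt \<epsilon> s v' i"
    using xs D1(2)[of i] ij by (auto simp: weight_pt_def)
  moreover have "moves_to n \<epsilon> s i v' w"
    unfolding moves_to_def using D D' D1 nn ij by auto
  ultimately have "bx s i v' = Some (c, w)"
    using box_x_iff[OF v' ij(1)] w by blast
  with x1 show ?thesis using that by blast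
qed

text \<open>After a move at \<open>i\<close> the two steps of the path next to \<open>i\<close> are
  fixed, and they exclude an extremum of the same kind at a neighbour.\<close>

lemma box_x_adjacent_opp:
  assumes B: "B \<in> boxes" and ij: "i \<le> n" "j \<le> n" "adjacent n i j"
    and x: "bx s i B = Some (c, v)"
  shows "bx (opp s) j v = None"
proof -
  note xs = box_x_iff[OF B ij(1), of s c v, THEN iffD1, OF x]
  have v: "v \<in> boxes" and mv: "moves_to n \<epsilon> s i B v" using xs by auto
  have "\<not> movable n (opp s) v j"
    using moves_toD(1)[OF mv, of j] moves_toD(1)[OF mv, of "nxt n j"] ij nxt_neq[of i] nxt_neq[of j]
    by (cases s) (auto simp: movable_def adjacent_iff)
  then show ?thesis using box_x_None_iff[OF v ij(2)] by simp
qed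

text \<open>One step of the path at the neighbour \<open>i\<close> is known before and after the move at \<open>j\<close>,
  so exactly one of two extrema is present at \<open>i\<close>, decided by the other step.\<close>

lemma box_x_adjacent:
  assumes B: "B \<in> boxes" and ij: "i \<le> n" "j \<le> n" "adjacent n i j"
    and x: "bx s j B = Some (c, v)"
  shows "(\<exists>w. bx s i v = Some (\<epsilon> powi (- sg s) * c, w) \<and> bx (opp s) i B = None) \<or>
    (\<exists>w. bx (opp s) i B = Some (\<epsilon> powi (sg s) * c, w) \<and> bx s i v = None)"
proof -
  note xs = box_x_iff[OF B ij(2), of s c v, THEN iffD1, OF x]
  have v: "v \<in> boxes" and mv: "moves_to n \<epsilon> s j B v" using xs by auto
  note D = moves_toD[OF mv]
  have nn: "nxt n i \<noteq> i" "nxt n j \<noteq> j" "nxt n (nxt n i) \<noteq> i" "nxt n (nxt n j) \<noteq> j" "i \<noteq> j"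
    using nxt_neq ij adjacent_neq by auto
  have hv: "height \<epsilon> v i = height \<epsilon> B i" using D(2)[of i] ij nn by auto
  have h: "height \<epsilon> B i = height \<epsilon> B j * \<epsilon> powi (- sg s)"
    using ij(3) slope[OF B ij(1)] slope[OF B ij(2)] xs nn eps_nz
    by (cases s) (auto simp: adjacent_iff movable_def power_int_minus)
  have pw: "\<epsilon> powi 2 * inverse \<epsilon> = \<epsilon>" "inverse \<epsilon> * \<epsilon> powi 2 = \<epsilon>"
    using eps_nz by (simp_all add: power2_eq_square)
  have w1: "weight_pt \<epsilon> s v i = \<epsilon> powi (- sg s) * c"
    using xs hv h eps_nz by (cases s) (auto simp: weight_pt_def power_int_minus)
  have w2: "weight_pt \<epsilon> (opp s) B i = \<epsilon> powi (sg s) * c"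
    using xs h eps_nz pw by (cases s) (auto simp: weight_pt_def power_int_minus power2_eq_square)
  have "movable n s v i \<and> \<not> movable n (opp s) B i \<or> \<not> movable n s v i \<and> movable n (opp s) B i"
    using ij(3) D(1)[of i] D(1)[of "nxt n i"] ij nn xs
    by (cases s) (auto simp: adjacent_iff movable_def nxt_inj)
  then show ?thesis
    using box_x_ex_iff[OF v ij(1), of s] box_x_ex_iff[OF B ij(1), of "opp s"] w1 w2
      box_x_None_iff[OF v ij(1), of s] box_x_None_iff[OF B ij(1), of "opp s"] by metis
qed

text \<open>The parameters in the two nontrivial cases of the definition are brought to the same form by
  $\psi_\epsilon(\epsilon^2 cz)^{-1} = \psi_{\epsilon^{-1}}(cz)$, where $\psi_e(z) = (e - e^{-1}z)/(1 - z)$.\<close>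

lemma box_phi_eq:
  assumes B: "B \<in> boxes" and i: "i \<le> n"
  shows "box_phi n \<epsilon> i B = (if movable n Neg B i then psi_at \<epsilon> (weight_pt \<epsilon> Neg B i)
    else if movable n Pos B i then psi_at (inverse \<epsilon>) (weight_pt \<epsilon> Pos B i) else 1)"
proof -
  obtain T b where TB: "B = (T, b)" "T \<in> tabs" "b \<noteq> 0" using B by (auto simp: boxes_def)
  note b = TB(3)
  show ?thesis
  proof (cases "i = 0")
    case True
    have "inverse (psi_at \<epsilon> (b * \<epsilon> powi 2)) = psi_at (inverse \<epsilon>) b"
      by (rule inverse_psi_at) (use b eps_nz in auto)
    then show ?thesis
      using TB True hd_tab_iff[OF TB(2)] last_tab_iff[OF TB(2)] height_0[OF TB(2), of b]
      by (auto simp: movable_def occ_0 occ_nxt weight_pt_def)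
  next
    case False
    have 1: "pos T i = card {x \<in> set T. x \<le> i}" if "i \<in> set T"
      using pos_eq_card[OF tabsD(4)[OF TB(2)] that] .
    have 2: "pos T (i + 1) = card {x \<in> set T. x \<le> i} + 1" if "i + 1 \<in> set T"
      using pos_eq_card[OF tabsD(4)[OF TB(2)] that] card_le_Suc[of T i] that by simp
    have 3: "inverse (psi_at \<epsilon> (b * \<epsilon> powi (int i - 2 * int (pos T (i + 1)) + 4))) = 
      psi_at (inverse \<epsilon>) (height \<epsilon> B i)" if "i + 1 \<in> set T"
    proof (rule inverse_psi_at)
      have "b * \<epsilon> powi (int i - 2 * int (pos T (i + 1)) + 4) = 
        b * \<epsilon> powi (2 + (int i - 2 * int (card {x \<in> set T. x \<le> i})))"
        using 2[OF that] by (intro powi_eq) simp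
      also have "\<dots> = \<epsilon> ^ 2 * height \<epsilon> B i"
        unfolding powi_add' using TB by (simp add: height_def)
      finally show "b * \<epsilon> powi (int i - 2 * int (pos T (i + 1)) + 4) = \<epsilon> ^ 2 * height \<epsilon> B i" .
    qed (use b eps_nz TB in \<open>auto simp: height_def\<close>)
    have 4: "b * \<epsilon> powi (int i - 2 * int (pos T i) + 2) = weight_pt \<epsilon> Neg B i" if "i \<in> set T"
      using 1[OF that] TB unfolding powi_add' by (simp add: height_def weight_pt_def)
    show ?thesis
      using TB False i 3 4 by (auto simp: movable_def occ_pos occ_nxt weight_pt_def)
  qed
qed

end

section \<open>Counting, separating and connecting the paths\<close>

lemma nxt_cyclic_induct:
  assumes "P i0" "i0 \<le> n" and step: "\<And>i. i \<le> n \<Longrightarrow> P i \<Longrightarrow> P (nxt n i)" and "j \<le> n"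
  shows "P j"
proof -
  have up: "k \<le> n \<Longrightarrow> P k" if "P i" "i \<le> k" for i k
    using that(2)
  proof (induction k rule: dec_induct)
    case (step k)
    then show ?case using assms(3)[of k] by (simp add: nxt_eq)
  qed (use that in simp)
  have "P n" using up[OF assms(1,2)] by simp
  then have "P 0" using step[of n] by (simp add: nxt_eq)
  then show ?thesis using up assms(4) by blast
qed

lemma column_tableaux_bij: "bij_betw set (column_tableaux n l) {S. S \<subseteq> {1..n+1} \<and> card S = l}"
proof (rule bij_betwI[where g = sorted_list_of_set])
  show "set \<in> column_tableaux n l \<rightarrow> {S. S \<subseteq> {1..n+1} \<and> card S = l}"
    by (auto simp: column_tableaux_def strict_sorted_iff distinct_card)
  show "sorted_list_of_set \<in> {S. S \<subseteq> {1..n+1} \<and> card S = l} \<rightarrow> column_tableaux n l"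
  proof
    fix S assume S: "S \<in> {S. S \<subseteq> {1..n+1} \<and> card S = l}"
    then have "set (sorted_list_of_set S) = S"
      using finite_subset[of S "{1..n+1}"] by simp
    then show "sorted_list_of_set S \<in> column_tableaux n l"
      using S unfolding column_tableaux_def by simp
  qed
  show "sorted_list_of_set (set T) = T" if "T \<in> column_tableaux n l" for T
    using that by (simp add: column_tableaux_def strict_sorted_iff sorted_list_of_set.idem_if_sorted_distinct)
  show "set (sorted_list_of_set S) = S" if "S \<in> {S. S \<subseteq> {1..n+1} \<and> card S = l}" for S
    using that finite_subset[of S "{1..n+1}"] by simp
qed

lemma column_tableaux_finite: "finite (column_tableaux n l)"
  and column_tableaux_card: "card (column_tableaux n l) = (n + 1) choose l"
proof -
  show "finite (column_tableaux n l)"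
    using bij_betw_finite[OF column_tableaux_bij, of n l] by simp
  show "card (column_tableaux n l) = (n + 1) choose l"
    using bij_betw_same_card[OF column_tableaux_bij, of n l] n_subsets[of "{1..n+1}" l] by simp
qed

context tableau_boxes
begin

text \<open>The points where the currents at the node \<open>i\<close> can act on a module with parameter \<open>a\<close>.\<close>

definition cls :: "complex \<Rightarrow> nat \<Rightarrow> complex \<Rightarrow> bool"
  where "cls a i c \<longleftrightarrow> (\<exists>m::int. c = a * \<epsilon> powi (int i + 2 * m))"

abbreviation V :: "complex \<Rightarrow> box set" where "V \<equiv> V_basis r \<epsilon>"

lemma V_eq: "V a = tabs \<times> {a * \<epsilon> powi (2 * m) | m :: int. True}"
  by (simp add: V_basis_def n)

lemma V_memI: "T \<in> tabs \<Longrightarrow> b = a * \<epsilon> powi (2 * m) \<Longrightarrow> (T, b) \<in> V a"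
  unfolding V_eq by blast

lemma V_memE:
  assumes "B \<in> V a"
  obtains T b m where "B = (T, b)" "T \<in> tabs" "b = a * \<epsilon> powi (2 * m)"
  using assms unfolding V_eq by blast

lemma V_boxes: "a \<noteq> 0 \<Longrightarrow> V a \<subseteq> boxes"
  using eps_nz by (auto simp: V_eq boxes_def)

lemma weight_pt_cls:
  assumes "B \<in> V a"
  shows "cls a i (weight_pt \<epsilon> s B i)"
proof -
  obtain T b m where TB: "B = (T, b)" "b = a * \<epsilon> powi (2 * m)"
    using assms by (auto simp: V_eq)
  have "weight_pt \<epsilon> s B i = a * (\<epsilon> powi (2 * m) * 
      \<epsilon> powi (int i - 2 * int (card {x \<in> set T. x \<le> i})) * \<epsilon> powi (1 - sg s))"
    using TB by (simp add: weight_pt_def height_def mult.assoc)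
  also have "\<dots> = a * \<epsilon> powi (2 * m + (int i - 2 * int (card {x \<in> set T. x \<le> i})) + (1 - sg s))"
    unfolding powi_add' ..
  also have "\<dots> = a * \<epsilon> powi (int i + 2 * (m - int (card {x \<in> set T. x \<le> i}) + of_bool (s = Neg)))"
    by (rule powi_eq) (cases s; simp)
  finally show ?thesis unfolding cls_def by blast
qed

lemma V_step:
  assumes "a \<noteq> 0" "B \<in> V a" "i \<le> n" "bx s i B = Some (c, v)"
  shows "v \<in> V a" "cls a i c"
proof -
  obtain T b m where TB: "B = (T, b)" "T \<in> tabs" "b = a * \<epsilon> powi (2 * m)"
    using assms(2) by (rule V_memE)
  have B: "B \<in> boxes" using assms V_boxes by auto
  have mv: "movable n s (T, b) i" and c: "c = weight_pt \<epsilon> s B i"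
    using box_x_iff[OF B assms(3)] assms(4) TB by auto
  obtain T' where T': "v = (T', shifted \<epsilon> s i b)" "T' \<in> tabs"
    using box_x_movable[OF TB(2) assms(3) mv] assms(4) TB by (metis option.inject prod.inject)
  have "shifted \<epsilon> s i b = a * (\<epsilon> powi (2 * m) * \<epsilon> powi (if i = 0 then - 2 * sg s else 0))"
    by (simp add: shifted_def TB(3) mult.assoc)
  also have "\<dots> = a * \<epsilon> powi (2 * (m + (if i = 0 then - sg s else 0)))"
    unfolding powi_add'[symmetric] by (rule powi_eq) simp
  finally show "v \<in> V a" using T' V_memI by blast
  show "cls a i c" using weight_pt_cls[OF assms(2)] c by simp
qed

lemma powi_2L: "\<epsilon> powi (2 * int L * m) = 1"
proof -
  have "\<epsilon> powi (2 * int L) = \<epsilon> ^ (2 * L)"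
    by (metis of_nat_mult of_nat_numeral power_int_of_nat)
  then have "\<epsilon> powi (2 * int L) = 1"
    using eps by (simp add: primitive_root_def)
  then show ?thesis by (simp add: power_int_mult)
qed

lemma spectral_set_eq: "{a * \<epsilon> powi (2 * m) | m :: int. True} = (\<lambda>k. a * \<epsilon> ^ (2 * k)) ` {..<L}"
proof (intro equalityI subsetI)
  fix x assume "x \<in> {a * \<epsilon> powi (2 * m) | m :: int. True}"
  then obtain m :: int where m: "x = a * \<epsilon> powi (2 * m)" by auto
  have "2 * m = 2 * int L * (m div int L) + 2 * (m mod int L)"
    by (metis mult.assoc distrib_left mult_div_mod_eq)
  then have "\<epsilon> powi (2 * m) = \<epsilon> powi (2 * (m mod int L))"
    using powi_add' powi_2L by (metis mult_1)
  also have "\<dots> = \<epsilon> ^ (2 * nat (m mod int L))"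
    using L by (subst power_int_of_nat[symmetric]) (simp add: mult.commute)
  finally show "x \<in> (\<lambda>k. a * \<epsilon> ^ (2 * k)) ` {..<L}"
    using L m by (auto intro!: image_eqI[of _ _ "nat (m mod int L)"] simp: nat_less_iff)
next
  fix x assume "x \<in> (\<lambda>k. a * \<epsilon> ^ (2 * k)) ` {..<L}"
  then obtain k where "x = a * \<epsilon> ^ (2 * k)" by auto
  then have "x = a * \<epsilon> powi (2 * int k)"
    by (metis of_nat_mult of_nat_numeral power_int_of_nat)
  then show "x \<in> {a * \<epsilon> powi (2 * m) | m :: int. True}" by blast
qed

lemma eps_power_inj:
  assumes "\<epsilon> ^ (2 * k) = \<epsilon> ^ (2 * l)" "k < L" "l < L" "k \<le> l"
  shows "k = l"
proof (rule ccontr)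
  assume "k \<noteq> l"
  then have "0 < 2 * (l - k)" "2 * (l - k) < 2 * L" using assms by auto
  moreover have "\<epsilon> ^ (2 * l) = \<epsilon> ^ (2 * k) * \<epsilon> ^ (2 * (l - k))"
    using assms(4) by (simp flip: power_add add: right_diff_distrib')
  then have "\<epsilon> ^ (2 * (l - k)) = 1"
    using assms(1) eps_nz by simp
  ultimately show False using eps unfolding primitive_root_def by blast
qed

lemma V_finite: "finite (V a)"
  unfolding V_eq spectral_set_eq
  by (intro finite_cartesian_product column_tableaux_finite finite_imageI) simp

lemma V_card:
  assumes "a \<noteq> 0"
  shows "card (V a) = L * ((n + 1) choose (r + 1))"
proof -
  have "inj_on (\<lambda>k. a * \<epsilon> ^ (2 * k)) {..<L}"
  proof (rule inj_onI)
    fix k l assume "k \<in> {..<L}" "l \<in> {..<L}" "a * \<epsilon> ^ (2 * k) = a * \<epsilon> ^ (2 * l)"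
    then show "k = l"
      using assms eps_power_inj[of k l] eps_power_inj[of l k] by (cases "k \<le> l") auto
  qed
  then have "card {a * \<epsilon> powi (2 * m) | m :: int. True} = L"
    unfolding spectral_set_eq by (simp add: card_image)
  then show ?thesis
    by (simp only: V_eq card_cartesian_product column_tableaux_card mult.commute)
qed

text \<open>Neither all nodes nor none are occupied, so somewhere on the cycle a free node is followed by an
  occupied one.\<close>

lemma ex_movable_Pos:
  assumes "B \<in> boxes"
  obtains i where "i \<le> n" "movable n Pos B i"
proof (rule ccontr)
  assume no: "\<not> thesis"
  obtain T b where TB: "B = (T, b)" "T \<in> tabs" using assms by (auto simp: boxes_def)
  have "\<not> {1..n+1} \<subseteq> set T"
  proof
    assume "{1..n+1} \<subseteq> set T"
    then have "card {1..n+1} \<le> card (set T)" by (intro card_mono) auto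
    then show False using tabsD(6)[OF TB(2)] n r by simp
  qed
  then obtain x where "x \<in> {1..n+1}" "x \<notin> set T" by blast
  then have x: "1 \<le> x" "x \<le> n + 1" "x \<notin> set T" by auto
  \<comment> \<open>The node of the missing entry.\<close>
  define i where "i = (if x = n + 1 then 0 else x)"
  have i: "i \<le> n" "\<not> occ n B i" using x TB by (auto simp: i_def occ_def)
  have step: "\<And>i. i \<le> n \<Longrightarrow> \<not> occ n B i \<Longrightarrow> \<not> occ n B (nxt n i)"
    using no that by (auto simp: movable_def)
  have all: "\<not> occ n B j" if "j \<le> n" for j
    using nxt_cyclic_induct[of "\<lambda>j. \<not> occ n B j", OF i(2,1) step that] .
  have "hd T \<in> set T" using tabsD(2)[OF TB(2)] by simp
  then show False
    using all[of 0] all[of "hd T"] tabsD(5)[OF TB(2), of "hd T"] TB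
    by (cases "hd T = n + 1") (auto simp: occ_0 occ_pos)
qed

text \<open>A closed path is monotone between consecutive local extrema. Starting from a common
  maximum, it can be reconstructed step by step from the places and values of its extrema.\<close>

lemma box_separation:
  assumes B: "B \<in> boxes" "B' \<in> boxes"
    and eq: "\<And>s i c. i \<le> n \<Longrightarrow> (\<exists>v. bx s i B = Some (c, v)) \<longleftrightarrow> (\<exists>v. bx s i B' = Some (c, v))"
  shows "B = B'"
proof -
  have key: "movable n s B i \<and> c = weight_pt \<epsilon> s B i \<longleftrightarrow> movable n s B' i \<and> c = weight_pt \<epsilon> s B' i"
    if "i \<le> n" for s i c
    using eq[OF that] box_x_ex_iff[OF B(1) that] box_x_ex_iff[OF B(2) that] by simp
  have mv: "movable n s B i \<longleftrightarrow> movable n s B' i" if "i \<le> n" for s i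
    using key[OF that] by blast
  have wt: "height \<epsilon> B i = height \<epsilon> B' i" if "i \<le> n" "movable n s B i" for s i
  proof -
    have "weight_pt \<epsilon> s B i = weight_pt \<epsilon> s B' i" using key[OF that(1)] that(2) by blast
    then show ?thesis using eps_nz by (simp add: weight_pt_def)
  qed
  obtain i0 where i0: "i0 \<le> n" "movable n Pos B i0" using ex_movable_Pos[OF B(1)] .
  \<comment> \<open>The height at \<open>i\<close> and the step that leaves \<open>i\<close> agree for both paths.\<close>
  define P where "P = (\<lambda>i. height \<epsilon> B i = height \<epsilon> B' i \<and> occ n B (nxt n i) = occ n B' (nxt n i))"
  have P: "P j" if "j \<le> n" for j
  proof (rule nxt_cyclic_induct[of P, OF _ i0(1) _ that])
    show "P i0" using i0 mv[OF i0(1), of Pos] wt[OF i0] by (auto simp: P_def movable_def)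
    fix i assume i: "i \<le> n" "P i"
    then have h: "height \<epsilon> B (nxt n i) = height \<epsilon> B' (nxt n i)" and o: "occ n B (nxt n i) = occ n B' (nxt n i)"
      using slope[OF B(1) i(1)] slope[OF B(2) i(1)] by (auto simp: P_def)
    have "occ n B (nxt n (nxt n i)) = occ n B' (nxt n (nxt n i))"
      using mv[of "nxt n i" Pos] mv[of "nxt n i" Neg] o by (auto simp: movable_def)
    with h show "P (nxt n i)" by (simp add: P_def)
  qed
  have "occ n B i = occ n B' i" if "i \<le> n" for i
  proof (rule nxt_cyclic_induct[of "\<lambda>i. occ n B i = occ n B' i" "nxt n 0", OF _ _ _ that])
    show "occ n B (nxt n 0) = occ n B' (nxt n 0)" using P[of 0] by (simp add: P_def)
    show "occ n B (nxt n i) = occ n B' (nxt n i)" if "i \<le> n" for i using P[OF that] by (simp add: P_def)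
  qed simp
  then show ?thesis
    using P[of 0] by (intro boxes_eqI[OF B]) (auto simp: P_def)
qed

definition adj_rel :: "complex \<Rightarrow> (box \<times> box) set"
  where "adj_rel a = {(B, v). B \<in> V a \<and> (\<exists>s i c. i \<le> n \<and> bx s i B = Some (c, v))}"

lemma adj_rel_sym: "a \<noteq> 0 \<Longrightarrow> sym (adj_rel a)"
  unfolding adj_rel_def sym_def using box_x_inverse V_boxes V_step(1) by blast

definition low_tab :: "nat list" where "low_tab = [1..<r + 2]"

lemma set_low_tab: "set low_tab = {1..r + 1}"
  by (auto simp: low_tab_def)

lemma low_tab_tabs: "low_tab \<in> tabs"
  unfolding column_tableaux_def mem_Collect_eq low_tab_def set_upt length_upt
  by (intro conjI sorted_wrt_upt) (use n r in auto)

text \<open>Lowering entries one by one decreases their sum; the process stops only at the tableau $1, \dots, r + 1$.\<close>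

lemma adj_rel_lowest:
  assumes "a \<noteq> 0" "(T, b) \<in> V a"
  shows "((T, b), (low_tab, b)) \<in> (adj_rel a)\<^sup>*"
  using assms(2)
proof (induction "\<Sum>(set T)" arbitrary: T rule: less_induct)
  case less
  have T: "T \<in> tabs" using less.prems by (simp add: V_eq)
  show ?case
  proof (cases "\<exists>i. i \<ge> 1 \<and> i + 1 \<in> set T \<and> i \<notin> set T")
    case True
    then obtain i where i: "i \<ge> 1" "i + 1 \<in> set T" "i \<notin> set T" by auto
    have in': "i \<le> n" using tabsD(5)[OF T i(2)] by simp
    have occ: "\<not> occ n (T, b) i" "occ n (T, b) (nxt n i)"
      using i in' by (auto simp: occ_pos occ_nxt)
    obtain T' where T': "e_til n i T = Some T'" "T' \<in> tabs" "set T' = insert i (set T - {i + 1})"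
      using e_til_Some[OF T in' occ] i by auto
    have "\<Sum>(set T') = i + \<Sum>(set T - {i + 1})"
      using i T' by simp
    moreover have "\<Sum>(set T) = (i + 1) + \<Sum>(set T - {i + 1})"
      using i by (simp add: sum.remove)
    ultimately have lt: "\<Sum>(set T') < \<Sum>(set T)" by simp
    have x: "((T, b), (T', b)) \<in> adj_rel a"
      using less.prems T' i in' by (auto simp: adj_rel_def intro!: exI[of _ Pos] exI[of _ i])
    have "(T', b) \<in> V a" using less.prems T' by (simp add: V_eq)
    then show ?thesis using less.hyps[OF lt] x by (meson converse_rtrancl_into_rtrancl)
  next
    case False
    then have down: "x - 1 \<in> set T" if "x \<in> set T" "x \<ge> 2" for x
      using that by (metis Nat.le_imp_diff_is_add le_add_diff_inverse2 add_leD2 diff_is_0_eq' le_diff_conv nat_1_add_1 not_less_eq_eq numeral_2_eq_2 one_le_numeral order_trans)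
    define M where "M = Max (set T)"
    have ne: "set T \<noteq> {}" using tabsD(2)[OF T] by simp
    have "M - k \<in> set T" if "k < M" for k
      using that
    proof (induction k)
      case 0 then show ?case using ne by (simp add: M_def)
    next
      case (Suc k) then show ?case using down[of "M - k"] by simp
    qed
    then have "{1..M} \<subseteq> set T"
      by (metis atLeastAtMost_iff diff_diff_cancel diff_less less_le_trans subsetI zero_less_one)
    moreover have "set T \<subseteq> {1..M}" using tabsD(5)[OF T] by (auto simp: M_def)
    ultimately have eq: "set T = {1..M}" by (rule equalityI[rotated])
    have "card {1..M} = r + 1"
      using tabsD(6)[OF T] unfolding eq .
    then have "set T = set low_tab" unfolding eq set_low_tab by simp
    then have "T = low_tab"
      using strict_sorted_equal tabsD(4)[OF T] tabsD(4)[OF low_tab_tabs] by blast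
    then show ?thesis by simp
  qed
qed

text \<open>The move at the node 0 multiplies the parameter by $\epsilon^{-2}$; lowering the new tableau
  afterwards returns to the lowest tableau.\<close>

lemma adj_rel_shift:
  assumes "a \<noteq> 0" "(low_tab, b) \<in> V a"
  shows "((low_tab, b), (low_tab, b * \<epsilon> powi (- 2 * int k))) \<in> (adj_rel a)\<^sup>*"
proof (induction k)
  case (Suc k)
  let ?T = low_tab let ?b = "b * \<epsilon> powi (- 2 * int k)"
  have T: "?T \<in> tabs" using assms(2) by (simp add: V_eq)
  obtain m where b: "b = a * \<epsilon> powi (2 * m)" using assms(2) by (auto elim: V_memE)
  have "?b = a * (\<epsilon> powi (2 * m) * \<epsilon> powi (- 2 * int k))" using b by simp
  also have "\<dots> = a * \<epsilon> powi (2 * (m - int k))"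
    unfolding powi_add'[symmetric] by (rule powi_eq) simp
  finally have V: "(?T, ?b) \<in> V a" by (rule V_memI[OF T])
  have mv: "movable n Pos (?T, ?b) 0"
    using n r by (auto simp: movable_def occ_0 occ_nxt set_low_tab)
  obtain T' where T': "bx Pos 0 (?T, ?b) = Some (weight_pt \<epsilon> Pos (?T, ?b) 0, (T', shifted \<epsilon> Pos 0 ?b))"
    using box_x_movable[OF T _ mv] by auto
  have sh: "shifted \<epsilon> Pos 0 ?b = b * \<epsilon> powi (- 2 * int (Suc k))"
  proof -
    have "shifted \<epsilon> Pos 0 ?b = b * (\<epsilon> powi (- 2 * int k) * \<epsilon> powi (- 2))"
      by (simp add: shifted_def)
    also have "\<dots> = b * \<epsilon> powi (- 2 * int (Suc k))"
      unfolding powi_add'[symmetric] by (rule powi_eq) simp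
    finally show ?thesis .
  qed
  have "((?T, ?b), (T', shifted \<epsilon> Pos 0 ?b)) \<in> adj_rel a"
    using V T' unfolding adj_rel_def by blast
  moreover have "(T', shifted \<epsilon> Pos 0 ?b) \<in> V a"
    using V_step(1)[OF assms(1) V _ T'] by simp
  ultimately show ?case
    using Suc adj_rel_lowest[OF assms(1), of T' "shifted \<epsilon> Pos 0 ?b"] unfolding sh
    by (meson rtrancl_trans r_into_rtrancl)
qed simp

lemma V_connected:
  assumes a: "a \<noteq> 0" and B: "B \<in> V a" "B' \<in> V a"
  shows "(B, B') \<in> (adj_rel a)\<^sup>*"
proof -
  let ?T = low_tab 
  note trans = rtrancl_trans and sym = sym_rtrancl[OF adj_rel_sym[OF a], THEN symD]
  obtain T b m T' b' m' where eq: "B = (T, b)" "B' = (T', b')" "T \<in> tabs" "T' \<in> tabs"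
    "b = a * \<epsilon> powi (2 * m)" "b' = a * \<epsilon> powi (2 * m')"
    using B V_memE by metis
  note T = low_tab_tabs
  have V: "(?T, b) \<in> V a" "(?T, b') \<in> V a" using V_memI[OF T] eq by blast+
  have gen: "((?T, x * \<epsilon> powi (2 * p)), (?T, x * \<epsilon> powi (2 * q))) \<in> (adj_rel a)\<^sup>*"
    if "q \<le> p" "(?T, x * \<epsilon> powi (2 * p)) \<in> V a" for x p q
  proof -
    have "x * \<epsilon> powi (2 * p) * \<epsilon> powi (- 2 * int (nat (p - q))) = x * \<epsilon> powi (2 * q)"
      unfolding mult.assoc powi_add'[symmetric] by (rule powi_eq) (use that in simp)
    then show ?thesis using adj_rel_shift[OF a that(2), of "nat (p - q)"] by argo
  qed
  have "((?T, b), (?T, b')) \<in> (adj_rel a)\<^sup>*"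
  proof (cases "m' \<le> m")
    case True then show ?thesis using gen[of m' m a] V eq by simp
  next
    case False then show ?thesis using gen[of m m' a] V eq sym by simp
  qed
  then show ?thesis
    using adj_rel_lowest[OF a] B sym trans unfolding eq by meson
qed

end

section \<open>Partial fractions\<close>

definition psi_val :: "complex \<Rightarrow> complex \<Rightarrow> complex \<Rightarrow> complex"
  where "psi_val e c z = (e - inverse e * c * z) / (1 - c * z)"

lemma psi_val_eq:
  assumes "e \<noteq> 0" "c * z \<noteq> 1"
  shows "psi_val e c z = inverse e + (e - inverse e) / (1 - c * z)"
proof -
  have "1 - c * z \<noteq> 0" using assms by simp
  then show ?thesis by (simp add: psi_val_def divide_simps)
qed

text \<open>The coefficient of $1/(1 - c_l z)$ in the product of the functions
  $(e_m - e_m^{-1} c_m z)/(1 - c_m z)$ over $m \in S$.\<close>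

definition psi_residue :: "('i \<Rightarrow> complex) \<Rightarrow> ('i \<Rightarrow> complex) \<Rightarrow> 'i set \<Rightarrow> 'i \<Rightarrow> complex"
  where "psi_residue e c S l =
    (e l - inverse (e l)) * (\<Prod>m\<in>S - {l}. psi_val (e m) (c m) (inverse (c l)))"

text \<open>The induction step for the decomposition of a product into partial fractions. It uses only
  the product rule for $1/(1 - cz)$, so the function \<open>g\<close> may be the value of $1/(1 - cz)$ at a point
  or either of its expansions. The coefficient at the new pole involves the value there of the old product, which is
  why the value is an assumption.\<close>

lemma partial_fractions_insert:
  fixes \<kappa> :: "complex \<Rightarrow> 'a :: comm_ring_1" and g :: "complex \<Rightarrow> 'a"
  assumes add: "\<And>x y. \<kappa> (x + y) = \<kappa> x + \<kappa> y" and mult: "\<And>x y. \<kappa> (x * y) = \<kappa> x * \<kappa> y"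
    and zero: "\<kappa> 0 = 0"
    and g: "\<And>l. l \<in> S \<Longrightarrow> g (c x) * g (c l) = 
      \<kappa> (c x / (c x - c l)) * g (c x) + \<kappa> (c l / (c l - c x)) * g (c l)"
    and S: "finite S" "x \<notin> S" and e: "e x \<noteq> 0" 
    and c: "c x \<noteq> 0" "\<And>l. l \<in> S \<Longrightarrow> c l \<noteq> 0 \<and> c l \<noteq> c x"
    and val: "(\<Prod>l\<in>S. psi_val (e l) (c l) (inverse (c x))) =
      (\<Prod>l\<in>S. inverse (e l)) + (\<Sum>l\<in>S. psi_residue e c S l / (1 - c l * inverse (c x)))"
    and IH: "(\<Prod>l\<in>S. \<kappa> (inverse (e l)) + \<kappa> (e l - inverse (e l)) * g (c l)) =
      \<kappa> (\<Prod>l\<in>S. inverse (e l)) + (\<Sum>l\<in>S. \<kappa> (psi_residue e c S l) * g (c l))"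
  shows "(\<Prod>l\<in>insert x S. \<kappa> (inverse (e l)) + \<kappa> (e l - inverse (e l)) * g (c l)) =
      \<kappa> (\<Prod>l\<in>insert x S. inverse (e l)) + 
      (\<Sum>l\<in>insert x S. \<kappa> (psi_residue e c (insert x S) l) * g (c l))"
proof -
  have \<kappa>_sum: "\<kappa> (\<Sum>l\<in>S. f l) = (\<Sum>l\<in>S. \<kappa> (f l))" for f
    using S(1) by (induction S rule: finite_induct) (simp_all add: add zero)
  define G where "G = (\<Prod>l\<in>S. inverse (e l))"
  define R where "R = psi_residue e c S"
  define \<rho> where "\<rho> = e x - inverse (e x)"
  have Rx: "psi_residue e c (insert x S) x = \<rho> * (G + (\<Sum>l\<in>S. R l * (c x / (c x - c l))))"
  proof -
    have "insert x S - {x} = S" using S by auto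
    then have "psi_residue e c (insert x S) x = \<rho> * (\<Prod>l\<in>S. psi_val (e l) (c l) (inverse (c x)))"
      by (simp only: psi_residue_def \<rho>_def)
    also have "(\<Prod>l\<in>S. psi_val (e l) (c l) (inverse (c x))) =
        G + (\<Sum>l\<in>S. R l / (1 - c l * inverse (c x)))"
      using val by (simp only: G_def R_def)
    also have "(\<Sum>l\<in>S. R l / (1 - c l * inverse (c x))) = (\<Sum>l\<in>S. R l * (c x / (c x - c l)))"
    proof (rule sum.cong[OF refl])
      fix l assume "l \<in> S"
      have "1 - c l * inverse (c x) = (c x - c l) / c x"
        using c(1) by (simp add: field_simps)
      then show "R l / (1 - c l * inverse (c x)) = R l * (c x / (c x - c l))" by simp
    qed
    finally show ?thesis .
  qed
  have Rl: "psi_residue e c (insert x S) l = R l * (inverse (e x) + \<rho> * (c l / (c l - c x)))" 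
    if l: "l \<in> S" for l
  proof -
    have "insert x S - {l} = insert x (S - {l})" using S l by auto
    then have "psi_residue e c (insert x S) l = R l * psi_val (e x) (c x) (inverse (c l))"
      using S by (simp add: psi_residue_def R_def)
    also have "psi_val (e x) (c x) (inverse (c l)) = inverse (e x) + \<rho> / (1 - c x * inverse (c l))"
      unfolding \<rho>_def using c(2)[OF l] by (intro psi_val_eq e) (auto simp: field_simps)
    also have "1 - c x * inverse (c l) = (c l - c x) / c l"
      using c(2)[OF l] by (simp add: field_simps)
    finally show ?thesis by simp
  qed
  have "(\<Prod>l\<in>insert x S. \<kappa> (inverse (e l)) + \<kappa> (e l - inverse (e l)) * g (c l)) =
    (\<kappa> (inverse (e x)) + \<kappa> \<rho> * g (c x)) * (\<kappa> G + (\<Sum>l\<in>S. \<kappa> (R l) * g (c l)))"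
    using S IH by (simp add: G_def R_def \<rho>_def)
  also have "\<dots> = \<kappa> (inverse (e x) * G) + \<kappa> (\<rho> * G) * g (c x) +
      (\<Sum>l\<in>S. \<kappa> (inverse (e x) * R l) * g (c l) + \<kappa> (\<rho> * R l) * (g (c x) * g (c l)))"
    by (simp add: mult distrib_left distrib_right sum.distrib sum_distrib_left mult_ac)
  also have "(\<Sum>l\<in>S. \<kappa> (inverse (e x) * R l) * g (c l) + \<kappa> (\<rho> * R l) * (g (c x) * g (c l))) =
      (\<Sum>l\<in>S. \<kappa> (psi_residue e c (insert x S) l) * g (c l) + 
        \<kappa> (\<rho> * (R l * (c x / (c x - c l)))) * g (c x))"
  proof (rule sum.cong[OF refl])
    fix l assume l: "l \<in> S"
    show "\<kappa> (inverse (e x) * R l) * g (c l) + \<kappa> (\<rho> * R l) * (g (c x) * g (c l)) =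
        \<kappa> (psi_residue e c (insert x S) l) * g (c l) + 
        \<kappa> (\<rho> * (R l * (c x / (c x - c l)))) * g (c x)"
      unfolding g[OF l] Rl[OF l] by (simp only: mult add distrib_left distrib_right mult_ac add_ac)
  qed
  also have "\<dots> = (\<Sum>l\<in>S. \<kappa> (psi_residue e c (insert x S) l) * g (c l)) + 
      \<kappa> (\<rho> * (\<Sum>l\<in>S. R l * (c x / (c x - c l)))) * g (c x)"
    by (simp add: sum.distrib \<kappa>_sum sum_distrib_left sum_distrib_right)
  also have "\<kappa> (inverse (e x) * G) + \<kappa> (\<rho> * G) * g (c x) + \<dots> =
      \<kappa> (inverse (e x) * G) + \<kappa> (psi_residue e c (insert x S) x) * g (c x) + 
      (\<Sum>l\<in>S. \<kappa> (psi_residue e c (insert x S) l) * g (c l))"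
    unfolding Rx distrib_left[of \<rho>] add by (simp add: algebra_simps)
  finally show ?thesis
    using S by (simp add: G_def algebra_simps)
qed

lemma partial_fractions_val:
  assumes "finite S" "inj_on c S" "\<And>l. l \<in> S \<Longrightarrow> e l \<noteq> 0" "\<And>l. l \<in> S \<Longrightarrow> c l \<noteq> 0"
    and "\<And>l. l \<in> S \<Longrightarrow> c l * z \<noteq> 1"
  shows "(\<Prod>l\<in>S. psi_val (e l) (c l) z) =
      (\<Prod>l\<in>S. inverse (e l)) + (\<Sum>l\<in>S. psi_residue e c S l / (1 - c l * z))"
  using assms
proof (induction S arbitrary: z rule: finite_induct)
  case (insert x S)
  have cx: "c l * inverse (c x) \<noteq> 1" "c l \<noteq> c x" if "l \<in> S" for l
    using insert.hyps insert.prems that by (auto simp: field_simps inj_on_def)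
  have "(\<Prod>l\<in>insert x S. inverse (e l) + (e l - inverse (e l)) * (1 / (1 - c l * z))) =
      (\<Prod>l\<in>insert x S. inverse (e l)) + 
      (\<Sum>l\<in>insert x S. psi_residue e c (insert x S) l * (1 / (1 - c l * z)))"
  proof (rule partial_fractions_insert[where \<kappa> = "\<lambda>x. x" and g = "\<lambda>c. 1 / (1 - c * z)"])
    fix l assume l: "l \<in> S"
    have nz: "1 - c x * z \<noteq> 0" "1 - c l * z \<noteq> 0" "c x - c l \<noteq> 0" "c l - c x \<noteq> 0"
      using insert.prems(4)[of x] insert.prems(4)[of l] cx[OF l] l by auto
    have split: "1 / a * (1 / b) = u / d * (1 / a) + v / - d * (1 / b)"
      if "a \<noteq> 0" "b \<noteq> 0" "d \<noteq> 0" "u * b - v * a = d" for a b d u v :: complex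
      using that(1-3) by (simp add: divide_simps) (simp add: that(4)[symmetric])
    have "c x * (1 - c l * z) - c l * (1 - c x * z) = c x - c l"
      by (simp add: algebra_simps)
    from split[OF nz(1-3) this]
    show "1 / (1 - c x * z) * (1 / (1 - c l * z)) =
      c x / (c x - c l) * (1 / (1 - c x * z)) + c l / (c l - c x) * (1 / (1 - c l * z))"
      by simp
  next
    show "(\<Prod>l\<in>S. psi_val (e l) (c l) (inverse (c x))) =
      (\<Prod>l\<in>S. inverse (e l)) + (\<Sum>l\<in>S. psi_residue e c S l / (1 - c l * inverse (c x)))"
      using insert.prems insert.hyps cx by (intro insert.IH) (auto simp: inj_on_def)
  next
    have "(\<Prod>l\<in>S. inverse (e l) + (e l - inverse (e l)) * (1 / (1 - c l * z))) = 
      (\<Prod>l\<in>S. psi_val (e l) (c l) z)"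
      using insert.prems by (intro prod.cong) (auto simp: psi_val_eq)
    also have "\<dots> = (\<Prod>l\<in>S. inverse (e l)) + (\<Sum>l\<in>S. psi_residue e c S l / (1 - c l * z))"
      using insert.prems insert.hyps by (intro insert.IH) (auto simp: inj_on_def)
    finally show "(\<Prod>l\<in>S. inverse (e l) + (e l - inverse (e l)) * (1 / (1 - c l * z))) = 
      (\<Prod>l\<in>S. inverse (e l)) + (\<Sum>l\<in>S. psi_residue e c S l * (1 / (1 - c l * z)))"
      by simp
  qed (use insert.prems insert.hyps cx in auto)
  moreover have "(\<Prod>l\<in>insert x S. inverse (e l) + (e l - inverse (e l)) * (1 / (1 - c l * z))) =
      (\<Prod>l\<in>insert x S. psi_val (e l) (c l) z)"
    using insert.prems by (intro prod.cong) (auto simp: psi_val_eq)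
  ultimately show ?case by simp
qed simp

lemma partial_fractions_expansion:
  assumes "finite S" "inj_on c S" "\<And>l. l \<in> S \<Longrightarrow> e l \<noteq> 0" "\<And>l. l \<in> S \<Longrightarrow> c l \<noteq> 0"
    and "\<And>l. l \<in> S \<Longrightarrow> e l ^ 2 \<noteq> 1"
  shows "(\<Prod>l\<in>S. expansion s (psi_at (e l) (c l))) =
      fps_const (\<Prod>l\<in>S. inverse (e l)) + (\<Sum>l\<in>S. fps_const (psi_residue e c S l) * geom s (c l))"
proof -
  have "(\<Prod>l\<in>S. expansion s (psi_at (e l) (c l))) = 
      (\<Prod>l\<in>S. fps_const (inverse (e l)) + fps_const (e l - inverse (e l)) * geom s (c l))"
    using assms by (intro prod.cong) (auto simp: expansion_psi_at simp del: fps_const_sub)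
  also have "\<dots> = fps_const (\<Prod>l\<in>S. inverse (e l)) + 
      (\<Sum>l\<in>S. fps_const (psi_residue e c S l) * geom s (c l))"
    using assms
  proof (induction S rule: finite_induct)
    case (insert x S)
    have cx: "c l * inverse (c x) \<noteq> 1" "c l \<noteq> c x" if "l \<in> S" for l
      using insert.hyps insert.prems that by (auto simp: field_simps inj_on_def)
    show ?case
    proof (rule partial_fractions_insert[where \<kappa> = fps_const and g = "geom s"])
      show "geom s (c x) * geom s (c l) = 
        fps_const (c x / (c x - c l)) * geom s (c x) + fps_const (c l / (c l - c x)) * geom s (c l)"
        if "l \<in> S" for l
        using insert.prems cx(2)[OF that] that by (intro geom_mult) auto
      show "(\<Prod>l\<in>S. psi_val (e l) (c l) (inverse (c x))) =
        (\<Prod>l\<in>S. inverse (e l)) + (\<Sum>l\<in>S. psi_residue e c S l / (1 - c l * inverse (c x)))"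
        using insert.prems insert.hyps cx by (intro partial_fractions_val) (auto simp: inj_on_def)
      show "(\<Prod>l\<in>S. fps_const (inverse (e l)) + fps_const (e l - inverse (e l)) * geom s (c l)) =
        fps_const (\<Prod>l\<in>S. inverse (e l)) + (\<Sum>l\<in>S. fps_const (psi_residue e c S l) * geom s (c l))"
        using insert.prems by (intro insert.IH) (auto simp: inj_on_def)
    qed (use insert.prems insert.hyps cx in \<open>auto simp flip: fps_const_add fps_const_mult\<close>)
  qed simp
  finally show ?thesis .
qed

section \<open>How a move changes an eigenvalue of phi\<close>

text \<open>The cases in which $f' = f \cdot (q - cz)/(1 - qcz)$ for the eigenvalues of $\phi_i$ before and after a move.
  Both $f$ and $f'$ are trivial or of the type of $\psi$; listing the cases allows all
  the interpretations of the identity (values, expansions) to be checked separately.\<close>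

definition psi_ratio :: "complex \<Rightarrow> complex \<Rightarrow> complex poly fract \<Rightarrow> complex poly fract \<Rightarrow> bool"
  where "psi_ratio q c f' f \<longleftrightarrow>
    q = 1 \<and> f' = f \<or>
    q ^ 2 \<noteq> 1 \<and> f = 1 \<and> f' = psi_at q (q * c) \<or>
    q ^ 2 \<noteq> 1 \<and> f' = 1 \<and> f = psi_at (inverse q) (inverse q * c) \<or>
    (\<exists>e. q = e ^ 2 \<and> q \<noteq> 1 \<and> f' = psi_at e c \<and> f = psi_at (inverse e) c)"

text \<open>The value of $(q - x)/(1 - qx)$, with the removable singularity at $q = 1$ removed: for
  nodes that are not adjacent the points may well coincide.\<close>

definition psi_factor :: "complex \<Rightarrow> complex \<Rightarrow> complex"
  where "psi_factor q x = (if q = 1 then 1 else (q - x) / (1 - q * x))"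

lemma inverse_sq_neq_1: "q ^ 2 \<noteq> 1 \<Longrightarrow> inverse q ^ 2 \<noteq> (1::complex)"
  by (simp add: power_inverse)

lemma psi_ratio_val:
  assumes "psi_ratio q c f' f" "q \<noteq> 0" "c \<noteq> 0" "q \<noteq> 1 \<Longrightarrow> q * (c * z) \<noteq> 1 \<and> c * z \<noteq> q"
  shows "rat_val f' z = psi_factor q (c * z) * rat_val f z"
proof -
  consider "q = 1" "f' = f" | "q ^ 2 \<noteq> 1" "f = 1" "f' = psi_at q (q * c)" 
    | "q ^ 2 \<noteq> 1" "f' = 1" "f = psi_at (inverse q) (inverse q * c)"
    | e where "q = e ^ 2" "q \<noteq> 1" "f' = psi_at e c" "f = psi_at (inverse e) c"
    using assms(1) unfolding psi_ratio_def by blast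
  then show ?thesis
  proof cases
    case 1 then show ?thesis by (simp add: psi_factor_def)
  next
    case 2 then show ?thesis using assms by (auto simp: rat_val_psi_at psi_factor_def mult.assoc)
  next
    case 3 
    then have "q \<noteq> 1" by auto
    then have nz: "1 - q * (c * z) \<noteq> 0" "q - c * z \<noteq> 0" using assms(4) by auto
    have "rat_val f z = (inverse q - c * z) / (1 - inverse q * (c * z))"
      using 3 assms(2,3) by (simp add: rat_val_psi_at inverse_sq_neq_1 mult.assoc)
    also have "inverse q - c * z = inverse q * (1 - q * (c * z))"
      using assms(2) by (simp add: algebra_simps)
    also have "1 - inverse q * (c * z) = inverse q * (q - c * z)"
      using assms(2) by (simp add: algebra_simps)
    finally have "rat_val f z = (1 - q * (c * z)) / (q - c * z)"
      using assms(2) by simp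
    then show ?thesis using 3 nz \<open>q \<noteq> 1\<close> by (simp add: psi_factor_def)
  next
    case 4
    then have e: "e \<noteq> 0" "e ^ 2 \<noteq> 1" using assms(2) by auto
    have nz: "1 - e ^ 2 * (c * z) \<noteq> 0" using assms(4) 4 by auto
    have 1: "inverse e - e * (c * z) = inverse e * (1 - e ^ 2 * (c * z))"
      using e by (simp add: field_simps power2_eq_square)
    have 2: "e - inverse e * (c * z) = inverse e * (e ^ 2 - c * z)"
      using e by (simp add: field_simps power2_eq_square)
    have "rat_val f' z = inverse e * (e ^ 2 - c * z) / (1 - c * z)"
      "rat_val f z = inverse e * (1 - e ^ 2 * (c * z)) / (1 - c * z)"
      using 4 e assms(3) by (simp_all add: rat_val_psi_at inverse_sq_neq_1 mult.assoc 1[symmetric] 2[symmetric])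
    then show ?thesis using nz 4 by (simp add: psi_factor_def)
  qed
qed

text \<open>The polynomial $x - yz$ in the variable $z$ of the expansion at 0, or $z^{-1}(x - yz)$ in
  the variable $z^{-1}$ of the expansion at infinity.\<close>

definition sg_poly :: "sign \<Rightarrow> complex \<Rightarrow> complex \<Rightarrow> complex fps"
  where "sg_poly s x y = (case s of
     Pos \<Rightarrow> fps_const x - fps_const y * fps_X
   | Neg \<Rightarrow> fps_const x * fps_X - fps_const y)"

lemma sg_poly_smult: "fps_const a * sg_poly s x y = sg_poly s (a * x) (a * y)"
  by (cases s) (simp_all add: sg_poly_def right_diff_distrib mult.assoc[symmetric])

lemma expansion_psi_at_mult:
  assumes "e \<noteq> 0" "e ^ 2 \<noteq> 1" "c \<noteq> 0"
  shows "expansion s (psi_at e c) * sg_poly s 1 c = sg_poly s e (inverse e * c)"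
proof -
  let ?E' = "fps_const (inverse e)" and ?D = "fps_const (e - inverse e)" and ?C = "fps_const c"
  show ?thesis
  proof (cases s)
    case Pos
    have "expansion s (psi_at e c) * sg_poly s 1 c = 
        ?E' * (1 - ?C * fps_X) + ?D * (geom Pos c * (1 - ?C * fps_X))"
      using Pos by (simp only: expansion_psi_at[OF assms] sg_poly_def sign.case distrib_right mult.assoc fps_const_1_eq_1)
    also have "\<dots> = ?E' + ?D - (?E' * ?C) * fps_X"
      unfolding geom_Pos by (simp only: right_diff_distrib mult_1_right mult.assoc) simp
    also have "\<dots> = sg_poly s e (inverse e * c)"
      using Pos by (simp add: sg_poly_def)
    finally show ?thesis .
  next
    case Neg
    have "expansion s (psi_at e c) * sg_poly s 1 c = 
        ?E' * (fps_X - ?C) + ?D * (geom Neg c * (fps_X - ?C))"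
      using Neg by (simp only: expansion_psi_at[OF assms] sg_poly_def sign.case distrib_right mult.assoc fps_const_1_eq_1 mult_1_left)
    also have "\<dots> = (?E' + ?D) * fps_X - ?E' * ?C"
      unfolding geom_Neg[OF assms(3)] by (simp only: right_diff_distrib distrib_right) simp
    also have "\<dots> = sg_poly s e (inverse e * c)"
      using Neg by (simp add: sg_poly_def)
    finally show ?thesis .
  qed
qed

lemma sg_poly_nz: "c \<noteq> 0 \<Longrightarrow> sg_poly s 1 c \<noteq> 0"
proof
  assume "c \<noteq> 0" "sg_poly s 1 c = 0"
  moreover have "fps_nth (sg_poly s 1 c) 0 = (case s of Pos \<Rightarrow> 1 | Neg \<Rightarrow> - c)"
    by (cases s) (simp_all add: sg_poly_def)
  ultimately show False by (cases s) auto
qed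

lemma psi_ratio_expansion:
  assumes "psi_ratio q c f' f" "q \<noteq> 0" "c \<noteq> 0"
  shows "sg_poly s 1 (q * c) * expansion s f' = sg_poly s q c * expansion s f"
proof -
  consider "q = 1" "f' = f" | "q ^ 2 \<noteq> 1" "f = 1" "f' = psi_at q (q * c)" 
    | "q ^ 2 \<noteq> 1" "f' = 1" "f = psi_at (inverse q) (inverse q * c)"
    | e where "q = e ^ 2" "q \<noteq> 1" "f' = psi_at e c" "f = psi_at (inverse e) c"
    using assms(1) unfolding psi_ratio_def by blast
  then show ?thesis
  proof cases
    case 1 then show ?thesis by simp
  next
    case 2 
    have "expansion s (psi_at q (q * c)) * sg_poly s 1 (q * c) = sg_poly s q (inverse q * (q * c))"
      using 2 assms by (intro expansion_psi_at_mult) auto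
    also have "inverse q * (q * c) = c" using assms by simp
    finally show ?thesis
      using 2 by (simp add: mult.commute[of "sg_poly s 1 (q * c)"])
  next
    case 3
    have "sg_poly s q c = fps_const q * sg_poly s 1 (inverse q * c)"
      using assms(2) by (simp add: sg_poly_smult mult.assoc[symmetric])
    then have "sg_poly s q c * expansion s f = fps_const q * (expansion s f * sg_poly s 1 (inverse q * c))"
      by (simp only: mult_ac)
    also have "\<dots> = fps_const q * sg_poly s (inverse q) (q * (inverse q * c))"
      using 3 assms(2,3) expansion_psi_at_mult[of "inverse q" "inverse q * c" s]
      by (simp add: inverse_sq_neq_1)
    also have "\<dots> = sg_poly s 1 (q * c)"
    proof -
      have 1: "q * (inverse q * c) = c" and 2: "q * inverse q = 1"
        using assms(2) by (simp_all add: field_simps)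
      show ?thesis unfolding sg_poly_smult 1 2 by (rule refl)
    qed
    finally show ?thesis using 3 by simp
  next
    case 4
    then have e: "e \<noteq> 0" "e ^ 2 \<noteq> 1" using assms(2) by auto
    let ?N = "sg_poly s 1 c"
    have E: "expansion s f' * ?N = sg_poly s e (inverse e * c)"
      unfolding 4 using e assms(3) by (intro expansion_psi_at_mult)
    have "expansion s f * ?N = sg_poly s (inverse e) (inverse (inverse e) * c)"
      unfolding 4 using e assms(3) by (intro expansion_psi_at_mult inverse_sq_neq_1) auto
    then have E': "expansion s f * ?N = sg_poly s (inverse e) (e * c)"
      by simp
    have A: "sg_poly s 1 (q * c) = fps_const e * sg_poly s (inverse e) (e * c)" 
      and D: "sg_poly s q c = fps_const e * sg_poly s e (inverse e * c)"
    proof -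
      have "e * inverse e = 1" "e * (inverse e * c) = c" "q = e * e"
        using e 4 by (simp_all add: field_simps power2_eq_square)
      then show "sg_poly s 1 (q * c) = fps_const e * sg_poly s (inverse e) (e * c)" 
        "sg_poly s q c = fps_const e * sg_poly s e (inverse e * c)"
        unfolding sg_poly_smult by (simp_all only: mult.assoc)
    qed
    have "(sg_poly s 1 (q * c) * expansion s f') * ?N = (sg_poly s q c * expansion s f) * ?N"
      unfolding A D mult.assoc E E' by (simp only: mult_ac)
    then show ?thesis using sg_poly_nz[OF assms(3)] by simp
  qed
qed

definition laurent_coeff :: "sign \<Rightarrow> complex fps \<Rightarrow> int \<Rightarrow> complex"
  where "laurent_coeff s F m = (if 0 \<le> sg s * m then fps_nth F (nat (sg s * m)) else 0)"

text \<open>The form in which the identity of expansions enters the relation between $\phi$ and $x$.\<close>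

lemma laurent_coeff_relation:
  assumes "sg_poly s 1 x * F' = sg_poly s q c * F"
  shows "laurent_coeff s F' a - x * laurent_coeff s F' (a - 1) = q * laurent_coeff s F a - c * laurent_coeff s F (a - 1)"
proof (cases s)
  case Pos
  have co: "fps_nth (sg_poly s u y * G) m = u * fps_nth G m - y * (if m = 0 then 0 else fps_nth G (m - 1))"
    for u y G m
    using Pos by (simp add: sg_poly_def left_diff_distrib mult.assoc)
  show ?thesis
  proof (cases a rule: int_cases)
    case (nonneg m)
    have "fps_nth (sg_poly s 1 x * F') m = fps_nth (sg_poly s q c * F) m"
      using assms by simp
    then have "fps_nth F' m - x * (if m = 0 then 0 else fps_nth F' (m - 1)) = 
        q * fps_nth F m - c * (if m = 0 then 0 else fps_nth F (m - 1))"
      unfolding co by simp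
    moreover have "laurent_coeff s G a = fps_nth G m" "laurent_coeff s G (a - 1) = (if m = 0 then 0 else fps_nth G (m - 1))" for G
      unfolding nonneg laurent_coeff_def Pos by (auto simp: of_nat_diff nat_diff_distrib')
    ultimately show ?thesis by simp
  next
    case (neg m)
    have "laurent_coeff s G a = 0" "laurent_coeff s G (a - 1) = 0" for G
      unfolding neg laurent_coeff_def Pos by simp_all
    then show ?thesis by simp
  qed
next
  case Neg
  have co: "fps_nth (sg_poly s u y * G) m = u * (if m = 0 then 0 else fps_nth G (m - 1)) - y * fps_nth G m"
    for u y G m
    using Neg by (simp add: sg_poly_def left_diff_distrib mult.assoc)
  show ?thesis
  proof (cases "1 - a" rule: int_cases)
    case (nonneg m)
    then have a: "a = 1 - int m" by simp
    have "fps_nth (sg_poly s 1 x * F') m = fps_nth (sg_poly s q c * F) m"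
      using assms by simp
    then have "(if m = 0 then 0 else fps_nth F' (m - 1)) - x * fps_nth F' m = 
        q * (if m = 0 then 0 else fps_nth F (m - 1)) - c * fps_nth F m"
      unfolding co by simp
    moreover have "laurent_coeff s G (a - 1) = fps_nth G m" "laurent_coeff s G a = (if m = 0 then 0 else fps_nth G (m - 1))" for G
      unfolding a laurent_coeff_def Neg by (auto simp: of_nat_diff nat_diff_distrib')
    ultimately show ?thesis by simp
  next
    case (neg m)
    then have "a = 2 + int m" by simp
    then have "laurent_coeff s G a = 0" "laurent_coeff s G (a - 1) = 0" for G
      unfolding laurent_coeff_def Neg by simp_all
    then show ?thesis by simp
  qed
qed

section \<open>Weights and eigenvalues\<close>

locale toroidal = tableau_boxes +
  fixes \<tau> :: complex
  assumes tau: "exp \<tau> = \<epsilon>"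
begin

lemma eps_pow_int: "eps_pow \<tau> (of_int m) = \<epsilon> powi m"
  by (simp add: eps_pow_def exp_power_int tau[symmetric] mult.commute)

lemma eps_pow_add: "eps_pow \<tau> (x + y) = eps_pow \<tau> x * eps_pow \<tau> y"
  by (simp add: eps_pow_def of_rat_add distrib_left exp_add)

lemma eps_pow_0: "eps_pow \<tau> 0 = 1"
  by (simp add: eps_pow_def)

text \<open>The weight at the node \<open>i\<close>: $-1$ at a maximum, $1$ at a minimum, $0$ elsewhere.\<close>

definition box_weight :: "box \<Rightarrow> nat \<Rightarrow> int"
  where "box_weight B i = of_bool (occ n B i) - of_bool (occ n B (nxt n i))"

lemma box_k_eq:
  assumes "B \<in> boxes"
  shows "box_k n \<tau> h B = eps_pow \<tau> (\<Sum>i\<le>n. Poly_Mapping.lookup h i * of_int (box_weight B i))"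
proof -
  obtain T b where TB: "B = (T, b)" "T \<in> tabs" using assms by (auto simp: boxes_def)
  note T = tabsD(5)[OF TB(2)]
  let ?h = "Poly_Mapping.lookup h"
  have mod: "j mod (n + 1) = (if j = n + 1 then 0 else j)" "j \<noteq> 0" if "j \<in> set T" for j
    using T[OF that] by auto
  have mod': "(j - 1) mod (n + 1) = j - 1" "j - 1 \<le> n" "j - 1 + 1 = j" if "j \<in> set T" for j
    using T[OF that] by auto
  have 1: "(\<Sum>j\<in>set T. Lam n j h) = (\<Sum>i\<in>{i\<in>{..n}. occ n B i}. ?h i)"
  proof (rule sum.reindex_bij_witness[of _ "\<lambda>i. if i = 0 then n + 1 else i" "\<lambda>j. j mod (n + 1)"])
    fix j assume j: "j \<in> set T"
    show "(if j mod (n + 1) = 0 then n + 1 else j mod (n + 1)) = j"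
      using mod[OF j] by simp
    show "j mod (n + 1) \<in> {i \<in> {..n}. occ n B i}"
      using mod[OF j] j T[OF j] by (auto simp: occ_def TB)
    show "?h (j mod (n + 1)) = Lam n j h" by (simp add: Lam_def)
  qed (auto simp: occ_def TB)
  have 2: "(\<Sum>j\<in>set T. Lam n (j - 1) h) = (\<Sum>i\<in>{i\<in>{..n}. occ n B (nxt n i)}. ?h i)"
  proof (rule sum.reindex_bij_witness[of _ "\<lambda>i. i + 1" "\<lambda>j. j - 1"])
    fix j assume j: "j \<in> set T"
    show "j - 1 + 1 = j" by (rule mod'(3)[OF j])
    show "j - 1 \<in> {i \<in> {..n}. occ n B (nxt n i)}"
      using mod'[OF j] j by (simp add: occ_nxt TB)
    show "?h (j - 1) = Lam n (j - 1) h" using mod'[OF j] by (simp add: Lam_def)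
  qed (auto simp: occ_nxt TB)
  have "(\<Sum>j\<leftarrow>T. Lam n j h - Lam n (j - 1) h) = (\<Sum>j\<in>set T. Lam n j h - Lam n (j - 1) h)"
    using tabsD(3)[OF TB(2)] by (rule sum_list_distinct_conv_sum_set)
  also have "\<dots> = (\<Sum>i\<le>n. ?h i * of_bool (occ n B i)) - (\<Sum>i\<le>n. ?h i * of_bool (occ n B (nxt n i)))"
    unfolding sum_subtractf 1 2 
    by (intro arg_cong2[of _ _ _ _ "(-)"] sum.mono_neutral_cong_left) auto
  also have "\<dots> = (\<Sum>i\<le>n. ?h i * of_int (box_weight B i))"
    unfolding sum_subtractf[symmetric] box_weight_def
    by (intro sum.cong) (auto simp: algebra_simps)
  finally show ?thesis by (simp add: TB)
qed

lemma box_weight_step: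
  assumes B: "B \<in> boxes" and ij: "i \<le> n" "j \<le> n" and x: "bx s j B = Some (c, v)"
  shows "box_weight v i = box_weight B i + sg s * cartan n i j"
proof -
  note xs = box_x_iff[OF B ij(2), of s c v, THEN iffD1, OF x]
  note D = moves_toD(1)[of n \<epsilon> s j B v]
  have nn: "nxt n i \<noteq> i" "nxt n j \<noteq> j" "nxt n (nxt n i) \<noteq> i" "nxt n (nxt n j) \<noteq> j" 
    using nxt_neq ij by auto
  show ?thesis
    using xs D[of i] D[of "nxt n i"] nn ij nxt_inj[OF ij]
    by (cases s) (auto simp: box_weight_def cartan_def adjacent_iff movable_def)
qed

lemma box_k_step:
  assumes B: "B \<in> boxes" and j: "j \<le> n" and x: "bx s j B = Some (c, v)"
  shows "box_k n \<tau> h v = eps_pow \<tau> (of_int (sg s) * alpha n j h) * box_k n \<tau> h B"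
proof -
  have "v \<in> boxes" using box_x_boxes[OF x B j] .
  have "(\<Sum>i\<le>n. Poly_Mapping.lookup h i * of_int (box_weight v i)) =
    of_int (sg s) * alpha n j h + (\<Sum>i\<le>n. Poly_Mapping.lookup h i * of_int (box_weight B i))"
    unfolding alpha_def sum_distrib_left sum.distrib[symmetric]
    using box_weight_step[OF B _ j x] by (intro sum.cong) (auto simp: algebra_simps)
  then show ?thesis
    using \<open>v \<in> boxes\<close> B by (simp add: box_k_eq eps_pow_add)
qed

lemma box_k_single:
  assumes "B \<in> boxes" "i \<le> n"
  shows "box_k n \<tau> (Poly_Mapping.single i (of_int m)) B = \<epsilon> powi (m * box_weight B i)"
proof -
  have "(\<Sum>l\<le>n. Poly_Mapping.lookup (Poly_Mapping.single i (of_int m)) l * of_int (box_weight B l)) =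
    (of_int (m * box_weight B i) :: rat)"
  proof -
    have "(\<Sum>l\<le>n. Poly_Mapping.lookup (Poly_Mapping.single i (of_int m)) l * of_int (box_weight B l)) =
      (\<Sum>l\<in>{i}. Poly_Mapping.lookup (Poly_Mapping.single i (of_int m)) l * (of_int (box_weight B l) :: rat))"
      using assms by (intro sum.mono_neutral_right) (auto simp: lookup_single when_def)
    then show ?thesis by simp
  qed
  then show ?thesis using assms by (simp only: box_k_eq eps_pow_int)
qed

abbreviation bphi :: "nat \<Rightarrow> box \<Rightarrow> complex poly fract" where "bphi \<equiv> box_phi n \<epsilon>"

text \<open>The value \<open>e\<close> for which the eigenvalue of $\phi_i$ at an extremum of sign \<open>s\<close> is
  $(e - e^{-1}cz)/(1 - cz)$.\<close>

definition pw :: "sign \<Rightarrow> complex" where "pw s = \<epsilon> powi (- sg s)"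

lemma pw_simps: "pw Pos = inverse \<epsilon>" "pw Neg = \<epsilon>"
  by (simp_all add: pw_def power_int_minus)

lemma pw_nz: "pw s \<noteq> 0" using eps_nz by (cases s) (auto simp: pw_simps)

lemma pw_sq: "pw s ^ 2 \<noteq> 1" using eps_sq inv_eps_sq by (cases s) (auto simp: pw_simps)

lemma pw_opp: "pw (opp s) = inverse (pw s)" by (cases s) (auto simp: pw_simps)

lemma box_phi_Some:
  assumes "B \<in> boxes" "i \<le> n" "bx s i B = Some (c, v)"
  shows "bphi i B = psi_at (pw s) c"
  using box_phi_eq[OF assms(1,2)] box_x_iff[OF assms(1,2), of s c v, THEN iffD1, OF assms(3)]
  by (cases s) (auto simp: movable_def pw_simps)

lemma box_phi_None:
  assumes "B \<in> boxes" "i \<le> n" "bx s i B = None" "bx (opp s) i B = None"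
  shows "bphi i B = 1"
  using box_phi_eq[OF assms(1,2)] box_x_None_iff[OF assms(1,2)] assms(3,4)
  by (cases s) auto

lemma box_phi_cases:
  assumes "B \<in> boxes" "i \<le> n"
  obtains "bx Pos i B = None" "bx Neg i B = None" "bphi i B = 1" 
  | s c v where "bx s i B = Some (c, v)" "bx (opp s) i B = None" "bphi i B = psi_at (pw s) c"
proof (cases "\<exists>s c v. bx s i B = Some (c, v)")
  case True
  then obtain s c v where S: "bx s i B = Some (c, v)" by blast
  show ?thesis by (rule that(2)[OF S box_x_exclusive[OF assms S] box_phi_Some[OF assms S]])
next
  case False
  then have "bx s i B = None" for s by (metis not_None_eq surj_pair)
  then show ?thesis using that(1) box_phi_None[OF assms, of Pos] by simp
qed

lemma box_phi_cong:
  assumes B: "B \<in> boxes" "B' \<in> boxes" and i: "i \<le> n"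
    and *: "\<And>s c. (\<exists>w. bx s i B = Some (c, w)) \<Longrightarrow> (\<exists>w. bx s i B' = Some (c, w))"
    and **: "\<And>s c. (\<exists>w. bx s i B' = Some (c, w)) \<Longrightarrow> (\<exists>w. bx s i B = Some (c, w))"
  shows "bphi i B = bphi i B'"
proof (rule box_phi_cases[OF B(1) i])
  assume N: "bx Pos i B = None" "bx Neg i B = None" "bphi i B = 1"
  have "bx s i B' = None" for s
  proof (cases "bx s i B'")
    case (Some cw)
    then obtain w' where "bx s i B = Some (fst cw, w')"
      using **[of s "fst cw"] by (metis prod.collapse)
    then show ?thesis using N by (cases s) simp_all
  qed
  then show ?thesis using box_phi_None[OF B(2) i, of Pos] N by simp
next
  fix s c v assume S: "bx s i B = Some (c, v)" "bphi i B = psi_at (pw s) c"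
  then obtain w where "bx s i B' = Some (c, w)" using * by blast
  then show ?thesis using box_phi_Some[OF B(2) i] S by simp
qed

text \<open>At a node that is not adjacent nothing changes. At the node itself a maximum becomes a minimum or
  conversely. At an adjacent node an extremum is either created or destroyed by the move.\<close>

lemma phi_step:
  assumes B: "B \<in> boxes" and ij: "i \<le> n" "j \<le> n" and x: "bx s j B = Some (c, v)"
  shows "psi_ratio (\<epsilon> powi (sg s * cartan n i j)) c (bphi i v) (bphi i B)"
proof -
  have v: "v \<in> boxes" using box_x_boxes[OF x B ij(2)] .
  have x': "bx (opp s) j v = Some (c, B)" using box_x_inverse[OF B ij(2) x] .
  consider "i = j" | "i \<noteq> j" "adjacent n i j" | "i \<noteq> j" "\<not> adjacent n i j" by blast
  then show ?thesis
  proof cases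
    case 1
    have "bphi i v = psi_at (pw (opp s)) c" "bphi i B = psi_at (inverse (pw (opp s))) c"
      using box_phi_Some[OF B ij(2) x] box_phi_Some[OF v ij(2) x'] 1 by (simp_all add: pw_opp)
    moreover have "\<epsilon> powi (sg s * cartan n i j) = pw (opp s) ^ 2"
      using 1 by (cases s) (simp_all add: cartan_def pw_simps power_int_minus power_inverse)
    ultimately show ?thesis
      unfolding psi_ratio_def using pw_sq by metis
  next
    case 2
    have q: "\<epsilon> powi (sg s * cartan n i j) = pw s"
      using 2 by (simp add: cartan_def pw_def)
    have Bi: "bx s i B = None"
      using box_x_adjacent_opp[OF v ij(2,1) _ x'] 2 adjacent_sym by simp
    have vi: "bx (opp s) i v = None"
      using box_x_adjacent_opp[OF B ij(2,1) _ x] 2 adjacent_sym by simp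
    from box_x_adjacent[OF B ij 2(2) x] show ?thesis
    proof (elim disjE exE conjE)
      fix w assume w: "bx s i v = Some (\<epsilon> powi (- sg s) * c, w)" "bx (opp s) i B = None"
      have "bphi i B = 1" using box_phi_None[OF B ij(1) Bi w(2)] .
      moreover have "bphi i v = psi_at (pw s) (pw s * c)"
        using box_phi_Some[OF v ij(1) w(1)] by (simp add: pw_def)
      ultimately show ?thesis
        unfolding psi_ratio_def q using pw_sq by blast
    next
      fix w assume w: "bx (opp s) i B = Some (\<epsilon> powi sg s * c, w)" "bx s i v = None"
      have "bphi i v = 1" using box_phi_None[OF v ij(1) w(2) vi] .
      moreover have "bphi i B = psi_at (inverse (pw s)) (inverse (pw s) * c)"
        using box_phi_Some[OF B ij(1) w(1)] by (simp add: pw_opp) (simp add: pw_def power_int_minus)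
      ultimately show ?thesis
        unfolding psi_ratio_def q using pw_sq by blast
    qed
  next
    case 3
    have "bphi i v = bphi i B"
    proof (rule box_phi_cong[OF v B ij(1)])
      fix s' c' assume "\<exists>w. bx s' i v = Some (c', w)"
      then show "\<exists>w. bx s' i B = Some (c', w)"
        using box_x_far[OF B ij(2,1) _ _ x] 3 adjacent_sym by metis
    next
      fix s' c' assume "\<exists>w. bx s' i B = Some (c', w)"
      then show "\<exists>w. bx s' i v = Some (c', w)"
        using box_x_far[OF v ij(2,1) _ _ x'] 3 adjacent_sym by metis
    qed
    then show ?thesis
      using 3 by (simp add: psi_ratio_def cartan_def)
  qed
qed

lemma expansion_box_phi_0:
  assumes "B \<in> boxes" "i \<le> n"
  shows "fps_nth (expansion s (bphi i B)) 0 = \<epsilon> powi (sg s * box_weight B i)"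
proof (rule box_phi_cases[OF assms])
  assume N: "bx Pos i B = None" "bx Neg i B = None" "bphi i B = 1"
  have "occ n B i = occ n B (nxt n i)"
    using N(1,2) box_x_None_iff[OF assms] by (auto simp: movable_def)
  then show ?thesis using N by (simp add: box_weight_def)
next
  fix s' c v assume S: "bx s' i B = Some (c, v)" "bphi i B = psi_at (pw s') c"
  note xs = box_x_iff[OF assms, of s' c v, THEN iffD1, OF S(1)]
  have c: "c \<noteq> 0" using xs assms(1) eps_nz by (auto simp: weight_pt_def height_def boxes_def)
  have "box_weight B i = - sg s'"
    using xs by (cases s') (auto simp: box_weight_def movable_def)
  then show ?thesis
    unfolding S(2) expansion_psi_at[OF pw_nz pw_sq c]
    by (cases s; cases s') (simp_all add: geom_def pw_simps power_int_minus)
qed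

lemma weight_pt_nz: "B \<in> boxes \<Longrightarrow> weight_pt \<epsilon> s B i \<noteq> 0"
  using eps_nz by (auto simp: weight_pt_def height_def boxes_def)

lemma box_x_nz: "B \<in> boxes \<Longrightarrow> i \<le> n \<Longrightarrow> bx s i B = Some (c, v) \<Longrightarrow> c \<noteq> 0"
  using box_x_iff weight_pt_nz by metis

definition generic :: "complex \<Rightarrow> complex \<Rightarrow> bool"
  where "generic x y \<longleftrightarrow> (\<forall>m::int. x \<noteq> y * \<epsilon> powi (2 * m))"

lemma generic_sym: "generic x y \<Longrightarrow> generic y x"
  unfolding generic_def
proof (intro allI notI)
  fix m :: int assume *: "\<forall>m. x \<noteq> y * \<epsilon> powi (2 * m)" "y = x * \<epsilon> powi (2 * m)"
  have "y * \<epsilon> powi (2 * (- m)) = x * (\<epsilon> powi (2 * m) * \<epsilon> powi (2 * (- m)))"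
    using *(2) by simp
  also have "\<dots> = x" unfolding powi_add'[symmetric] by simp
  finally show False using *(1) by metis
qed

lemma generic_cls:
  assumes "generic a a'" "cls a i c" "cls a' j c'" "even (int i + int j + k)"
  shows "c \<noteq> c' * \<epsilon> powi k"
proof
  assume eq: "c = c' * \<epsilon> powi k"
  obtain m m' where m: "c = a * \<epsilon> powi (int i + 2 * m)" "c' = a' * \<epsilon> powi (int j + 2 * m')"
    using assms by (auto simp: cls_def)
  obtain p where p: "int i + int j + k = 2 * p" using assms(4) by (elim evenE)
  have "a = a * (\<epsilon> powi (int i + 2 * m) * \<epsilon> powi (- (int i + 2 * m)))"
    unfolding powi_add'[symmetric] by simp
  also have "\<dots> = c * \<epsilon> powi (- (int i + 2 * m))" by (simp add: m)
  also have "\<dots> = a' * (\<epsilon> powi (int j + 2 * m') * \<epsilon> powi k * \<epsilon> powi (- (int i + 2 * m)))"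
    unfolding eq m by simp
  also have "\<dots> = a' * \<epsilon> powi (2 * (m' + p - int i - m))"
    unfolding powi_add'[symmetric] by (rule powi_eq) (use p in simp)
  finally show False using assms(1) unfolding generic_def by blast
qed

end

section \<open>Components of the currents on the tensor product\<close>

lemma listset_iff: "t \<in> listset As \<longleftrightarrow> length t = length As \<and> (\<forall>l<length As. t ! l \<in> As ! l)"
proof (induction As arbitrary: t)
  case (Cons A As)
  show ?case
    by (cases t) (auto simp: Cons set_Cons_def nth_Cons split: nat.splits)
qed auto

locale tensor_setting = toroidal +
  fixes as :: "complex list"
  assumes as_nz: "\<And>l. l < length as \<Longrightarrow> as ! l \<noteq> 0"
    and as_generic: "\<And>l u. l < length as \<Longrightarrow> u < length as \<Longrightarrow> l \<noteq> u \<Longrightarrow> generic (as ! l) (as ! u)"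
begin

abbreviation k :: nat where "k \<equiv> length as"
abbreviation TB :: "box list set" where "TB \<equiv> tensor_basis r \<epsilon> as"

lemma TB_iff: "t \<in> TB \<longleftrightarrow> length t = k \<and> (\<forall>l<k. t ! l \<in> V (as ! l))"
  by (auto simp: tensor_basis_def listset_iff)

lemma TB_length: "t \<in> TB \<Longrightarrow> length t = k"
  by (simp add: TB_iff)

lemma TB_boxes: "t \<in> TB \<Longrightarrow> l < k \<Longrightarrow> t ! l \<in> boxes"
  using V_boxes[OF as_nz, of l] by (auto simp: TB_iff)

lemma TB_update:
  assumes "t \<in> TB" "u < k" "i \<le> n" "bx s i (t ! u) = Some (c, v)"
  shows "t[u := v] \<in> TB"
  using assms V_step(1)[OF as_nz[OF assms(2)] _ assms(3,4)] by (auto simp: TB_iff nth_list_update)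

lemma TB_param:
  assumes "t \<in> TB" "u < k" "i \<le> n" "bx s i (t ! u) = Some (c, v)"
  shows "cls (as ! u) i c" "c \<noteq> 0"
  using assms V_step(2)[OF as_nz[OF assms(2)] _ assms(3,4)] box_x_nz[OF TB_boxes assms(3,4)]
  by (auto simp: TB_iff)

lemma adjacent_parity: "adjacent n i j \<Longrightarrow> i \<le> n \<Longrightarrow> j \<le> n \<Longrightarrow> even (int i + int j + 1)"
  using n by (auto simp: adjacent_iff nxt_eq split: if_splits)

text \<open>Adjacent nodes have different parity because the cycle has even length, so the powers of
  $\epsilon$ that occur here are even.\<close>

lemma params_generic:
  assumes t: "t \<in> TB" "t' \<in> TB" and u: "u < k" "u' < k" "u \<noteq> u'" and ij: "i \<le> n" "j \<le> n"
    and x: "bx s i (t ! u) = Some (c, v)" "bx s' j (t' ! u') = Some (c', v')"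
    and C: "cartan n i j \<noteq> 0"
  shows "c \<noteq> \<epsilon> powi (sg s'' * cartan n i j) * c'" "c' \<noteq> \<epsilon> powi (sg s'' * cartan n i j) * c"
proof -
  have even: "even (int i + int j + sg s'' * cartan n i j)"
    using C adjacent_parity[OF _ ij] by (cases s'') (auto simp: cartan_def split: if_splits)
  have even': "even (int j + int i + sg s'' * cartan n i j)"
    using even by (simp add: add.commute)
  note c = TB_param(1)[OF t(1) u(1) ij(1) x(1)] and c' = TB_param(1)[OF t(2) u(2) ij(2) x(2)]
  show "c \<noteq> \<epsilon> powi (sg s'' * cartan n i j) * c'" "c' \<noteq> \<epsilon> powi (sg s'' * cartan n i j) * c"
    using generic_cls[OF as_generic[OF u] c c' even] generic_cls[OF as_generic[OF u(2,1)] c' c even'] u(3)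
    by (auto simp: mult.commute)
qed

lemma eps_powi_cartan_1:
  assumes "\<epsilon> powi (sg s * cartan n i j) = 1"
  shows "cartan n i j = 0"
proof (rule ccontr)
  assume "cartan n i j \<noteq> 0"
  then have "(\<epsilon> powi (sg s * cartan n i j)) ^ 2 \<noteq> 1 \<or> \<epsilon> powi (sg s * cartan n i j) = (pw (opp s)) ^ 2"
    using pw_sq[of s]
    by (cases s) (auto simp: cartan_def pw_simps power_int_minus power_inverse split: if_splits)
  then show False using assms pw_sq[of "opp s"] by auto
qed

text \<open>The pole and the zero of a factor of type $\psi$ differ from the points of the same node by
  even powers of $\epsilon$, and such points lie on one tensor factor only.\<close>

lemma spectator_regular:
  assumes t: "t \<in> TB" and u: "u < k" "l < k" "u \<noteq> l" and i: "i \<le> n"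
    and x: "bx s i (t ! u) = Some (c, v)"
  shows "no_pole_at (bphi i (t ! l)) (inverse c)" "rat_val (bphi i (t ! l)) (inverse c) \<noteq> 0"
proof -
  have c: "c \<noteq> 0" using TB_param[OF t u(1) i x] by simp
  have "no_pole_at (bphi i (t ! l)) (inverse c) \<and> rat_val (bphi i (t ! l)) (inverse c) \<noteq> 0"
  proof (rule box_phi_cases[OF TB_boxes[OF t u(2)] i])
    fix s' c' v' assume x': "bx s' i (t ! l) = Some (c', v')" and ph: "bphi i (t ! l) = psi_at (pw s') c'"
    have c': "c' \<noteq> 0" using TB_param[OF t u(2) i x'] by simp
    have "cls (as ! u) i c" "cls (as ! l) i c'" using TB_param[OF t u(2) i x'] TB_param[OF t u(1) i x] by auto
    note g = generic_cls[OF as_generic[OF u] this]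
    have "c \<noteq> c'" using g[of 0] by simp
    moreover have "c \<noteq> c' * \<epsilon> powi 2" "c \<noteq> c' * \<epsilon> powi (- 2)"
      using g[of 2] g[of "- 2"] by simp_all
    then have "c' * inverse c \<noteq> pw s' ^ 2"
      using c c' eps_nz
      by (cases s') (auto simp: pw_simps field_simps power_int_minus power2_eq_square)
    ultimately show ?thesis
      unfolding ph using c pw_nz[of s'] pw_sq[of s'] c'
      by (auto simp: no_pole_psi_at rat_val_psi_at field_simps power2_eq_square)
  qed auto
  then show "no_pole_at (bphi i (t ! l)) (inverse c)" "rat_val (bphi i (t ! l)) (inverse c) \<noteq> 0" by auto
qed

text \<open>The contribution of the spectators when a current acts on the factor \<open>u\<close> at the point \<open>c\<close>.\<close>

definition amp :: "sign \<Rightarrow> nat \<Rightarrow> nat \<Rightarrow> box list \<Rightarrow> complex \<Rightarrow> complex"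
  where "amp s i u t c = (\<Prod>l\<in>spectators s u (length t). rat_val (bphi i (t ! l)) (inverse c))"

text \<open>The component of a current that acts on the factor \<open>u\<close>.\<close>

definition xu :: "sign \<Rightarrow> nat \<Rightarrow> int \<Rightarrow> nat \<Rightarrow> box list \<Rightarrow> (box list \<Rightarrow>\<^sub>0 complex)"
  where "xu s i m u t = (case bx s i (t ! u) of None \<Rightarrow> 0
    | Some (c, v) \<Rightarrow> Poly_Mapping.single (t[u := v]) (amp s i u t c * c powi m))"

lemma drinfeld_x_eq: "drinfeld_x n \<epsilon> s i m t = (\<Sum>u<length t. xu s i m u t)"
  unfolding drinfeld_x_def xu_def amp_def by (rule refl)

lemma xu_Some:
  "bx s i (t ! u) = Some (c, v) \<Longrightarrow> xu s i m u t = Poly_Mapping.single (t[u := v]) (amp s i u t c * c powi m)"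
  by (simp add: xu_def)

lemma xu_None: "bx s i (t ! u) = None \<Longrightarrow> xu s i m u t = 0"
  by (simp add: xu_def)

lemma spectators_neq: "l \<in> spectators s u m \<Longrightarrow> u < m \<Longrightarrow> l \<noteq> u \<and> l < m"
  by (cases s) auto

lemma amp_nz:
  assumes "t \<in> TB" "u < k" "i \<le> n" "bx s i (t ! u) = Some (c, v)"
  shows "amp s i u t c \<noteq> 0"
proof -
  have "finite (spectators s u m)" for m by (cases s) auto
  then show ?thesis
    using spectator_regular(2)[OF assms(1,2) _ _ assms(3,4)] spectators_neq[of _ s u "length t"] assms(2) 
      TB_length[OF assms(1)]
    by (auto simp: amp_def)
qed

lemma amp_update_self: "u < length t \<Longrightarrow> amp s i u (t[u := v]) c = amp s i u t c"
  unfolding amp_def length_list_update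
proof (rule prod.cong[OF refl])
  fix l assume "u < length t" "l \<in> spectators s u (length t)"
  then have "u \<noteq> l" using spectators_neq by blast
  then show "rat_val (bphi i (t[u := v] ! l)) (inverse c) = rat_val (bphi i (t ! l)) (inverse c)"
    by simp
qed

text \<open>A move on a spectator changes its eigenvalue by the factor of \<open>phi_step\<close>.\<close>

lemma amp_update:
  assumes t: "t \<in> TB" and u: "u < k" "u' < k" "u \<noteq> u'" and ij: "i \<le> n" "j \<le> n"
    and x: "bx s i (t ! u) = Some (c, v)" "bx s' j (t ! u') = Some (c', v')"
  shows "amp s i u (t[u' := v']) c = 
    (if u' \<in> spectators s u k then psi_factor (\<epsilon> powi (sg s' * cartan n i j)) (c' * inverse c) else 1) *
    amp s i u t c"
proof -
  let ?q = "\<epsilon> powi (sg s' * cartan n i j)" and ?S = "spectators s u k"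
  have fin: "finite ?S" by (cases s) auto
  have len: "length t = k" using TB_length[OF t] .
  have c: "c \<noteq> 0" "c' \<noteq> 0" using TB_param[OF t u(1) ij(1) x(1)] TB_param[OF t u(2) ij(2) x(2)] by auto
  show ?thesis
  proof (cases "u' \<in> ?S")
    case True
    have "rat_val (bphi i v') (inverse c) = psi_factor ?q (c' * inverse c) * rat_val (bphi i (t ! u')) (inverse c)"
    proof (rule psi_ratio_val[OF phi_step[OF TB_boxes[OF t u(2)] ij x(2)]])
      assume "?q \<noteq> 1"
      then have C: "cartan n i j \<noteq> 0" by auto
      from params_generic[OF t t u ij x C, of s'] c
      show "?q * (c' * inverse c) \<noteq> 1 \<and> c' * inverse c \<noteq> ?q"
        by (auto simp: field_simps)
    qed (use c eps_nz in auto)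
    moreover have "(\<Prod>l\<in>?S - {u'}. rat_val (bphi i (t[u' := v'] ! l)) (inverse c)) = 
        (\<Prod>l\<in>?S - {u'}. rat_val (bphi i (t ! l)) (inverse c))"
      by (intro prod.cong) auto
    ultimately show ?thesis
      using True u len by (simp add: amp_def prod.remove[OF fin True])
  next
    case False
    then have "amp s i u (t[u' := v']) c = amp s i u t c"
      unfolding amp_def length_list_update len
    proof (intro prod.cong[OF refl])
      fix l assume "u' \<notin> ?S" "l \<in> ?S"
      then have "u' \<noteq> l" by blast
      then show "rat_val (bphi i (t[u' := v'] ! l)) (inverse c) = rat_val (bphi i (t ! l)) (inverse c)"
        by simp
    qed
    then show ?thesis using False by simp
  qed
qed

text \<open>The product of two components; the right one acts first.\<close>

definition xx :: "sign \<Rightarrow> nat \<Rightarrow> int \<Rightarrow> nat \<Rightarrow> sign \<Rightarrow> nat \<Rightarrow> int \<Rightarrow> nat \<Rightarrow> box list \<Rightarrow> (box list \<Rightarrow>\<^sub>0 complex)"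
  where "xx s i a u s' j b u' t = lin (xu s i a u) (xu s' j b u' t)"

lemma xx_distinct:
  assumes t: "t \<in> TB" and u: "u < k" "u' < k" "u \<noteq> u'" and ij: "i \<le> n" "j \<le> n"
    and x: "bx s i (t ! u) = Some (c, v)" "bx s' j (t ! u') = Some (c', v')"
  shows "xx s i a u s' j b u' t = Poly_Mapping.single (t[u := v, u' := v'])
    ((if u' \<in> spectators s u k then psi_factor (\<epsilon> powi (sg s' * cartan n i j)) (c' * inverse c) else 1) *
      (amp s i u t c * amp s' j u' t c' * c powi a * c' powi b))"
proof -
  have "bx s i (t[u' := v'] ! u) = Some (c, v)" using x u by simp
  then have "xu s i a u (t[u' := v']) = Poly_Mapping.single (t[u := v, u' := v'])
    ((if u' \<in> spectators s u k then psi_factor (\<epsilon> powi (sg s' * cartan n i j)) (c' * inverse c) else 1) *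
    amp s i u t c * c powi a)"
    using u by (simp add: xu_Some amp_update[OF assms] list_update_swap[of u u'])
  then show ?thesis
    by (simp add: xx_def xu_Some[OF x(2)] mult_ac)
qed

lemma xx_distinct_None:
  assumes "u < length t" "u' < length t" "u \<noteq> u'" "bx s i (t ! u) = None \<or> bx s' j (t ! u') = None"
  shows "xx s i a u s' j b u' t = 0"
  using assms by (auto simp: xx_def xu_def split: option.splits)

lemma spectators_cases:
  assumes "u < m" "u' < m" "u \<noteq> u'"
  shows "u' \<in> spectators s u m \<longleftrightarrow> u \<notin> spectators s u' m"
    "u' \<in> spectators s u m \<longleftrightarrow> u \<in> spectators (opp s) u' m"
  using assms by (cases s; auto)+

lemma psi_factor_eq:
  assumes "c \<noteq> 0" "q \<noteq> 1" 
  shows "psi_factor q (c' * inverse c) = (q * c - c') / (c - q * c')"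
proof -
  have "q - c' * inverse c = (q * c - c') * inverse c" "1 - q * (c' * inverse c) = (c - q * c') * inverse c"
    using assms by (simp_all add: left_diff_distrib mult.assoc)
  then show ?thesis using assms by (simp add: psi_factor_def)
qed

text \<open>The scalar by which components at distinct factors commute.\<close>

definition xgamma :: "sign \<Rightarrow> nat \<Rightarrow> nat \<Rightarrow> complex \<Rightarrow> complex \<Rightarrow> complex"
  where "xgamma s i j c c' = (let q = \<epsilon> powi (sg s * cartan n i j) in
    if q = 1 then 1 else (c' - q * c) / (q * c' - c))"

text \<open>Exactly one of the two factors is a spectator of the other. Whichever it is, the same scalar
  appears, because the two possible ratios are inverse to each other after
  exchanging the points.\<close>

lemma xx_exchange_same:
  assumes t: "t \<in> TB" and u: "u < k" "u' < k" "u \<noteq> u'" and ij: "i \<le> n" "j \<le> n"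
    and x: "bx s i (t ! u) = Some (c, v)" "bx s j (t ! u') = Some (c', v')"
  shows "xx s i a u s j b u' t = cscale (xgamma s i j c c') (xx s j b u' s i a u t)"
proof -
  let ?q = "\<epsilon> powi (sg s * cartan n i j)"
  let ?f = "psi_factor ?q (c' * inverse c)" and ?g = "psi_factor ?q (c * inverse c')"
  let ?A = "amp s i u t c * amp s j u' t c' * c powi a * c' powi b"
  have c: "c \<noteq> 0" "c' \<noteq> 0" using TB_param[OF t u(1) ij(1) x(1)] TB_param[OF t u(2) ij(2) x(2)] by auto
  have L: "xx s i a u s j b u' t = Poly_Mapping.single (t[u := v, u' := v'])
    ((if u' \<in> spectators s u k then ?f else 1) * ?A)"
    by (rule xx_distinct[OF t u ij x])
  have R: "xx s j b u' s i a u t = Poly_Mapping.single (t[u := v, u' := v'])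
    ((if u' \<in> spectators s u k then 1 else ?g) * ?A)"
    using u xx_distinct[OF t u(2,1) _ ij(2,1) x(2,1), of b a] spectators_cases(1)[OF u]
    by (simp add: cartan_sym[of n j i] list_update_swap[of u u'] mult_ac)
  have "(if u' \<in> spectators s u k then ?f else 1) = xgamma s i j c c' * (if u' \<in> spectators s u k then 1 else ?g)"
  proof (cases "?q = 1")
    case True
    then show ?thesis by (simp add: xgamma_def psi_factor_def)
  next
    case False
    then have C: "cartan n i j \<noteq> 0" by auto
    have nz: "c - ?q * c' \<noteq> 0" "c' - ?q * c \<noteq> 0"
      using params_generic[OF t t u ij x C, of s] by auto
    have 1: "?f = (?q * c - c') / (c - ?q * c')" "?g = (?q * c' - c) / (c' - ?q * c)"
      using psi_factor_eq c False by blast+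
    have 2: "xgamma s i j c c' = (c' - ?q * c) / (?q * c' - c)"
      using False by (simp add: xgamma_def Let_def)
    have 3: "?f = xgamma s i j c c'"
      unfolding 1 2 using minus_divide_divide[of "?q * c - c'" "c - ?q * c'"] by simp
    have 4: "xgamma s i j c c' * ?g = 1"
      unfolding 1 2 using nz by (simp add: divide_simps)
    show ?thesis using 3 4 by simp
  qed
  then show ?thesis unfolding L R by (simp add: mult.assoc)
qed

text \<open>For opposite signs each factor is a spectator of the other one or neither is, and the two
  contributions agree.\<close>

lemma xx_exchange_opp:
  assumes t: "t \<in> TB" and u: "u < k" "u' < k" "u \<noteq> u'" and ij: "i \<le> n" "j \<le> n"
  shows "xx s i a u (opp s) j b u' t = xx (opp s) j b u' s i a u t"
proof (cases "bx s i (t ! u) = None \<or> bx (opp s) j (t ! u') = None")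
  case True
  then show ?thesis using xx_distinct_None u TB_length[OF t] by metis
next
  case False
  then obtain c v c' v' where x: "bx s i (t ! u) = Some (c, v)" "bx (opp s) j (t ! u') = Some (c', v')"
    by auto
  let ?q = "\<epsilon> powi (sg (opp s) * cartan n i j)" and ?q' = "\<epsilon> powi (sg s * cartan n i j)"
  have c: "c \<noteq> 0" "c' \<noteq> 0" using TB_param[OF t u(1) ij(1) x(1)] TB_param[OF t u(2) ij(2) x(2)] by auto
  have qq: "?q' = inverse ?q" "?q \<noteq> 0" "?q * ?q' = 1"
    using eps_nz by (simp_all add: power_int_minus)
  have "psi_factor ?q (c' * inverse c) = psi_factor ?q' (c * inverse c')"
  proof (cases "?q = 1")
    case True then show ?thesis using qq by (simp add: psi_factor_def)
  next
    case False
    then have q': "?q' \<noteq> 1" using qq by (metis inverse_eq_1_iff)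
    have "psi_factor ?q' (c * inverse c') = (?q' * c' - c) / (c' - ?q' * c)"
      using psi_factor_eq[OF c(2) q'] .
    also have "\<dots> = (?q * (?q' * c' - c)) / (?q * (c' - ?q' * c))"
      by (rule mult_divide_mult_cancel_left[OF qq(2), symmetric])
    also have "?q * (?q' * c' - c) = - (?q * c - c')"
      unfolding right_diff_distrib mult.assoc[symmetric] qq(3) by simp
    also have "?q * (c' - ?q' * c) = - (c - ?q * c')"
      unfolding right_diff_distrib mult.assoc[symmetric] qq(3) by simp
    also have "- (?q * c - c') / - (c - ?q * c') = psi_factor ?q (c' * inverse c)"
      using psi_factor_eq[OF c(1) False] by (simp only: minus_divide_divide)
    finally show ?thesis by simp
  qed
  then show ?thesis
    using xx_distinct[OF t u ij x, of a b] xx_distinct[OF t u(2,1) _ ij(2,1) x(2,1), of b a] 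
      spectators_cases(2)[OF u, of s] u
    by (simp add: cartan_sym[of n j i] list_update_swap[of u u'] mult_ac)
qed

lemma xx_same:
  assumes "u < length t" "bx s' j (t ! u) = Some (c', v')" "bx s i v' = Some (c, w)"
  shows "xx s i a u s' j b u t = Poly_Mapping.single (t[u := w]) 
    (amp s i u t c * amp s' j u t c' * c powi a * c' powi b)"
  using assms by (simp add: xx_def xu_Some amp_update_self mult_ac)

lemma xx_same_None:
  assumes "u < length t" "\<And>c' v'. bx s' j (t ! u) = Some (c', v') \<Longrightarrow> bx s i v' = None"
  shows "xx s i a u s' j b u t = 0"
  using assms by (auto simp: xx_def xu_def split: option.splits)

lemma xx_same_far:
  assumes t: "t \<in> TB" and u: "u < k" and ij: "i \<le> n" "j \<le> n" "i \<noteq> j" "\<not> adjacent n i j"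
  shows "xx s i a u s' j b u t = xx s' j b u s i a u t"
proof -
  have len: "u < length t" and B: "t ! u \<in> boxes" using u TB_length[OF t] TB_boxes[OF t] by auto
  have one: "xx s i a u s' j b u t = xx s' j b u s i a u t"
    if x: "bx s' j (t ! u) = Some (c', v')" "bx s i v' = Some (c, w)"
      and ij: "i \<le> n" "j \<le> n" "i \<noteq> j" "\<not> adjacent n i j" for s s' i j a b c' v' c w
  proof -
    obtain v where v: "bx s i (t ! u) = Some (c, v)" "bx s' j v = Some (c', w)"
      using box_x_far[OF B ij(2,1) _ _ x] ij adjacent_sym by metis
    show ?thesis
      using xx_same[OF len x, of a b] xx_same[OF len v, of b a] by (simp add: mult_ac)
  qed
  show ?thesis
  proof (cases "\<exists>c' v' c w. bx s' j (t ! u) = Some (c', v') \<and> bx s i v' = Some (c, w)")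
    case True
    then show ?thesis using one ij by blast
  next
    case F1: False
    show ?thesis
    proof (cases "\<exists>c' v' c w. bx s i (t ! u) = Some (c', v') \<and> bx s' j v' = Some (c, w)")
      case True
      then show ?thesis using one[of s i _ _ s' j _ _ b a] ij adjacent_sym by metis
    next
      case False
      have "xx s i a u s' j b u t = 0"
        using F1 by (intro xx_same_None[OF len]) (metis not_None_eq surj_pair)
      moreover have "xx s' j b u s i a u t = 0"
        using False by (intro xx_same_None[OF len]) (metis not_None_eq surj_pair)
      ultimately show ?thesis by simp
    qed
  qed
qed

lemma xx_same_twice:
  assumes "t \<in> TB" "u < k" "i \<le> n"
  shows "xx s i a u s i b u t = 0"
  using assms box_x_twice[OF TB_boxes] TB_length[OF assms(1)] by (intro xx_same_None) auto

lemma xx_same_adjacent_opp: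
  assumes "t \<in> TB" "u < k" "i \<le> n" "j \<le> n" "adjacent n i j"
  shows "xx (opp s) i a u s j b u t = 0"
  using assms box_x_adjacent_opp[OF TB_boxes] TB_length[OF assms(1)] adjacent_sym 
  by (intro xx_same_None) auto

end

section \<open>The relations among the currents\<close>

lemma clear_inverse:
  fixes e :: complex
  assumes "e \<noteq> 0" "g * (inverse e * x - y) = x' - inverse e * y'"
  shows "g * (x - e * y) = e * x' - y'"
proof -
  have "g * (x - e * y) = e * (g * (inverse e * x - y))"
    using assms(1) by (simp add: right_diff_distrib mult.assoc[symmetric])
  also have "\<dots> = e * x' - y'"
    unfolding assms(2) using assms(1) by (simp add: right_diff_distrib mult.assoc[symmetric])
  finally show ?thesis .
qed

text \<open>The Serre relation for three distinct factors: all six products are multiples of one of them, and this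
  is the sum of the six coefficients. The next two lemmas are the degenerate cases in which two of the
  points belong to one factor, where only three products survive.\<close>

lemma serre_identity:
  fixes e :: complex
  assumes e: "e \<noteq> 0" 
    and nz: "e ^ 2 * c2 - c1 \<noteq> 0" "inverse e * c3 - c1 \<noteq> 0" "inverse e * c3 - c2 \<noteq> 0"
    and g: "g12 * (e ^ 2 * c2 - c1) = c2 - e ^ 2 * c1" "g13 * (inverse e * c3 - c1) = c3 - inverse e * c1"
      "g23 * (inverse e * c3 - c2) = c3 - inverse e * c2"
  shows "g23 * g13 * g12 - (e + inverse e) * (g13 * g12) + g12 + (g13 * g23 - (e + inverse e) * g23 + 1) = 0"
proof -
  define f where "f = e + inverse e"
  have F: "e * f = e * e + 1" using e by (simp add: f_def distrib_left)
  define A B C where "A = e * e * c2 - c1" and "B = c3 - e * c1" and "C = c3 - e * c2"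
  have scale: "e * (inverse e * x - y) = x - e * y" for x y
    using e by (simp add: right_diff_distrib mult.assoc[symmetric])
  have g': "g12 * A = c2 - e * e * c1" "g13 * B = e * c3 - c1" "g23 * C = e * c3 - c2"
    using g(1) clear_inverse[OF e g(2)] clear_inverse[OF e g(3)]
    by (simp_all only: A_def B_def C_def power2_eq_square)
  have nz': "A \<noteq> 0" "B \<noteq> 0" "C \<noteq> 0"
    using nz scale[of c3 c1] scale[of c3 c2] e by (auto simp: A_def B_def C_def power2_eq_square)
  have "(g23 * g13 * g12 - f * (g13 * g12) + g12 + (g13 * g23 - f * g23 + 1)) * (e * A * B * C) =
    e * (g23 * C) * (g13 * B) * (g12 * A) - (e * f) * (g13 * B) * (g12 * A) * C + e * (g12 * A) * B * C +
    (e * (g13 * B) * (g23 * C) * A - (e * f) * (g23 * C) * A * B + e * A * B * C)"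
    by (simp only: algebra_simps mult_1_left mult_1_right)
  also have "\<dots> = 0"
    unfolding g' F unfolding A_def B_def C_def by (simp add: algebra_simps)
  finally show ?thesis
    using nz' e by (simp add: f_def)
qed

lemma serre_identity_first:
  fixes e :: complex
  assumes e: "e \<noteq> 0" and nz: "e ^ 2 * c2 - c1 \<noteq> 0" "inverse e * c2 - c3 \<noteq> 0"
    and g: "g12 * (e ^ 2 * c2 - c1) = c2 - e ^ 2 * c1" "g32 * (inverse e * c2 - c3) = c2 - inverse e * c3"
    and c: "c1 = inverse e * c3"
  shows "g12 - (e + inverse e) * (g32 * g12) + 1 = 0"
proof -
  define f where "f = e + inverse e"
  have F: "e * f = e * e + 1" using e by (simp add: f_def distrib_left)
  have c3: "c3 = e * c1" using c e by simp
  define A C where "A = e * e * c2 - c1" and "C = c2 - e * e * c1"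
  have scale: "e * (inverse e * x - y) = x - e * y" for x y
    using e by (simp add: right_diff_distrib mult.assoc[symmetric])
  have g': "g12 * A = c2 - e * e * c1" "g32 * C = e * c2 - e * c1"
    using g(1) clear_inverse[OF e g(2)]
    by (simp_all only: A_def C_def power2_eq_square c3 mult.assoc)
  have nz': "A \<noteq> 0" "C \<noteq> 0"
    using nz scale[of c2 c3] e by (auto simp: A_def C_def power2_eq_square c3)
  have "(g12 - f * (g32 * g12) + 1) * (e * A * C) =
    e * (g12 * A) * C - (e * f) * (g32 * C) * (g12 * A) + e * A * C"
    by (simp only: algebra_simps mult_1_left mult_1_right)
  also have "\<dots> = 0"
    unfolding g' F unfolding A_def C_def by (simp add: algebra_simps)
  finally show ?thesis
    using nz' e by (simp add: f_def)
qed

lemma serre_identity_last: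
  fixes e :: complex
  assumes e: "e \<noteq> 0" and nz: "e ^ 2 * c2 - c1 \<noteq> 0" "inverse e * c2 - c3 \<noteq> 0"
    and g: "g12 * (e ^ 2 * c2 - c1) = c2 - e ^ 2 * c1" "g32 * (inverse e * c2 - c3) = c2 - inverse e * c3"
    and c: "c3 = inverse e * c1"
  shows "g12 * g32 - (e + inverse e) + g32 = 0"
proof -
  define f where "f = e + inverse e"
  have F: "e * f = e * e + 1" using e by (simp add: f_def distrib_left)
  have c1: "c1 = e * c3" using c e by simp
  define A C where "A = e * e * c2 - e * c3" and "C = c2 - e * c3"
  have scale: "e * (inverse e * x - y) = x - e * y" for x y
    using e by (simp add: right_diff_distrib mult.assoc[symmetric])
  have g': "g12 * A = c2 - e * e * e * c3" "g32 * C = e * c2 - c3"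
    using g(1) clear_inverse[OF e g(2)]
    by (simp_all only: A_def C_def power2_eq_square c1 mult.assoc)
  have nz': "A \<noteq> 0" "C \<noteq> 0"
    using nz scale[of c2 c3] e by (auto simp: A_def C_def power2_eq_square c1)
  have "(g12 * g32 - f + g32) * (e * A * C) =
    e * (g12 * A) * (g32 * C) - (e * f) * A * C + e * (g32 * C) * A"
    by (simp only: algebra_simps)
  also have "\<dots> = 0"
    unfolding g' F unfolding A_def C_def by (simp add: algebra_simps)
  finally show ?thesis
    using nz' e by (simp add: f_def)
qed

context tensor_setting
begin

abbreviation DX :: "sign \<Rightarrow> nat \<Rightarrow> int \<Rightarrow> box list \<Rightarrow> (box list \<Rightarrow>\<^sub>0 complex)"
  where "DX \<equiv> drinfeld_x n \<epsilon>"

lemma xu_free: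
  assumes "t \<in> TB" "u < k" "i \<le> n"
  shows "xu s i m u t \<in> free_space TB"
  using TB_update[OF assms] by (auto simp: xu_def free_space_0 intro!: free_space_single split: option.split)

lemma DX_sum: "t \<in> TB \<Longrightarrow> DX s i m t = (\<Sum>u<k. xu s i m u t)"
  by (simp add: drinfeld_x_eq TB_length)

lemma DX_free: "t \<in> TB \<Longrightarrow> i \<le> n \<Longrightarrow> DX s i m t \<in> free_space TB"
  by (auto simp: DX_sum intro!: free_space_sum xu_free)

lemma lin_DX:
  assumes "v \<in> free_space TB"
  shows "lin (DX s i a) v = (\<Sum>u<k. lin (xu s i a u) v)"
proof -
  have "lin (DX s i a) v = lin (\<lambda>t. \<Sum>u<k. xu s i a u t) v"
    unfolding lin_def using assms by (intro sum.cong) (auto simp: DX_sum free_space_def)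
  then show ?thesis by (simp add: lin_fun_sum)
qed

lemma lin_xu_free:
  assumes "v \<in> free_space TB" "u < k" "i \<le> n"
  shows "lin (xu s i a u) v \<in> free_space TB"
  by (rule lin_free_space[OF _ assms(1)]) (rule xu_free[OF _ assms(2,3)])

lemma DX_DX:
  assumes "t \<in> TB" "j \<le> n"
  shows "lin (DX s i a) (DX s' j b t) = (\<Sum>u<k. \<Sum>u'<k. xx s i a u s' j b u' t)"
  using lin_DX[OF DX_free[OF assms]] by (simp add: DX_sum assms lin_sum xx_def)

lemma DX_DX_swap:
  assumes "t \<in> TB" "i \<le> n"
  shows "lin (DX s' j b) (DX s i a t) = (\<Sum>u<k. \<Sum>u'<k. xx s' j b u' s i a u t)"
  using DX_DX[OF assms, of s' j b s a] by (subst sum.swap) simp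

text \<open>Successive moves at adjacent nodes act at points with ratio $q$, so each side of the relation vanishes
  separately.\<close>

lemma xx_same_adjacent:
  assumes t: "t \<in> TB" and u: "u < k" and ij: "i \<le> n" "j \<le> n" "adjacent n i j"
  shows "xx s i (a + 1) u s j b u t = cscale (\<epsilon> powi (sg s * cartan n i j)) (xx s i a u s j (b + 1) u t)"
proof (cases "\<exists>c' v' c w. bx s j (t ! u) = Some (c', v') \<and> bx s i v' = Some (c, w)")
  case True
  then obtain c' v' c w where x: "bx s j (t ! u) = Some (c', v')" "bx s i v' = Some (c, w)" by blast
  have len: "u < length t" and B: "t ! u \<in> boxes" using u TB_length[OF t] TB_boxes[OF t] by auto
  have c: "c = \<epsilon> powi (- sg s) * c'" using box_x_adjacent[OF B ij x(1)] x(2) by auto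
  have "c' \<noteq> 0" using box_x_nz[OF B ij(2) x(1)] .
  then have "c \<noteq> 0" using c eps_nz by simp
  have "i \<noteq> j" using adjacent_neq ij by blast
  then have C: "\<epsilon> powi (sg s * cartan n i j) * c' = c" using ij c by (simp add: cartan_def)
  have pw: "c powi (a + 1) * c' powi b = \<epsilon> powi (sg s * cartan n i j) * (c powi a * c' powi (b + 1))"
    using \<open>c' \<noteq> 0\<close> \<open>c \<noteq> 0\<close> by (simp add: power_int_add_1 mult_ac C[symmetric])
  have "xx s i (a + 1) u s j b u t = Poly_Mapping.single (t[u := w])
      (amp s i u t c * amp s j u t c' * (c powi (a + 1) * c' powi b))"
    using xx_same[OF len x] by (simp only: mult.assoc)
  also have "\<dots> = cscale (\<epsilon> powi (sg s * cartan n i j)) (xx s i a u s j (b + 1) u t)"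
    unfolding pw xx_same[OF len x] cscale_single by (simp only: mult_ac)
  finally show ?thesis .
next
  case False
  then have "xx s i a u s j b u t = 0" for a b
    using u TB_length[OF t] by (intro xx_same_None) (auto, metis not_None_eq surj_pair)
  then show ?thesis by simp
qed

text \<open>The relation $(w - qz)\,x_i(z)x_j(w) = (qw - z)\,x_j(w)x_i(z)$ holds for each choice of the
  two factors.\<close>

lemma xx_relation:
  assumes t: "t \<in> TB" and u: "u < k" "u' < k" and ij: "i \<le> n" "j \<le> n" 
    and q: "q = \<epsilon> powi (sg s * cartan n i j)"
  shows "xx s i (a + 1) u s j b u' t - cscale q (xx s i a u s j (b + 1) u' t)
    - (cscale q (xx s j b u' s i (a + 1) u t) - xx s j (b + 1) u' s i a u t) = 0"
proof (cases "u = u'")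
  case True
  consider "i = j" | "adjacent n i j" | "i \<noteq> j" "\<not> adjacent n i j" by blast
  then show ?thesis
  proof cases
    case 1
    then show ?thesis using xx_same_twice[OF t u(1) ij(1)] True by simp
  next
    case 2
    have q': "q = \<epsilon> powi (sg s * cartan n j i)" using q by (simp add: cartan_sym)
    have "adjacent n j i" using 2 adjacent_sym by blast
    then show ?thesis
      using xx_same_adjacent[OF t u(2) ij 2, of s a b] xx_same_adjacent[OF t u(2) ij(2,1), of s b a] True q q'
      by simp
  next
    case 3
    then have "q = 1" using q by (simp add: cartan_def)
    then show ?thesis
      using xx_same_far[OF t u(2) ij 3] True by simp
  qed
next
  case False
  show ?thesis
  proof (cases "bx s i (t ! u) = None \<or> bx s j (t ! u') = None")
    case True
    have "xx s i a u s j b u' t = 0" "xx s j b u' s i a u t = 0" for a b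
      using xx_distinct_None[of u t u'] xx_distinct_None[of u' t u] u False True TB_length[OF t] by auto
    then show ?thesis by simp
  next
    case some: False
    then obtain c v c' v' where x: "bx s i (t ! u) = Some (c, v)" "bx s j (t ! u') = Some (c', v')"
      by auto
    have c: "c \<noteq> 0" "c' \<noteq> 0" using TB_param[OF t u(1) ij(1) x(1)] TB_param[OF t u(2) ij(2) x(2)] by auto
    define \<gamma> where "\<gamma> = xgamma s i j c c'"
    have g: "\<gamma> * (c - q * c') = q * c - c'"
    proof (cases "q = 1")
      case True then show ?thesis by (simp add: \<gamma>_def xgamma_def q)
    next
      case q1: False
      then have C: "cartan n i j \<noteq> 0" using q by auto
      have "q * c' - c \<noteq> 0" using params_generic[OF t t u False ij x C, of s] q by auto
      moreover have "\<gamma> = (c' - q * c) / (q * c' - c)"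
        using q1 q by (simp add: \<gamma>_def xgamma_def Let_def)
      ultimately have "\<gamma> * (q * c' - c) = c' - q * c" by simp
      then show ?thesis by (simp add: algebra_simps)
    qed
    define K where "K = (if u \<in> spectators s u' k then psi_factor (\<epsilon> powi (sg s * cartan n j i)) (c * inverse c') else 1) *
      (amp s j u' t c' * amp s i u t c)"
    let ?T = "t[u' := v', u := v]"
    have R: "xx s j b u' s i a u t = Poly_Mapping.single ?T (K * (c powi a * c' powi b))" for a b
      using xx_distinct[OF t u(2,1) False[symmetric] ij(2,1) x(2,1), of b a] by (simp add: K_def mult_ac)
    have L: "xx s i a u s j b u' t = Poly_Mapping.single ?T (\<gamma> * (K * (c powi a * c' powi b)))" for a b
      using xx_exchange_same[OF t u False ij x, of a b] by (simp add: R \<gamma>_def)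
    have p: "c powi (a + 1) = c powi a * c" "c' powi (b + 1) = c' powi b * c'"
      using c by (simp_all add: power_int_add_1)
    have "\<gamma> * (K * (c powi (a + 1) * c' powi b)) - q * (\<gamma> * (K * (c powi a * c' powi (b + 1))))
      - (q * (K * (c powi (a + 1) * c' powi b)) - K * (c powi a * c' powi (b + 1))) =
      K * c powi a * c' powi b * (\<gamma> * (c - q * c') - (q * c - c'))"
      unfolding p by (simp only: algebra_simps)
    also have "\<dots> = 0" using g by simp
    finally show ?thesis
      unfolding L R cscale_single single_diff[symmetric] by simp
  qed
qed

lemma relation_x_x:
  assumes t: "t \<in> TB" and ij: "i \<le> n" "j \<le> n" and q: "q = \<epsilon> powi (sg s * cartan n i j)"
  shows "lin (DX s i a) (DX s j (b - 1) t) - cscale q (lin (DX s i (a - 1)) (DX s j b t))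
    - (cscale q (lin (DX s j (b - 1)) (DX s i a t)) - lin (DX s j b) (DX s i (a - 1) t)) = 0"
proof -
  note r = xx_relation[OF t _ _ ij q, of _ _ "a - 1" "b - 1", simplified]
  show ?thesis
    unfolding DX_DX[OF t ij(2)] DX_DX_swap[OF t ij(1)] cscale_sum sum_subtractf[symmetric]
    using r by (intro sum.neutral ballI) simp
qed

lemma relation_far:
  assumes t: "t \<in> TB" and ij: "i \<le> n" "j \<le> n" "i \<noteq> j" "\<not> adjacent n i j"
  shows "lin (DX s i a) (DX s j b t) = lin (DX s j b) (DX s i a t)"
proof -
  have "xx s i a u s j b u' t = xx s j b u' s i a u t" if u: "u < k" "u' < k" for u u'
  proof (cases "u = u'")
    case True
    then show ?thesis using xx_same_far[OF t u(2) ij] by simp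
  next
    case False
    show ?thesis
    proof (cases "bx s i (t ! u) = None \<or> bx s j (t ! u') = None")
      case True
      then show ?thesis
        using xx_distinct_None[of u t u'] xx_distinct_None[of u' t u] u False TB_length[OF t] by auto
    next
      case some: False
      then obtain c v c' v' where x: "bx s i (t ! u) = Some (c, v)" "bx s j (t ! u') = Some (c', v')"
        by auto
      show ?thesis using xx_exchange_same[OF t u False ij(1,2) x, of a b] ij by (simp add: xgamma_def cartan_def)
    qed
  qed
  then show ?thesis
    unfolding DX_DX[OF t ij(2)] DX_DX_swap[OF t ij(1)] by (intro sum.cong refl) simp
qed

lemma relation_opp_neq:
  assumes t: "t \<in> TB" and ij: "i \<le> n" "j \<le> n" "i \<noteq> j"
  shows "lin (DX Pos i a) (DX Neg j b t) = lin (DX Neg j b) (DX Pos i a t)"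
proof -
  have "xx Pos i a u Neg j b u' t = xx Neg j b u' Pos i a u t" if u: "u < k" "u' < k" for u u'
  proof (cases "u = u'")
    case True
    show ?thesis
    proof (cases "adjacent n i j")
      case adj: True
      then show ?thesis
        using xx_same_adjacent_opp[OF t u(1) ij(1,2), of Neg] xx_same_adjacent_opp[OF t u(1) ij(2,1), of Pos] True 
          adjacent_sym[of n i j] by simp
    next
      case False
      then show ?thesis using xx_same_far[OF t u(2) ij] True by simp
    qed
  next
    case False
    then show ?thesis using xx_exchange_opp[OF t u False ij(1,2), of Pos] by simp
  qed
  then show ?thesis
    unfolding DX_DX[OF t ij(2)] DX_DX_swap[OF t ij(1)] by (intro sum.cong refl) simp
qed

text \<open>The product of three components, each given by its node, mode and factor; the last one acts
  first.\<close>

definition xxx :: "sign \<Rightarrow> nat \<times> int \<times> nat \<Rightarrow> nat \<times> int \<times> nat \<Rightarrow> nat \<times> int \<times> nat \<Rightarrow> box list \<Rightarrow> (box list \<Rightarrow>\<^sub>0 complex)"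
  where "xxx s = (\<lambda>(i1, a1, u1) (i2, a2, u2) (i3, a3, u3) t.
    lin (xu s i1 a1 u1) (lin (xu s i2 a2 u2) (xu s i3 a3 u3 t)))"

lemma xxx_swap_inner:
  assumes t: "t \<in> TB" and u: "u2 < k" "u3 < k" "u2 \<noteq> u3" and ij: "i2 \<le> n" "i3 \<le> n"
    and x: "bx s i2 (t ! u2) = Some (c2, v2)" "bx s i3 (t ! u3) = Some (c3, v3)"
  shows "xxx s o1 (i2, a2, u2) (i3, a3, u3) t = cscale (xgamma s i2 i3 c2 c3) (xxx s o1 (i3, a3, u3) (i2, a2, u2) t)"
  using xx_exchange_same[OF t u ij x, of a2 a3]
  by (cases o1) (simp add: xxx_def xx_def lin_cscale)

lemma xxx_first:
  assumes "bx s i3 (t ! u3) = Some (c3, v3)"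
  shows "xxx s (i1, a1, u1) (i2, a2, u2) (i3, a3, u3) t = 
    cscale (amp s i3 u3 t c3 * c3 powi a3) (xx s i1 a1 u1 s i2 a2 u2 (t[u3 := v3]))"
  by (simp add: xxx_def xu_Some[OF assms] xx_def lin_cscale)

lemma xxx_first_None:
  assumes "bx s i3 (t ! u3) = None"
  shows "xxx s o1 o2 (i3, a3, u3) t = 0"
  by (cases o1; cases o2) (simp add: xxx_def xu_None[OF assms])

text \<open>The point of \<open>i1\<close> is that of the box after the first move, which may be on the same factor.\<close>

lemma xxx_swap_outer:
  assumes t: "t \<in> TB" and u: "u1 < k" "u2 < k" "u3 < k" "u1 \<noteq> u2" and ij: "i1 \<le> n" "i2 \<le> n" "i3 \<le> n"
    and x: "bx s i3 (t ! u3) = Some (c3, v3)" "bx s i1 (t[u3 := v3] ! u1) = Some (c1, v1)" 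
      "bx s i2 (t[u3 := v3] ! u2) = Some (c2, v2)"
  shows "xxx s (i1, a1, u1) (i2, a2, u2) (i3, a3, u3) t = 
    cscale (xgamma s i1 i2 c1 c2) (xxx s (i2, a2, u2) (i1, a1, u1) (i3, a3, u3) t)"
  using xx_exchange_same[OF TB_update[OF t u(3) ij(3) x(1)] u(1,2,4) ij(1,2) x(2,3), of a1 a2]
  by (simp add: xxx_first[OF x(1)] mult.commute)

lemma xxx_None:
  assumes "t \<in> TB" "u1 < k" "u2 < k" "u3 < k"
    and "bx s i1 (t ! u1) = None \<and> u1 \<noteq> u2 \<and> u1 \<noteq> u3 \<or> bx s i2 (t ! u2) = None \<and> u2 \<noteq> u3 \<or> bx s i3 (t ! u3) = None"
  shows "xxx s (i1, a1, u1) (i2, a2, u2) (i3, a3, u3) t = 0"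
  using assms TB_length[OF assms(1)] by (auto simp: xxx_def xu_def split: option.splits)

text \<open>If a factor admits no move \<open>i3\<close> followed by a move \<open>i1\<close>, then no product that acts
  so on this factor and by \<open>i2\<close> elsewhere survives.\<close>

lemma xxx_impossible:
  assumes t: "t \<in> TB" and u: "u < k" "u' < k" "u \<noteq> u'"
    and no: "\<And>c v. bx s i3 (t ! u) = Some (c, v) \<Longrightarrow> bx s i1 v = None"
  shows "xxx s (i1, a1, u) (i2, a2, u') (i3, a3, u) t = 0" 
    "xxx s (i1, a1, u) (i3, a3, u) (i2, a2, u') t = 0"
    "xxx s (i2, a2, u') (i1, a1, u) (i3, a3, u) t = 0"
  using u TB_length[OF t] no by (auto simp: xxx_def xu_def split: option.splits)

lemma xgamma_eq:
  assumes "cartan n i j \<noteq> 0"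
  shows "xgamma s i j c c' = (c' - \<epsilon> powi (sg s * cartan n i j) * c) / (\<epsilon> powi (sg s * cartan n i j) * c' - c)"
  using assms eps_powi_cartan_1[of s i j] by (auto simp: xgamma_def Let_def)

definition serre_sum :: "sign \<Rightarrow> nat \<times> int \<times> nat \<Rightarrow> nat \<times> int \<times> nat \<Rightarrow> nat \<times> int \<times> nat \<Rightarrow> box list \<Rightarrow> (box list \<Rightarrow>\<^sub>0 complex)"
  where "serre_sum s o1 o2 o3 t =
    (xxx s o1 o2 o3 t - cscale (\<epsilon> + inverse \<epsilon>) (xxx s o1 o3 o2 t) + xxx s o3 o1 o2 t) +
    (xxx s o2 o1 o3 t - cscale (\<epsilon> + inverse \<epsilon>) (xxx s o2 o3 o1 t) + xxx s o3 o2 o1 t)"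

lemma serre_sum_sym: "serre_sum s o1 o2 o3 t = serre_sum s o2 o1 o3 t"
  by (simp add: serre_sum_def add.commute)

lemma eps_sg_sum: "\<epsilon> + inverse \<epsilon> = \<epsilon> powi (sg s) + inverse (\<epsilon> powi (sg s))"
  by (cases s) (simp_all add: power_int_minus)

lemma serre_distinct:
  assumes t: "t \<in> TB" and u: "u1 < k" "u2 < k" "u3 < k" "u1 \<noteq> u2" "u1 \<noteq> u3" "u2 \<noteq> u3"
    and ij: "i \<le> n" "j \<le> n" "adjacent n i j"
  shows "serre_sum s (i, a, u1) (i, b, u2) (j, c, u3) t = 0"
proof (cases "bx s i (t ! u1) = None \<or> bx s i (t ! u2) = None \<or> bx s j (t ! u3) = None")
  case True
  have "xxx s (i, a, u1) (i, b, u2) (j, c, u3) t = 0" "xxx s (i, a, u1) (j, c, u3) (i, b, u2) t = 0"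
    "xxx s (j, c, u3) (i, a, u1) (i, b, u2) t = 0" "xxx s (i, b, u2) (i, a, u1) (j, c, u3) t = 0"
    "xxx s (i, b, u2) (j, c, u3) (i, a, u1) t = 0" "xxx s (j, c, u3) (i, b, u2) (i, a, u1) t = 0"
    using True u by (auto intro!: xxx_None[OF t])
  then show ?thesis by (simp add: serre_sum_def)
next
  case False
  then obtain c1 v1 c2 v2 c3 v3 where x: "bx s i (t ! u1) = Some (c1, v1)" "bx s i (t ! u2) = Some (c2, v2)"
    "bx s j (t ! u3) = Some (c3, v3)" by auto
  let ?o1 = "(i, a, u1)" and ?o2 = "(i, b, u2)" and ?o3 = "(j, c, u3)"
  define e where "e = \<epsilon> powi (sg s)"
  have e: "e \<noteq> 0" using eps_nz by (simp add: e_def)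
  have "i \<noteq> j" using adjacent_neq ij by blast
  then have Cij: "cartan n i j = - 1" "cartan n i i = 2" using ij by (auto simp: cartan_def)
  have q2: "\<epsilon> powi (sg s * cartan n i i) = e ^ 2"
    unfolding e_def Cij by (cases s) (simp_all add: power_int_minus power_inverse)
  have q1: "\<epsilon> powi (sg s * cartan n i j) = inverse e"
    unfolding e_def Cij by (simp add: power_int_minus)
  have xg: "xgamma s i i x y = (y - e ^ 2 * x) / (e ^ 2 * y - x)"
    "xgamma s i j x y = (y - inverse e * x) / (inverse e * y - x)" for x y
    by (subst xgamma_eq, simp add: Cij, simp only: q1 q2)+
  have nz: "e ^ 2 * c2 - c1 \<noteq> 0" "inverse e * c3 - c1 \<noteq> 0" "inverse e * c3 - c2 \<noteq> 0"
    using params_generic(1)[OF t t u(1,2,4) ij(1,1) x(1,2), of s] Cij q1 q2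
      params_generic(1)[OF t t u(1,3,5) ij(1,2) x(1,3), of s]
      params_generic(1)[OF t t u(2,3,6) ij(1,2) x(2,3), of s] by auto
  define g12 where "g12 = xgamma s i i c1 c2"
  define g13 where "g13 = xgamma s i j c1 c3"
  define g23 where "g23 = xgamma s i j c2 c3"
  have g: "g12 * (e ^ 2 * c2 - c1) = c2 - e ^ 2 * c1" "g13 * (inverse e * c3 - c1) = c3 - inverse e * c1"
    "g23 * (inverse e * c3 - c2) = c3 - inverse e * c2"
    unfolding g12_def g13_def g23_def
    using nz by (simp_all add: xg)
  \<comment> \<open>All six products are reduced to the one in which the third component acts last.\<close>
  have w312: "xxx s ?o3 ?o1 ?o2 t = cscale g12 (xxx s ?o3 ?o2 ?o1 t)"
    unfolding g12_def by (rule xxx_swap_inner[OF t u(1,2,4) ij(1,1) x(1,2)])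
  have w132: "xxx s ?o1 ?o3 ?o2 t = cscale g13 (xxx s ?o3 ?o1 ?o2 t)"
    unfolding g13_def using u x
    by (intro xxx_swap_outer[OF t u(1,3,2,5) ij(1,2,1) x(2)]) auto
  have w123: "xxx s ?o1 ?o2 ?o3 t = cscale g23 (xxx s ?o1 ?o3 ?o2 t)"
    unfolding g23_def by (rule xxx_swap_inner[OF t u(2,3,6) ij(1,2) x(2,3)])
  have w231: "xxx s ?o2 ?o3 ?o1 t = cscale g23 (xxx s ?o3 ?o2 ?o1 t)"
    unfolding g23_def using u x
    by (intro xxx_swap_outer[OF t u(2,3,1,6) ij(1,2,1) x(1)]) auto
  have w213: "xxx s ?o2 ?o1 ?o3 t = cscale g13 (xxx s ?o2 ?o3 ?o1 t)"
    unfolding g13_def by (rule xxx_swap_inner[OF t u(1,3,5) ij(1,2) x(1,3)])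
  have id: "g23 * g13 * g12 - (e + inverse e) * (g13 * g12) + g12 + (g13 * g23 - (e + inverse e) * g23 + 1) = 0"
    by (rule serre_identity[OF e nz g])
  have "serre_sum s ?o1 ?o2 ?o3 t = cscale (g23 * g13 * g12 - (e + inverse e) * (g13 * g12) + g12 + 
      (g13 * g23 - (e + inverse e) * g23 + 1)) (xxx s ?o3 ?o2 ?o1 t)"
    unfolding serre_sum_def w123 w132 w213 w312 w231 eps_sg_sum[of s] e_def[symmetric] cscale_cscale
    by (simp only: cscale_add cscale_diff cscale_1 mult.assoc)
  then show ?thesis unfolding id by simp
qed

text \<open>On the common factor only one of the two orders of moves is possible; this decides which three of
  the six products survive.\<close>

lemma serre_shared:
  assumes t: "t \<in> TB" and u: "u < k" "u' < k" "u \<noteq> u'" and ij: "i \<le> n" "j \<le> n" "adjacent n i j"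
  shows "serre_sum s (i, a, u) (i, b, u') (j, c, u) t = 0"
proof (cases "bx s i (t ! u')")
  case None
  let ?o1 = "(i, a, u)" and ?o2 = "(i, b, u')" and ?o3 = "(j, c, u)"
  have "xxx s ?o1 ?o2 ?o3 t = 0" "xxx s ?o1 ?o3 ?o2 t = 0" "xxx s ?o3 ?o1 ?o2 t = 0" "xxx s ?o2 ?o1 ?o3 t = 0"
    "xxx s ?o2 ?o3 ?o1 t = 0" "xxx s ?o3 ?o2 ?o1 t = 0"
    using None u by (auto intro!: xxx_None[OF t])
  then show ?thesis by (simp add: serre_sum_def)
next
  case (Some cv2)
  then obtain c2 v2 where x2: "bx s i (t ! u') = Some (c2, v2)" by (cases cv2) auto
  let ?o1 = "(i, a, u)" and ?o2 = "(i, b, u')" and ?o3 = "(j, c, u)"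
  have B: "t ! u \<in> boxes" using TB_boxes[OF t u(1)] .
  have len: "length t = k" using TB_length[OF t] .
  define e where "e = \<epsilon> powi (sg s)"
  have e: "e \<noteq> 0" using eps_nz by (simp add: e_def)
  have ij': "adjacent n j i" using ij adjacent_sym by blast
  have "i \<noteq> j" using adjacent_neq ij by blast
  then have Cij: "cartan n i j = - 1" "cartan n j i = - 1" "cartan n i i = 2" 
    using ij ij' by (auto simp: cartan_def)
  have q2: "\<epsilon> powi (sg s * cartan n i i) = e ^ 2"
    unfolding e_def Cij by (cases s) (simp_all add: power_int_minus power_inverse)
  have q1: "\<epsilon> powi (sg s * cartan n j i) = inverse e"
    unfolding e_def Cij by (simp add: power_int_minus)
  have xg: "xgamma s i i x y = (y - e ^ 2 * x) / (e ^ 2 * y - x)"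
    "xgamma s j i x y = (y - inverse e * x) / (inverse e * y - x)" for x y
    by (subst xgamma_eq, simp add: Cij, simp only: q1 q2)+
  have first: "bx s i' (t ! u) = None" if "bx s j' (t ! u) = Some (d, v)" "bx s i' v = Some (d', w)"
    "i' \<le> n" "j' \<le> n" "adjacent n j' i'" for i' j' d v d' w
    using box_x_adjacent_opp[OF box_x_boxes[OF that(1) B that(4)] that(4,3,5) box_x_inverse[OF B that(4,1)]]
    by simp
  have ratio: "d' = inverse e * d" if "bx s j' (t ! u) = Some (d, v)" "bx s i' v = Some (d', w)"
    "i' \<le> n" "j' \<le> n" "adjacent n i' j'" for i' j' d v d' w
    using box_x_adjacent[OF B that(3,4,5,1)] that(2) by (auto simp: e_def power_int_minus)
  show ?thesis
  proof (cases "\<exists>c3 v c1 w. bx s j (t ! u) = Some (c3, v) \<and> bx s i v = Some (c1, w)")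
    case True
    then obtain c3 v c1 w where x: "bx s j (t ! u) = Some (c3, v)" "bx s i v = Some (c1, w)" by blast
    have None: "bx s i (t ! u) = None" using first[OF x ij(1,2) ij'] .
    have c: "c1 = inverse e * c3" using ratio[OF x ij] .
    have 0: "xxx s ?o2 ?o3 ?o1 t = 0" "xxx s ?o3 ?o2 ?o1 t = 0" "xxx s ?o3 ?o1 ?o2 t = 0"
      using None u by (auto intro!: xxx_None[OF t])
    define g12 where "g12 = xgamma s i i c1 c2"
    define g32 where "g32 = xgamma s j i c3 c2"
    have t3: "t[u := v] \<in> TB" using TB_update[OF t u(1) ij(2) x(1)] .
    have x1': "bx s i (t[u := v] ! u) = Some (c1, w)" using x u len by simp
    have x2': "bx s i (t[u := v] ! u') = Some (c2, v2)" using x2 u by simp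
    have nz: "e ^ 2 * c2 - c1 \<noteq> 0" "inverse e * c2 - c3 \<noteq> 0"
      using params_generic(1)[OF t3 t3 u ij(1,1) x1' x2', of s] Cij q1 q2
        params_generic(1)[OF t t u ij(2,1) x(1) x2, of s] by auto
    have g: "g12 * (e ^ 2 * c2 - c1) = c2 - e ^ 2 * c1" "g32 * (inverse e * c2 - c3) = c2 - inverse e * c3"
      unfolding g12_def g32_def using nz by (simp_all add: xg)
    have w123: "xxx s ?o1 ?o2 ?o3 t = cscale g12 (xxx s ?o2 ?o1 ?o3 t)"
      unfolding g12_def by (rule xxx_swap_outer[OF t u(1,2,1,3) ij(1,1,2) x(1) x1' x2'])
    have w132: "xxx s ?o1 ?o3 ?o2 t = cscale g32 (xxx s ?o1 ?o2 ?o3 t)"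
      unfolding g32_def by (rule xxx_swap_inner[OF t u ij(2,1) x(1) x2])
    have id: "g12 - (e + inverse e) * (g32 * g12) + 1 = 0"
      by (rule serre_identity_first[OF e nz g c])
    have "serre_sum s ?o1 ?o2 ?o3 t = cscale (g12 - (e + inverse e) * (g32 * g12) + 1) (xxx s ?o2 ?o1 ?o3 t)"
      unfolding serre_sum_def w132 w123 0 eps_sg_sum[of s] e_def[symmetric] cscale_cscale
      by (simp add: cscale_add cscale_diff mult.assoc)
    then show ?thesis unfolding id by simp
  next
    case no31: False
    have z: "xxx s ?o1 ?o2 ?o3 t = 0" "xxx s ?o1 ?o3 ?o2 t = 0" "xxx s ?o2 ?o1 ?o3 t = 0"
    proof -
      have no: "bx s i v = None" if "bx s j (t ! u) = Some (c3, v)" for c3 v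
        using no31 that by (cases "bx s i v") auto
      show "xxx s ?o1 ?o2 ?o3 t = 0" "xxx s ?o1 ?o3 ?o2 t = 0" "xxx s ?o2 ?o1 ?o3 t = 0"
        by (rule xxx_impossible[OF t u no], assumption)+
    qed
    show ?thesis
    proof (cases "\<exists>c1 v c3 w. bx s i (t ! u) = Some (c1, v) \<and> bx s j v = Some (c3, w)")
      case True
      then obtain c1 v c3 w where x: "bx s i (t ! u) = Some (c1, v)" "bx s j v = Some (c3, w)" by blast
      have c: "c3 = inverse e * c1" using ratio[OF x ij(2,1) ij'] .
      define g12 where "g12 = xgamma s i i c1 c2"
      define g32 where "g32 = xgamma s j i c3 c2"
      have t1: "t[u := v] \<in> TB" using TB_update[OF t u(1) ij(1) x(1)] .
      have x3': "bx s j (t[u := v] ! u) = Some (c3, w)" using x u len by simp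
      have x2': "bx s i (t[u := v] ! u') = Some (c2, v2)" using x2 u by simp
      have nz: "e ^ 2 * c2 - c1 \<noteq> 0" "inverse e * c2 - c3 \<noteq> 0"
        using params_generic(1)[OF t t u ij(1,1) x(1) x2, of s] Cij q1 q2
          params_generic(1)[OF t1 t1 u ij(2,1) x3' x2', of s] by auto
      have g: "g12 * (e ^ 2 * c2 - c1) = c2 - e ^ 2 * c1" "g32 * (inverse e * c2 - c3) = c2 - inverse e * c3"
        unfolding g12_def g32_def using nz by (simp_all add: xg)
      have w321: "xxx s ?o3 ?o2 ?o1 t = cscale g32 (xxx s ?o2 ?o3 ?o1 t)"
        unfolding g32_def by (rule xxx_swap_outer[OF t u(1,2,1,3) ij(2,1,1) x(1) x3' x2'])
      have w312: "xxx s ?o3 ?o1 ?o2 t = cscale g12 (xxx s ?o3 ?o2 ?o1 t)"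
        unfolding g12_def by (rule xxx_swap_inner[OF t u ij(1,1) x(1) x2])
      have id: "g12 * g32 - (e + inverse e) + g32 = 0"
        by (rule serre_identity_last[OF e nz g c])
      have "serre_sum s ?o1 ?o2 ?o3 t = cscale (g12 * g32 - (e + inverse e) + g32) (xxx s ?o2 ?o3 ?o1 t)"
        unfolding serre_sum_def w312 w321 z eps_sg_sum[of s] e_def[symmetric] cscale_cscale
        by (simp add: cscale_add cscale_diff)
      then show ?thesis unfolding id by simp
    next
      case no13: False
      have "xxx s ?o3 ?o2 ?o1 t = 0" "xxx s ?o3 ?o1 ?o2 t = 0" "xxx s ?o2 ?o3 ?o1 t = 0"
      proof -
        have no: "bx s j v = None" if "bx s i (t ! u) = Some (c1, v)" for c1 v
          using no13 that by (cases "bx s j v") auto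
        show "xxx s ?o3 ?o2 ?o1 t = 0" "xxx s ?o3 ?o1 ?o2 t = 0" "xxx s ?o2 ?o3 ?o1 t = 0"
          by (rule xxx_impossible[OF t u no], assumption)+
      qed
      with z show ?thesis by (simp add: serre_sum_def)
    qed
  qed
qed

text \<open>Two moves of one sign at one node cannot both be made on one factor, even with a move at
  an adjacent node in between.\<close>

lemma serre_coincident:
  assumes t: "t \<in> TB" and u: "u < k" "u3 < k" and ij: "i \<le> n" "j \<le> n" "adjacent n i j"
  shows "serre_sum s (i, a, u) (i, b, u) (j, c, u3) t = 0"
proof -
  have B: "t ! u \<in> boxes" using TB_boxes[OF t u(1)] .
  have len: "length t = k" using TB_length[OF t] .
  have twice: "bx s i v = None" if "bx s i (t ! u) = Some (d, v)" for d v
    using box_x_twice[OF B ij(1) that] .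
  have A: "xxx s o3 (i, a, u) (i, b, u) t = 0" for o3 a b
    using xx_same_twice[OF t u(1) ij(1), of s a b] by (cases o3) (simp add: xxx_def xx_def)
  have A2: "xxx s (i, a, u) (i, b, u) (j, c, u3) t = 0" for a b
  proof (cases "bx s j (t ! u3)")
    case (Some cv)
    then obtain d v where x: "bx s j (t ! u3) = Some (d, v)" by (cases cv) auto
    show ?thesis
      using xx_same_twice[OF TB_update[OF t u(2) ij(2) x] u(1) ij(1)] by (simp add: xxx_first[OF x])
  qed (simp add: xxx_first_None)
  have A3: "xxx s (i, a, u) (j, c, u3) (i, b, u) t = 0" for a b
  proof (cases "bx s i (t ! u)")
    case (Some cv)
    then obtain d v where x: "bx s i (t ! u) = Some (d, v)" by (cases cv) auto
    have "xx s i a u s j c u3 (t[u := v]) = 0"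
    proof (cases "u = u3")
      case True
      have vb: "v \<in> boxes" using box_x_boxes[OF x B ij(1)] .
      have no: "bx s i w = None" if "bx s j v = Some (d', w)" for d' w
        using box_x_adjacent[OF vb ij that] box_x_inverse[OF B ij(1) x] by auto
      show ?thesis
        unfolding True[symmetric] by (rule xx_same_None) (use u len no in auto)
    next
      case False
      then show ?thesis
        using u len twice[OF x] by (intro xx_distinct_None) auto
    qed
    then show ?thesis by (simp add: xxx_first[OF x])
  qed (simp add: xxx_first_None)
  show ?thesis by (simp add: serre_sum_def A A2 A3)
qed

lemma serre_local:
  assumes t: "t \<in> TB" and u: "u1 < k" "u2 < k" "u3 < k" and ij: "i \<le> n" "j \<le> n" "adjacent n i j"
  shows "serre_sum s (i, a, u1) (i, b, u2) (j, c, u3) t = 0"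
proof -
  consider "u1 = u2" | "u1 \<noteq> u2" "u3 = u1" | "u1 \<noteq> u2" "u3 = u2" | "u1 \<noteq> u2" "u1 \<noteq> u3" "u2 \<noteq> u3" by blast
  then show ?thesis
  proof cases
    case 1 then show ?thesis using serre_coincident[OF t u(2,3) ij] by simp
  next
    case 2 then show ?thesis using serre_shared[OF t u(1,2) _ ij] by simp
  next
    case 3 then show ?thesis using serre_shared[OF t u(2,1) _ ij, of s b a c] serre_sum_sym by metis
  next
    case 4 then show ?thesis using serre_distinct[OF t u _ _ _ ij] by simp
  qed
qed

lemma DX_DX_DX:
  assumes "t \<in> TB" "i1 \<le> n" "i2 \<le> n" "i3 \<le> n"
  shows "lin (DX s i1 a1) (lin (DX s i2 a2) (DX s i3 a3 t)) =
    (\<Sum>u1<k. \<Sum>u2<k. \<Sum>u3<k. xxx s (i1, a1, u1) (i2, a2, u2) (i3, a3, u3) t)"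
proof -
  have "lin (DX s i2 a2) (DX s i3 a3 t) = (\<Sum>u2<k. \<Sum>u3<k. lin (xu s i2 a2 u2) (xu s i3 a3 u3 t))"
    using DX_DX[OF assms(1,4)] by (simp add: xx_def)
  moreover have "lin (xu s i2 a2 u2) (xu s i3 a3 u3 t) \<in> free_space TB" if "u2 < k" "u3 < k" for u2 u3
    using that assms by (intro lin_xu_free xu_free)
  ultimately show ?thesis
    by (subst lin_DX) (auto simp: lin_sum xxx_def intro!: free_space_sum)
qed

lemma relation_serre:
  assumes t: "t \<in> TB" and ij: "i \<le> n" "j \<le> n" "adjacent n i j"
  shows "(lin (DX s i a) (lin (DX s i b) (DX s j c t)) 
      - cscale (\<epsilon> + inverse \<epsilon>) (lin (DX s i a) (lin (DX s j c) (DX s i b t)))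
      + lin (DX s j c) (lin (DX s i a) (DX s i b t)))
    + (lin (DX s i b) (lin (DX s i a) (DX s j c t)) 
      - cscale (\<epsilon> + inverse \<epsilon>) (lin (DX s i b) (lin (DX s j c) (DX s i a t)))
      + lin (DX s j c) (lin (DX s i b) (DX s i a t))) = 0"
proof -
  let ?S = "\<lambda>f. \<Sum>u1<k. \<Sum>u2<k. \<Sum>u3<k. f (i, a, u1) (i, b, u2) (j, c, u3)"
  note D = DX_DX_DX[OF t]
  have swap: "(\<Sum>u1<k. \<Sum>u2<k. \<Sum>u3<k. h u1 u2 u3) = (\<Sum>u2<k. \<Sum>u1<k. \<Sum>u3<k. h u1 u2 u3)"
    "(\<Sum>u1<k. \<Sum>u2<k. \<Sum>u3<k. h u1 u2 u3) = (\<Sum>u1<k. \<Sum>u3<k. \<Sum>u2<k. h u1 u2 u3)"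
    for h :: "nat \<Rightarrow> nat \<Rightarrow> nat \<Rightarrow> box list \<Rightarrow>\<^sub>0 complex"
    by (rule sum.swap, rule sum.cong[OF refl], rule sum.swap)
  have 1: "lin (DX s i a) (lin (DX s i b) (DX s j c t)) = ?S (\<lambda>o1 o2 o3. xxx s o1 o2 o3 t)"
    using D ij by simp
  have 2: "lin (DX s i a) (lin (DX s j c) (DX s i b t)) = ?S (\<lambda>o1 o2 o3. xxx s o1 o3 o2 t)"
    unfolding D[OF ij(1,2,1)] by (rule swap(2))
  have 3: "lin (DX s j c) (lin (DX s i a) (DX s i b t)) = ?S (\<lambda>o1 o2 o3. xxx s o3 o1 o2 t)"
    unfolding D[OF ij(2,1,1)] by (rule trans[OF swap(1) swap(2)])
  have 4: "lin (DX s i b) (lin (DX s i a) (DX s j c t)) = ?S (\<lambda>o1 o2 o3. xxx s o2 o1 o3 t)"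
    unfolding D[OF ij(1,1,2)] by (rule swap(1))
  have 5: "lin (DX s i b) (lin (DX s j c) (DX s i a t)) = ?S (\<lambda>o1 o2 o3. xxx s o2 o3 o1 t)"
    unfolding D[OF ij(1,2,1)] by (rule trans[OF swap(2) swap(1)])
  have 6: "lin (DX s j c) (lin (DX s i b) (DX s i a t)) = ?S (\<lambda>o1 o2 o3. xxx s o3 o2 o1 t)"
    unfolding D[OF ij(2,1,1)] by (rule trans[OF swap(1) trans[OF swap(2) swap(1)]])
  have "?S (\<lambda>o1 o2 o3. serre_sum s o1 o2 o3 t) = 0"
    using serre_local[OF t _ _ _ ij] by (intro sum.neutral ballI) auto
  then show ?thesis
    unfolding 1 2 3 4 5 6 serre_sum_def by (simp only: sum.distrib sum_subtractf cscale_sum)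
qed

end

section \<open>Relations with the Cartan part\<close>

lemma laurent_coeff_partial_fractions:
  assumes "\<And>l. l \<in> S \<Longrightarrow> c l \<noteq> 0"
  shows "laurent_coeff Pos (fps_const G + (\<Sum>l\<in>S. fps_const (R l) * geom Pos (c l))) m -
    laurent_coeff Neg (fps_const G + (\<Sum>l\<in>S. fps_const (R l) * geom Neg (c l))) m = (\<Sum>l\<in>S. R l * c l powi m)"
proof -
  have nth: "fps_nth (\<Sum>l\<in>S. fps_const (R l) * geom s (c l)) p = 
    (\<Sum>l\<in>S. R l * fps_nth (geom s (c l)) p)" for s p
    by (simp add: fps_sum_nth)
  consider "m > 0" | "m = 0" | "m < 0" by linarith
  then show ?thesis
  proof cases
    case 1
    then have "c l powi m = c l ^ nat m" for l by (simp add: power_int_def)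
    then show ?thesis using 1 by (simp add: laurent_coeff_def nth) (simp add: geom_def)
  next
    case 2
    then show ?thesis by (simp add: laurent_coeff_def nth) (simp add: geom_def)
  next
    case 3
    then have "c l powi m = inverse (c l) ^ nat (- m)" for l by (simp add: power_int_def)
    then show ?thesis using 3 by (simp add: laurent_coeff_def nth sum_negf) (simp add: geom_def sum_negf)
  qed
qed

lemma single_sum: "Poly_Mapping.single t (\<Sum>u\<in>A. f u) = (\<Sum>u\<in>A. Poly_Mapping.single t (f u))"
  by (induction A rule: infinite_finite_induct) (auto simp: single_add)

context tensor_setting
begin

text \<open>The eigenvalues of $\phi_i^\pm(z)$ on a tensor product of basis vectors.\<close>

definition phi_series :: "sign \<Rightarrow> nat \<Rightarrow> box list \<Rightarrow> complex fps"
  where "phi_series s i t = (\<Prod>l<length t. expansion s (bphi i (t ! l)))"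

lemma drinfeld_phi_eq: "drinfeld_phi n \<epsilon> s i m t = fps_nth (phi_series s i t) m"
  by (simp add: drinfeld_phi_def phi_series_def)

lemma phi_series_update:
  assumes t: "t \<in> TB" and u: "u < k" and ij: "i \<le> n" "j \<le> n" and x: "bx s j (t ! u) = Some (c, v)"
    and q: "q = \<epsilon> powi (sg s * cartan n i j)"
  shows "sg_poly s' 1 (q * c) * phi_series s' i (t[u := v]) = sg_poly s' q c * phi_series s' i t"
proof -
  have len: "length t = k" using TB_length[OF t] .
  let ?P = "\<Prod>l\<in>{..<k} - {u}. expansion s' (bphi i (t ! l))"
  have 1: "phi_series s' i t = expansion s' (bphi i (t ! u)) * ?P"
    unfolding phi_series_def len using u by (intro prod.remove) auto
  have "phi_series s' i (t[u := v]) = expansion s' (bphi i (t[u := v] ! u)) * 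
      (\<Prod>l\<in>{..<k} - {u}. expansion s' (bphi i (t[u := v] ! l)))"
    unfolding phi_series_def length_list_update len using u by (intro prod.remove) auto
  also have "(\<Prod>l\<in>{..<k} - {u}. expansion s' (bphi i (t[u := v] ! l))) = ?P"
    by (intro prod.cong) auto
  finally have 2: "phi_series s' i (t[u := v]) = expansion s' (bphi i v) * ?P"
    using u len by simp
  have "q \<noteq> 0" "c \<noteq> 0" using q eps_nz TB_param[OF t u ij(2) x] by auto
  then have "sg_poly s' 1 (q * c) * expansion s' (bphi i v) = sg_poly s' q c * expansion s' (bphi i (t ! u))"
    using psi_ratio_expansion[OF phi_step[OF TB_boxes[OF t u] ij x]] q by blast
  then show ?thesis unfolding 1 2 by (simp only: mult.assoc[symmetric])
qed

lemma phi_series_0: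
  assumes "t \<in> TB" "i \<le> n"
  shows "fps_nth (phi_series s i t) 0 = drinfeld_k n \<tau> (Poly_Mapping.single i (of_int (sg s))) t"
    "fps_nth (phi_series s i t) 0 \<noteq> 0"
proof -
  have len: "length t = k" using TB_length[OF assms(1)] .
  have "fps_nth (\<Prod>l\<in>A. f l) 0 = (\<Prod>l\<in>A. fps_nth (f l) 0)" for A and f :: "nat \<Rightarrow> complex fps"
    by (induction A rule: infinite_finite_induct) auto
  then have 1: "fps_nth (phi_series s i t) 0 = (\<Prod>l<k. \<epsilon> powi (sg s * box_weight (t ! l) i))"
    unfolding phi_series_def len using expansion_box_phi_0[OF TB_boxes[OF assms(1)] assms(2)]
    by (simp add: cong: prod.cong_simp)
  then show "fps_nth (phi_series s i t) 0 = drinfeld_k n \<tau> (Poly_Mapping.single i (of_int (sg s))) t"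
    unfolding drinfeld_k_def len using box_k_single[OF TB_boxes[OF assms(1)] assms(2)]
    by (simp cong: prod.cong_simp)
  show "fps_nth (phi_series s i t) 0 \<noteq> 0"
    unfolding 1 using eps_nz by simp
qed

lemma drinfeld_k_update:
  assumes t: "t \<in> TB" and u: "u < k" and j: "j \<le> n" and x: "bx s j (t ! u) = Some (c, v)"
  shows "drinfeld_k n \<tau> h (t[u := v]) = eps_pow \<tau> (of_int (sg s) * alpha n j h) * drinfeld_k n \<tau> h t"
proof -
  have len: "length t = k" using TB_length[OF t] .
  let ?P = "\<Prod>l\<in>{..<k} - {u}. box_k n \<tau> h (t ! l)"
  have 1: "drinfeld_k n \<tau> h t = box_k n \<tau> h (t ! u) * ?P"
    unfolding drinfeld_k_def len using u by (intro prod.remove) auto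
  have "drinfeld_k n \<tau> h (t[u := v]) = box_k n \<tau> h (t[u := v] ! u) * 
      (\<Prod>l\<in>{..<k} - {u}. box_k n \<tau> h (t[u := v] ! l))"
    unfolding drinfeld_k_def length_list_update len using u by (intro prod.remove) auto
  also have "(\<Prod>l\<in>{..<k} - {u}. box_k n \<tau> h (t[u := v] ! l)) = ?P"
    by (intro prod.cong) auto
  finally have 2: "drinfeld_k n \<tau> h (t[u := v]) = box_k n \<tau> h v * ?P"
    using u len by simp
  show ?thesis unfolding 1 2 box_k_step[OF TB_boxes[OF t u] j x] by simp
qed

lemma box_k_add:
  assumes "B \<in> boxes"
  shows "box_k n \<tau> (h + h') B = box_k n \<tau> h B * box_k n \<tau> h' B"
  by (simp add: box_k_eq[OF assms] lookup_add distrib_right sum.distrib eps_pow_add)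

lemma drinfeld_k_add:
  assumes "t \<in> TB"
  shows "drinfeld_k n \<tau> (h + h') t = drinfeld_k n \<tau> h t * drinfeld_k n \<tau> h' t"
  using box_k_add[OF TB_boxes[OF assms]] TB_length[OF assms]
  by (simp add: drinfeld_k_def prod.distrib cong: prod.cong_simp)

lemma drinfeld_k_0: 
  assumes "t \<in> TB"
  shows "drinfeld_k n \<tau> 0 t = 1"
  using box_k_eq[OF TB_boxes[OF assms], of _ 0] TB_length[OF assms]
  by (simp add: drinfeld_k_def eps_pow_0 cong: prod.cong_simp)

text \<open>Components at distinct factors commute. On one factor, moving there and back contributes the value
  of the eigenvalues of the other factors at the pole, with the sign of the extremum; this is the
  residue of the eigenvalue of $\phi_i$ up to $\epsilon - \epsilon^{-1}$.\<close>

lemma relation_opp_eq: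
  assumes t: "t \<in> TB" and i: "i \<le> n"
  shows "lin (DX Pos i a) (DX Neg i b t) - lin (DX Neg i b) (DX Pos i a t) =
    Poly_Mapping.single t ((laurent_coeff Pos (phi_series Pos i t) (a + b) - laurent_coeff Neg (phi_series Neg i t) (a + b)) /
      (\<epsilon> - inverse \<epsilon>))"
proof -
  have len: "length t = k" using TB_length[OF t] .
  define S where "S = {u \<in> {..<k}. \<exists>s c v. bx s i (t ! u) = Some (c, v)}"
  have "\<forall>u\<in>S. \<exists>sc. \<exists>v. bx (fst sc) i (t ! u) = Some (snd sc, v)" by (auto simp: S_def)
  from bchoice[OF this] obtain sc where sc: "\<forall>u\<in>S. \<exists>v. bx (fst (sc u)) i (t ! u) = Some (snd (sc u), v)" ..
  define e c where "e = (\<lambda>u. pw (fst (sc u)))" and "c = (\<lambda>u. snd (sc u))"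
  have S: "finite S" "S \<subseteq> {..<k}" by (auto simp: S_def)
  have phS: "bphi i (t ! l) = psi_at (e l) (c l)" "cls (as ! l) i (c l)" "c l \<noteq> 0" if lS: "l \<in> S" for l
  proof -
    obtain v where x: "bx (fst (sc l)) i (t ! l) = Some (c l, v)"
      using bspec[OF sc lS] unfolding c_def by (elim exE)
    have l: "l < k" using S lS by auto
    show "bphi i (t ! l) = psi_at (e l) (c l)" "cls (as ! l) i (c l)" "c l \<noteq> 0"
      using box_phi_Some[OF TB_boxes[OF t l] i x] TB_param[OF t l i x] by (simp_all add: e_def)
  qed
  have phN: "bphi i (t ! l) = 1" "bx s i (t ! l) = None" if "l < k" "l \<notin> S" for l s
  proof -
    have N: "bx s i (t ! l) = None" for s using that by (cases "bx s i (t ! l)") (auto simp: S_def)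
    show "bx s i (t ! l) = None" "bphi i (t ! l) = 1"
      using N box_phi_None[OF TB_boxes[OF t that(1)] i, of Pos] by simp_all
  qed
  have neq: "c l \<noteq> c u" if "l \<in> S" "u \<in> S" "l \<noteq> u" for l u
    using generic_cls[OF as_generic phS(2) phS(2), of l u 0] that S by auto
  have inj: "inj_on c S" using neq by (auto simp: inj_on_def)
  have e: "e l \<noteq> 0" "e l ^ 2 \<noteq> 1" for l by (simp_all add: e_def pw_nz pw_sq)
  let ?R = "psi_residue e c S"
  have series: "phi_series s i t = fps_const (\<Prod>l\<in>S. inverse (e l)) + (\<Sum>l\<in>S. fps_const (?R l) * geom s (c l))" for s
  proof -
    have "phi_series s i t = (\<Prod>l\<in>S. expansion s (bphi i (t ! l)))"
      unfolding phi_series_def len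
    proof (intro prod.mono_neutral_right ballI)
      fix l assume "l \<in> {..<k} - S"
      then have "bphi i (t ! l) = 1" using phN(1) by blast
      then show "expansion s (bphi i (t ! l)) = 1" by simp
    qed (use S in auto)
    also have "\<dots> = (\<Prod>l\<in>S. expansion s (psi_at (e l) (c l)))"
      using phS(1) by (intro prod.cong) auto
    also have "\<dots> = fps_const (\<Prod>l\<in>S. inverse (e l)) + (\<Sum>l\<in>S. fps_const (?R l) * geom s (c l))"
      using S(1) inj e phS(3) by (intro partial_fractions_expansion) auto
    finally show ?thesis .
  qed
  have eps': "\<epsilon> - inverse \<epsilon> \<noteq> 0" using eps_neq by simp
  have loc: "xx Pos i a u Neg i b u t - xx Neg i b u Pos i a u t = 
      Poly_Mapping.single t (?R u * c u powi (a + b) / (\<epsilon> - inverse \<epsilon>))" if u: "u \<in> S" for u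
  proof -
    have uk: "u < k" "u < length t" using S u len by auto
    have B: "t ! u \<in> boxes" using TB_boxes[OF t uk(1)] .
    obtain v where x: "bx (fst (sc u)) i (t ! u) = Some (c u, v)"
      using bspec[OF sc u] unfolding c_def by (elim exE)
    have amps: "amp Pos i u t (c u) * amp Neg i u t (c u) = 
        (\<Prod>m\<in>S - {u}. psi_val (e m) (c m) (inverse (c u)))"
    proof -
      have "amp Pos i u t (c u) * amp Neg i u t (c u) = 
          (\<Prod>l\<in>{..<k} - {u}. rat_val (bphi i (t ! l)) (inverse (c u)))"
        unfolding amp_def spectators.simps len using uk
        by (subst prod.union_disjoint[symmetric]) (auto intro!: prod.cong)
      also have "\<dots> = (\<Prod>l\<in>S - {u}. rat_val (bphi i (t ! l)) (inverse (c u)))"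
      proof (intro prod.mono_neutral_right ballI)
        fix l assume "l \<in> {..<k} - {u} - (S - {u})"
        then have "bphi i (t ! l) = 1" using phN(1) by blast
        then show "rat_val (bphi i (t ! l)) (inverse (c u)) = 1" by simp
      qed (use S in auto)
      also have "\<dots> = (\<Prod>m\<in>S - {u}. psi_val (e m) (c m) (inverse (c u)))"
        using phS e by (intro prod.cong) (auto simp: rat_val_psi_at psi_val_def)
      finally show ?thesis .
    qed
    have pw: "c u powi (a + b) = c u powi a * c u powi b"
      using phS(3)[OF u] by (simp add: power_int_add)
    have N: "bx (opp (fst (sc u))) i (t ! u) = None" using box_x_exclusive[OF B i x] .
    have I: "bx (opp (fst (sc u))) i v = Some (c u, t ! u)" using box_x_inverse[OF B i x] .
    show ?thesis
    proof (cases "fst (sc u)")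
      case Neg
      have R: "?R u = (\<epsilon> - inverse \<epsilon>) * (amp Pos i u t (c u) * amp Neg i u t (c u))"
        unfolding amps psi_residue_def by (simp add: e_def Neg pw_simps)
      have "xx Pos i a u Neg i b u t = Poly_Mapping.single t 
          (amp Pos i u t (c u) * amp Neg i u t (c u) * (c u powi a * c u powi b))"
        using xx_same[OF uk(2) x[unfolded Neg] I[unfolded Neg opp.simps], of a b] by (simp add: mult.assoc)
      moreover have "xx Neg i b u Pos i a u t = 0"
        using N Neg by (intro xx_same_None[OF uk(2)]) simp
      ultimately show ?thesis unfolding R pw using eps' by (simp add: mult.assoc)
    next
      case Pos
      have R: "?R u = - ((\<epsilon> - inverse \<epsilon>) * (amp Pos i u t (c u) * amp Neg i u t (c u)))"
        unfolding amps psi_residue_def by (simp add: e_def Pos pw_simps algebra_simps)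
      have cancel: "- (d * x) * y / d = - (x * y)" if "d \<noteq> 0" for d x y :: complex
        using that by simp
      have "xx Neg i b u Pos i a u t = Poly_Mapping.single t 
          (amp Pos i u t (c u) * amp Neg i u t (c u) * (c u powi a * c u powi b))"
        using xx_same[OF uk(2) x[unfolded Pos] I[unfolded Pos opp.simps], of b a] by (simp add: mult_ac)
      moreover have "xx Pos i a u Neg i b u t = 0"
        using N Pos by (intro xx_same_None[OF uk(2)]) simp
      ultimately show ?thesis unfolding R pw cancel[OF eps'] by (simp add: single_uminus)
    qed
  qed
  have loc0: "xx Pos i a u Neg i b u t - xx Neg i b u Pos i a u t = 0" if "u < k" "u \<notin> S" for u
    using phN(2)[OF that] by (simp add: xx_def xu_None)
  have "lin (DX Pos i a) (DX Neg i b t) - lin (DX Neg i b) (DX Pos i a t) =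
    (\<Sum>u<k. \<Sum>u'<k. xx Pos i a u Neg i b u' t - xx Neg i b u' Pos i a u t)"
    unfolding DX_DX[OF t i, of Pos i a Neg b] DX_DX_swap[OF t i, of Neg i b Pos a]
    by (simp add: sum_subtractf)
  also have "\<dots> = (\<Sum>u<k. \<Sum>u'\<in>{u}. xx Pos i a u Neg i b u' t - xx Neg i b u' Pos i a u t)"
    using xx_exchange_opp[OF t _ _ _ i i, of _ _ Pos] 
    by (intro sum.cong refl sum.mono_neutral_right) auto
  also have "\<dots> = (\<Sum>u\<in>S. xx Pos i a u Neg i b u t - xx Neg i b u Pos i a u t)"
    unfolding sum.insert[OF finite.emptyI] using S loc0 by (intro sum.mono_neutral_cong_right) auto
  also have "\<dots> = (\<Sum>u\<in>S. Poly_Mapping.single t (?R u * c u powi (a + b) / (\<epsilon> - inverse \<epsilon>)))"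
    using loc by (intro sum.cong) auto
  also have "\<dots> = Poly_Mapping.single t ((\<Sum>u\<in>S. ?R u * c u powi (a + b)) / (\<epsilon> - inverse \<epsilon>))"
    by (simp add: sum_divide_distrib single_sum)
  also have "(\<Sum>u\<in>S. ?R u * c u powi (a + b)) = 
    laurent_coeff Pos (phi_series Pos i t) (a + b) - laurent_coeff Neg (phi_series Neg i t) (a + b)"
    unfolding series using phS(3) by (intro laurent_coeff_partial_fractions[symmetric])
  finally show ?thesis .
qed

text \<open>An operator that is diagonal on the basis acts on each component of a current through its
  eigenvalue after the move.\<close>

lemma diag_DX:
  assumes "t \<in> TB" 
  shows "lin (\<lambda>t. Poly_Mapping.single t (f t)) (DX s j b t) = 
    (\<Sum>u<k. case bx s j (t ! u) of None \<Rightarrow> 0 | Some (c, v) \<Rightarrow> 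
      Poly_Mapping.single (t[u := v]) (f (t[u := v]) * (amp s j u t c * c powi b)))"
  unfolding DX_sum[OF assms] lin_sum
  by (intro sum.cong) (auto simp: xu_def mult.commute split: option.split)

lemma relation_k_x:
  assumes t: "t \<in> TB" and j: "j \<le> n"
  shows "lin (\<lambda>t. Poly_Mapping.single t (drinfeld_k n \<tau> h t)) 
      (cscale (drinfeld_k n \<tau> (- h) t) (DX s j b t)) =
    cscale (eps_pow \<tau> (of_int (sg s) * alpha n j h)) (DX s j b t)"
proof -
  have inv: "drinfeld_k n \<tau> (- h) t * drinfeld_k n \<tau> h t = 1"
    using drinfeld_k_add[OF t, of "- h" h] drinfeld_k_0[OF t] by simp
  show ?thesis
    unfolding lin_cscale diag_DX[OF t] unfolding DX_sum[OF t] cscale_sum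
  proof (intro sum.cong refl)
    fix u assume "u \<in> {..<k}"
    then have u: "u < k" by simp
    show "cscale (drinfeld_k n \<tau> (- h) t) (case bx s j (t ! u) of None \<Rightarrow> 0 | Some (c, v) \<Rightarrow> 
        Poly_Mapping.single (t[u := v]) (drinfeld_k n \<tau> h (t[u := v]) * (amp s j u t c * c powi b))) =
      cscale (eps_pow \<tau> (of_int (sg s) * alpha n j h)) (xu s j b u t)"
    proof (cases "bx s j (t ! u)")
      case (Some cv)
      then obtain c v where x: "bx s j (t ! u) = Some (c, v)" by (cases cv) auto
      have "drinfeld_k n \<tau> (- h) t * (eps_pow \<tau> (of_int (sg s) * alpha n j h) * drinfeld_k n \<tau> h t * y) = 
          eps_pow \<tau> (of_int (sg s) * alpha n j h) * (drinfeld_k n \<tau> (- h) t * drinfeld_k n \<tau> h t) * y" for y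
        by (simp only: mult_ac)
      then show ?thesis
        unfolding xu_Some[OF x] x option.case prod.case cscale_single drinfeld_k_update[OF t u j x] inv
        by (simp only: mult_1_right)
    qed (simp add: xu_None)
  qed
qed

lemma relation_phi_x:
  assumes t: "t \<in> TB" and ij: "i \<le> n" "j \<le> n" and q: "q = \<epsilon> powi (sg s * cartan n i j)"
  shows "(lin (\<lambda>t. Poly_Mapping.single t (laurent_coeff s' (phi_series s' i t) a)) (DX s j (b - 1) t)
      - cscale q (lin (\<lambda>t. Poly_Mapping.single t (laurent_coeff s' (phi_series s' i t) (a - 1))) (DX s j b t)))
    - (cscale (q * laurent_coeff s' (phi_series s' i t) a) (DX s j (b - 1) t)
      - cscale (laurent_coeff s' (phi_series s' i t) (a - 1)) (DX s j b t)) = 0"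
proof -
  have "(case bx s j (t ! u) of None \<Rightarrow> 0 | Some (c, v) \<Rightarrow> 
        Poly_Mapping.single (t[u := v]) (laurent_coeff s' (phi_series s' i (t[u := v])) a * (amp s j u t c * c powi (b - 1))))
      - cscale q (case bx s j (t ! u) of None \<Rightarrow> 0 | Some (c, v) \<Rightarrow> 
        Poly_Mapping.single (t[u := v]) (laurent_coeff s' (phi_series s' i (t[u := v])) (a - 1) * (amp s j u t c * c powi b)))
      - (cscale (q * laurent_coeff s' (phi_series s' i t) a) (xu s j (b - 1) u t)
      - cscale (laurent_coeff s' (phi_series s' i t) (a - 1)) (xu s j b u t)) = 0" if u: "u < k" for u
  proof (cases "bx s j (t ! u)")
    case (Some cv)
    then obtain c v where x: "bx s j (t ! u) = Some (c, v)" by (cases cv) auto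
    have "c \<noteq> 0" using TB_param[OF t u ij(2) x] by simp
    then have c: "c powi b = c powi (b - 1) * c"
      using power_int_add_1[of c "b - 1"] by simp
    let ?F = "laurent_coeff s' (phi_series s' i t)" and ?F' = "laurent_coeff s' (phi_series s' i (t[u := v]))"
    have "?F' a - q * c * ?F' (a - 1) = q * ?F a - c * ?F (a - 1)"
      by (rule laurent_coeff_relation[OF phi_series_update[OF t u ij x q]])
    then have "(?F' a - q * c * ?F' (a - 1) - (q * ?F a - c * ?F (a - 1))) * (amp s j u t c * c powi (b - 1)) = 0"
      by simp
    then have "?F' a * (amp s j u t c * c powi (b - 1)) - q * (?F' (a - 1) * (amp s j u t c * c powi b)) - 
      (q * ?F a * (amp s j u t c * c powi (b - 1)) - ?F (a - 1) * (amp s j u t c * c powi b)) = 0"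
      unfolding c by (simp only: algebra_simps)
    then show ?thesis
      unfolding xu_Some[OF x] x option.case prod.case cscale_single single_diff[symmetric] by simp
  qed (simp add: xu_None)
  then show ?thesis
    unfolding diag_DX[OF t] unfolding DX_sum[OF t] cscale_sum sum_subtractf[symmetric]
    by (intro sum.neutral) auto
qed

end

section \<open>The action of the quantum toroidal algebra\<close>

lemma fps_log_exists:
  fixes F :: "complex fps"
  assumes "fps_nth F 0 = 1"
  shows "\<exists>E. fps_nth E 0 = 0 \<and> fps_exp 1 oo E = F"
proof -
  define A where "A = fps_exp (1::complex) - 1"
  have A: "fps_nth A 0 = 0" "fps_nth A 1 \<noteq> 0" by (simp_all add: A_def)
  \<comment> \<open>The compositional inverse of $\exp(z) - 1$ is $\log(1 + z)$.\<close>
  define E where "E = fps_inv A oo (F - 1)"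
  have F0: "fps_nth (F - 1) 0 = 0" using assms by simp
  have i0: "fps_nth (fps_inv A) 0 = 0" by (simp add: fps_inv_def)
  have "A oo E = (A oo fps_inv A) oo (F - 1)"
    unfolding E_def by (rule fps_compose_assoc[OF F0 i0])
  also have "\<dots> = F - 1"
    using F0 by (simp add: fps_inv_right[OF A])
  finally have "fps_exp 1 oo E = F"
    by (simp add: A_def fps_compose_sub_distrib)
  moreover have "fps_nth E 0 = 0" by (simp add: E_def i0)
  ultimately show ?thesis by blast
qed

lemma lin_cong_on:
  assumes "\<And>t. t \<in> B \<Longrightarrow> f t = g t" "v \<in> free_space B"
  shows "lin f v = lin g v"
  unfolding lin_def using assms by (intro sum.cong) (auto simp: free_space_def)

lemma phi_carrier:
  assumes "i \<le> n"
  shows "phi \<epsilon> s i m \<in> carrier (free_alg_on (tor_gens n))"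
proof -
  let ?C = "carrier (free_alg_on (tor_gens n))"
  have E: "fps_nth (phi_exponent \<epsilon> s i) m \<in> ?C" for m
    using assms by (cases s) (auto simp: phi_exponent_def tor_gens_def intro!: carrier_intros)
  have P: "fps_nth (phi_exponent \<epsilon> s i ^ N) m \<in> ?C" for N m
  proof (induction N arbitrary: m)
    case 0
    show ?case by (auto intro: carrier_intros)
  next
    case (Suc N)
    show ?case by (auto simp: fps_mult_nth intro!: carrier_sum carrier_mult E Suc)
  qed
  have "phi_nat \<epsilon> s i m \<in> ?C" for m
    unfolding phi_nat_def using assms P
    by (intro carrier_mult carrier_sum carrier_scal carrier_gen) (auto simp: tor_gens_def)
  then show ?thesis by (simp add: phi_def carrier_0)
qed

lemma tor_relators_carrier: "tor_relators n \<epsilon> \<tau> \<subseteq> carrier (free_alg_on (tor_gens n))"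
proof
  let ?C = "carrier (free_alg_on (tor_gens n))"
  have X: "xg s i m \<in> ?C" if "i \<le> n" for s i m
    using that by (intro carrier_gen) (auto simp: tor_gens_def)
  have K: "kg h \<in> ?C" if "Poly_Mapping.keys h \<subseteq> {..n}" for h
    using that by (intro carrier_gen) (auto simp: tor_gens_def)
  have K': "Poly_Mapping.keys (h + h') \<subseteq> {..n}" 
    if "Poly_Mapping.keys h \<subseteq> {..n}" "Poly_Mapping.keys h' \<subseteq> {..n}" for h h' :: "nat \<Rightarrow>\<^sub>0 rat"
    using that keys_add[of h h'] by blast
  note ph = phi_carrier[of _ n \<epsilon>]
  fix p assume "p \<in> tor_relators n \<epsilon> \<tau>"
  then show "p \<in> ?C"
  proof cases
    case k_zero then show ?thesis using K[of 0] by (auto intro: carrier_intros)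
  next
    case (k_add h h') then show ?thesis using K K' by (auto intro!: carrier_diff carrier_mult)
  next
    case (k_k h h') then show ?thesis using K by (auto intro!: carrier_diff carrier_mult)
  next
    case (k_phi h i s a) then show ?thesis using K ph by (auto intro!: carrier_diff carrier_mult)
  next
    case (phi_phi i j s a s' b) then show ?thesis using ph by (auto intro!: carrier_diff carrier_mult)
  next
    case (k_x h j s b) then show ?thesis using K K[of "- h"] X by (auto intro!: carrier_diff carrier_mult carrier_scal)
  next
    case (phi_x i j q s s' a b) then show ?thesis using X ph by (auto intro!: carrier_diff carrier_mult carrier_scal)
  next
    case (x_plus_minus i j a b) 
    then show ?thesis using X ph by (auto intro!: carrier_diff carrier_mult carrier_scal simp: carrier_0)
  next
    case (x_x i j q s a b) then show ?thesis using X by (auto intro!: carrier_diff carrier_mult carrier_scal)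
  next
    case (serre i j s a b c) 
    then show ?thesis using X by (auto intro!: carrier_diff carrier_add carrier_mult carrier_scal)
  next
    case (x_x_far i j s a b) then show ?thesis using X by (auto intro!: carrier_diff carrier_mult)
  qed
qed

context tensor_setting
begin

text \<open>The logarithm of the eigenvalue of $\phi_i^\pm(z)$, divided by its constant term, which is the
  eigenvalue of $k_i^{\pm 1}$.\<close>

definition phi_log :: "sign \<Rightarrow> nat \<Rightarrow> box list \<Rightarrow> complex fps"
  where "phi_log s i t = (SOME E. fps_nth E 0 = 0 \<and> 
    fps_exp 1 oo E = fps_const (inverse (fps_nth (phi_series s i t) 0)) * phi_series s i t)"

lemma phi_log:
  assumes "t \<in> TB" "i \<le> n"
  shows "fps_nth (phi_log s i t) 0 = 0"
    "fps_exp 1 oo phi_log s i t = fps_const (inverse (fps_nth (phi_series s i t) 0)) * phi_series s i t"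
proof -
  let ?F = "fps_const (inverse (fps_nth (phi_series s i t) 0)) * phi_series s i t"
  have "fps_nth ?F 0 = 1" using phi_series_0(2)[OF assms] by simp
  from someI_ex[OF fps_log_exists[OF this]]
  show "fps_nth (phi_log s i t) 0 = 0" "fps_exp 1 oo phi_log s i t = ?F"
    unfolding phi_log_def by auto
qed

text \<open>The sign of $h_{i,m}$ for negative $m$ is that of the exponent of $\phi_i^-$.\<close>

fun gen_op :: "tor_gen \<Rightarrow> box list \<Rightarrow> (box list \<Rightarrow>\<^sub>0 complex)" where
  "gen_op (X s i m) = DX s i m"
| "gen_op (K h) = (\<lambda>t. Poly_Mapping.single t (drinfeld_k n \<tau> h t))"
| "gen_op (H i m) = (\<lambda>t. Poly_Mapping.single t (if m \<ge> 0
      then fps_nth (phi_log Pos i t) (nat m) / (\<epsilon> - inverse \<epsilon>)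
      else - (fps_nth (phi_log Neg i t) (nat (- m)) / (\<epsilon> - inverse \<epsilon>))))"

lemma gen_op_free: "g \<in> tor_gens n \<Longrightarrow> t \<in> TB \<Longrightarrow> gen_op g t \<in> free_space TB"
  by (auto simp: tor_gens_def intro: DX_free free_space_single)

definition eigen :: "box list \<Rightarrow> tor_gen free_alg \<Rightarrow> complex \<Rightarrow> bool"
  where "eigen t p c \<longleftrightarrow> alg_op gen_op p (Poly_Mapping.single t 1) = Poly_Mapping.single t c"

lemma eigen_single:
  assumes "eigen t p c"
  shows "alg_op gen_op p (Poly_Mapping.single t d) = Poly_Mapping.single t (d * c)"
  using alg_op_cscale[of gen_op p d "Poly_Mapping.single t 1"] assms by (simp add: eigen_def)

lemma eigen_mult: "eigen t p c \<Longrightarrow> eigen t q d \<Longrightarrow> eigen t (p * q) (c * d)"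
  by (simp add: eigen_def[of t "p * q"] eigen_def[of t q] alg_op_mult eigen_single mult.commute)

lemma eigen_sum: "(\<And>x. x \<in> A \<Longrightarrow> eigen t (f x) (g x)) \<Longrightarrow> eigen t (sum f A) (sum g A)"
  by (simp add: eigen_def alg_op_sum single_sum)

lemma eigen_scal: "eigen t (scal c) c"
  by (simp add: eigen_def)

lemma eigen_fps_power:
  assumes "\<And>m. eigen t (fps_nth P m) (fps_nth E m)"
  shows "eigen t (fps_nth (P ^ N) m) (fps_nth (E ^ N) m)"
proof (induction N arbitrary: m)
  case 0
  show ?case by (simp add: eigen_def alg_op_0)
next
  case (Suc N)
  show ?case by (auto simp: fps_mult_nth intro!: eigen_sum eigen_mult assms Suc)
qed

text \<open>The exponential of the logarithm, multiplied by the constant term, returns the eigenvalue.\<close>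

lemma eigen_phi_nat:
  assumes t: "t \<in> TB" and i: "i \<le> n"
  shows "eigen t (phi_nat \<epsilon> s i m) (fps_nth (phi_series s i t) m)"
proof -
  have eps': "\<epsilon> - inverse \<epsilon> \<noteq> 0" using eps_neq by simp
  let ?E = "phi_log s i t" and ?F = "phi_series s i t"
  have E: "eigen t (fps_nth (phi_exponent \<epsilon> s i) m) (fps_nth ?E m)" for m
  proof (cases "m = 0")
    case True
    then show ?thesis 
      using eigen_scal[of t 0] phi_log(1)[OF t i, of s] by (simp add: phi_exponent_def scal_def)
  next
    case False
    have "eigen t (scal (of_int (sg s) * (\<epsilon> - inverse \<epsilon>)) * gen (H i (sg s * int m))) 
      ((of_int (sg s) * (\<epsilon> - inverse \<epsilon>)) * (of_int (sg s) * (fps_nth ?E m / (\<epsilon> - inverse \<epsilon>))))"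
      using False by (intro eigen_mult eigen_scal) (cases s; simp add: eigen_def)
    moreover have cancel: "(x * d) * (x * (y / d)) = x * x * y" if "d \<noteq> 0" for x d y :: complex
      using that by simp
    have sgsq: "of_int (sg s) * of_int (sg s) = (1 :: complex)" by (cases s) simp_all
    have "(of_int (sg s) * (\<epsilon> - inverse \<epsilon>)) * (of_int (sg s) * (fps_nth ?E m / (\<epsilon> - inverse \<epsilon>))) = fps_nth ?E m"
      unfolding cancel[OF eps'] sgsq by simp
    ultimately show ?thesis using False by (simp add: phi_exponent_def)
  qed
  have "eigen t (phi_nat \<epsilon> s i m) (drinfeld_k n \<tau> (Poly_Mapping.single i (of_int (sg s))) t *
      (\<Sum>N\<le>m. 1 / fact N * fps_nth (?E ^ N) m))"
    unfolding phi_nat_def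
    by (intro eigen_mult eigen_sum eigen_scal eigen_fps_power E) (simp add: eigen_def)
  also have "(\<Sum>N\<le>m. 1 / fact N * fps_nth (?E ^ N) m) = fps_nth (fps_exp 1 oo ?E) m"
    by (simp add: fps_compose_nth atLeast0AtMost)
  also have "drinfeld_k n \<tau> (Poly_Mapping.single i (of_int (sg s))) t * \<dots> = fps_nth ?F m"
    unfolding phi_log(2)[OF t i] using phi_series_0[OF t i, of s] by simp
  finally show ?thesis .
qed

lemma eigen_phi:
  assumes "t \<in> TB" "i \<le> n"
  shows "eigen t (phi \<epsilon> s i m) (laurent_coeff s (phi_series s i t) m)"
  using eigen_phi_nat[OF assms] eigen_scal[of t 0] by (simp add: phi_def laurent_coeff_def scal_def)

lemma eigen_kg: "eigen t (kg h) (drinfeld_k n \<tau> h t)"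
  by (simp add: eigen_def)

lemma alg_op_phi:
  assumes "i \<le> n" "v \<in> free_space TB"
  shows "alg_op gen_op (phi \<epsilon> s i m) v = lin (\<lambda>t. Poly_Mapping.single t (laurent_coeff s (phi_series s i t) m)) v"
  unfolding alg_op_decompose[of _ _ v]
  using eigen_phi[OF _ assms(1)] by (intro lin_cong_on[OF _ assms(2)]) (simp add: eigen_def)

lemma eigen_commute:
  assumes "eigen t p c" "eigen t q d"
  shows "alg_op gen_op (p * q - q * p) (Poly_Mapping.single t 1) = 0"
  using eigen_mult[OF assms] eigen_mult[OF assms(2,1)] by (simp add: alg_op_diff eigen_def mult.commute)

lemma relators_act_trivially:
  assumes p: "p \<in> tor_relators n \<epsilon> \<tau>" and t: "t \<in> TB"
  shows "alg_op gen_op p (Poly_Mapping.single t 1) = 0"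
  using p
proof cases
  case k_zero
  then show ?thesis by (simp add: alg_op_diff drinfeld_k_0[OF t])
next
  case (k_add h h')
  then show ?thesis by (simp add: alg_op_diff alg_op_mult drinfeld_k_add[OF t] mult.commute)
next
  case (k_k h h')
  then show ?thesis using eigen_commute[OF eigen_kg eigen_kg] by simp
next
  case (k_phi h i s a)
  then show ?thesis using eigen_commute[OF eigen_kg eigen_phi[OF t]] by simp
next
  case (phi_phi i j s a s' b)
  then show ?thesis using eigen_commute[OF eigen_phi[OF t] eigen_phi[OF t]] by simp
next
  case (k_x h j s b)
  then show ?thesis
    using relation_k_x[OF t, of j h s b] by (simp add: alg_op_diff alg_op_mult)
next
  case (phi_x i j q s s' a b)
  have ph: "alg_op gen_op (phi \<epsilon> s' i m) (Poly_Mapping.single t 1) = 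
      Poly_Mapping.single t (laurent_coeff s' (phi_series s' i t) m)" for m
    using eigen_phi[OF t phi_x(2)] by (simp add: eigen_def)
  show ?thesis
    unfolding phi_x(1)
    using relation_phi_x[OF t phi_x(2-4), of s' a b]
    by (simp only: alg_op_diff alg_op_mult alg_op_scal alg_op_gen gen_op.simps lin_single cscale_1 ph
        alg_op_phi[OF phi_x(2) DX_free[OF t phi_x(3)]] cscale_cscale)
next
  case (x_plus_minus i j a b)
  show ?thesis
  proof (cases "i = j")
    case True
    have ph: "alg_op gen_op (phi \<epsilon> s' i m) (Poly_Mapping.single t 1) = 
        Poly_Mapping.single t (laurent_coeff s' (phi_series s' i t) m)" for s' m
      using eigen_phi[OF t x_plus_minus(2)] by (simp add: eigen_def)
    show ?thesis
      unfolding x_plus_minus(1) 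
      using relation_opp_eq[OF t x_plus_minus(2), of a b] True
      by (simp add: alg_op_diff alg_op_mult ph[unfolded True] single_diff[symmetric])
  next
    case False
    then show ?thesis
      unfolding x_plus_minus(1) using relation_opp_neq[OF t x_plus_minus(2,3) False, of a b]
      by (simp add: alg_op_diff alg_op_mult)
  qed
next
  case (x_x i j q s a b)
  then show ?thesis
    using relation_x_x[OF t, of i j q s a b] by (simp add: alg_op_diff alg_op_mult)
next
  case (serre i j s a b c)
  show ?thesis
    unfolding serre(1) using relation_serre[OF t serre(2-4), of s a b c] 
    by (simp add: alg_op_diff alg_op_add alg_op_mult)
next
  case (x_x_far i j s a b)
  then show ?thesis
    using relation_far[OF t, of i j s a b] by (simp add: alg_op_diff alg_op_mult)
qed

end

sublocale toroidal \<subseteq> tor: presentation "tor_gens n" "tor_relators n \<epsilon> \<tau>"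
  by unfold_locales (rule tor_relators_carrier)

context tensor_setting
begin

lemma U_tor_eq: "U_tor n \<epsilon> \<tau> = tor.U" and tor_class_eq: "tor_class n \<epsilon> \<tau> = tor.cl"
  by (simp_all add: U_tor_def tor_class_def[abs_def])

lemma drinfeld_module_exists: "is_drinfeld_module n \<epsilon> \<tau> TB (tor.quot_act gen_op)"
proof -
  have module: "is_left_module tor.U (\<lambda>c. tor.cl (scal c)) (free_space TB) (tor.quot_act gen_op)"
    by (rule tor.quot_act_module) (fact gen_op_free relators_act_trivially)+
  have act: "tor.quot_act gen_op (tor.cl p) v = alg_op gen_op p v"
    if "p \<in> carrier (free_alg_on (tor_gens n))" "v \<in> free_space TB" for p v
    by (rule tor.quot_act_cl[OF _ _ that]) (fact gen_op_free relators_act_trivially)+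
  show ?thesis
    unfolding is_drinfeld_module_def U_tor_eq tor_class_eq drinfeld_phi_eq
  proof (intro conjI ballI allI impI module)
    fix t assume t: "t \<in> TB"
    note act = act[OF _ free_space_single[OF t]]
    show "tor.quot_act gen_op (tor.cl (xg s i m)) (Poly_Mapping.single t 1) = DX s i m t" if "i \<le> n" for s i m
    proof -
      have "xg s i m \<in> carrier (free_alg_on (tor_gens n))"
        using that by (intro carrier_gen) (auto simp: tor_gens_def)
      from act[OF this] show ?thesis by simp
    qed
    show "tor.quot_act gen_op (tor.cl (phi_nat \<epsilon> s i m)) (Poly_Mapping.single t 1) = 
        Poly_Mapping.single t (fps_nth (phi_series s i t) m)" if "i \<le> n" for s i m
    proof -
      have "phi_nat \<epsilon> s i m \<in> carrier (free_alg_on (tor_gens n))"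
        using phi_carrier[OF that, of \<epsilon> s "sg s * int m"] by (cases s) (simp_all add: phi_def)
      from act[OF this] show ?thesis using eigen_phi_nat[OF t that] by (simp add: eigen_def)
    qed
    show "tor.quot_act gen_op (tor.cl (kg h)) (Poly_Mapping.single t 1) = 
        Poly_Mapping.single t (drinfeld_k n \<tau> h t)" if "Poly_Mapping.keys h \<subseteq> {..n}" for h
    proof -
      have "kg h \<in> carrier (free_alg_on (tor_gens n))"
        using that by (intro carrier_gen) (auto simp: tor_gens_def)
      from act[OF this] show ?thesis by simp
    qed
  qed
qed

end

section \<open>Irreducibility\<close>

lemma scal_mult_commute: "scal c * p = p * (scal c :: 'g free_alg)"
proof -
  have 1: "Poly_Mapping.single w d * scal c = scal c * Poly_Mapping.single w d" for w :: "'g word" and d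
    by (simp add: scal_def mult_single mult.commute)
  have "p * scal c = (\<Sum>w\<in>Poly_Mapping.keys p. Poly_Mapping.single w (Poly_Mapping.lookup p w) * scal c)"
    unfolding sum_distrib_right[symmetric] poly_mapping_decompose[symmetric] ..
  also have "\<dots> = scal c * p"
    unfolding 1 sum_distrib_left[symmetric] poly_mapping_decompose[symmetric] ..
  finally show ?thesis ..
qed

context presentation
begin

text \<open>Scalars are central in the algebra, so every element acts linearly.\<close>

lemma module_act_lin:
  assumes mod: "is_left_module U (\<lambda>c. cl (scal c)) (free_space B) act" and p: "p \<in> carrier FA"
    and v: "v \<in> free_space B"
  shows "act (cl p) v = lin (\<lambda>t. act (cl p) (Poly_Mapping.single t 1)) v"
proof -
  have add: "act (cl p) (x + y) = act (cl p) x + act (cl p) y" 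
    if "x \<in> free_space B" "y \<in> free_space B" for x y
    using mod cl_carrier[OF p] that unfolding is_left_module_def by blast
  have scale: "act (cl p) (cscale c x) = cscale c (act (cl p) x)" if x: "x \<in> free_space B" for c x
  proof -
    have *: "act (u \<otimes>\<^bsub>U\<^esub> u') x = act u (act u' x)" if "u \<in> carrier U" "u' \<in> carrier U" for u u'
      using mod x that unfolding is_left_module_def by blast
    have **: "act (cl (scal c)) y = cscale c y" if "y \<in> free_space B" for y
      using mod that unfolding is_left_module_def by blast
    have in': "act (cl p) x \<in> free_space B"
      using mod x cl_carrier[OF p] unfolding is_left_module_def by blast
    have "act (cl p) (cscale c x) = act (cl (p * scal c)) x"
      unfolding cl_mult[OF p carrier_scal] *[OF cl_carrier[OF p] cl_carrier[OF carrier_scal]] **[OF x] ..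
    also have "\<dots> = cscale c (act (cl p) x)"
      unfolding scal_mult_commute[symmetric] cl_mult[OF carrier_scal p] 
        *[OF cl_carrier[OF carrier_scal] cl_carrier[OF p]] **[OF in'] ..
    finally show ?thesis .
  qed
  have zero: "act (cl p) 0 = 0"
    using scale[OF free_space_0, of 0] by simp
  have sum: "act (cl p) (\<Sum>t\<in>A. cscale (g t) (Poly_Mapping.single t 1)) = 
      (\<Sum>t\<in>A. cscale (g t) (act (cl p) (Poly_Mapping.single t 1)))" if "finite A" "A \<subseteq> B" for A g
    using that
  proof (induction A rule: finite_induct)
    case (insert x A)
    then have s: "Poly_Mapping.single x 1 \<in> free_space B" 
        "(\<Sum>t\<in>A. cscale (g t) (Poly_Mapping.single t 1)) \<in> free_space B"
      by (auto intro!: free_space_single free_space_sum)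
    have IH: "act (cl p) (\<Sum>t\<in>A. cscale (g t) (Poly_Mapping.single t 1)) = 
        (\<Sum>t\<in>A. cscale (g t) (act (cl p) (Poly_Mapping.single t 1)))"
      using insert by blast
    show ?case
      unfolding sum.insert[OF insert.hyps] add[OF free_space_cscale[OF s(1)] s(2)] scale[OF s(1)] IH ..
  qed (simp add: zero)
  have "act (cl p) (lin (\<lambda>t. Poly_Mapping.single t 1) v) = lin (\<lambda>t. act (cl p) (Poly_Mapping.single t 1)) v"
    using sum[of "Poly_Mapping.keys v"] v by (simp add: lin_def free_space_def)
  then show ?thesis by (simp only: lin_ident)
qed

end

context tensor_setting
begin

text \<open>The part of a current that acts at the point \<open>c\<close>.\<close>

definition component :: "sign \<Rightarrow> nat \<Rightarrow> complex \<Rightarrow> box list \<Rightarrow> (box list \<Rightarrow>\<^sub>0 complex)"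
  where "component s i c t = (\<Sum>u<k. case bx s i (t ! u) of None \<Rightarrow> 0
    | Some (c', v) \<Rightarrow> if c' = c then Poly_Mapping.single (t[u := v]) (amp s i u t c) else 0)"

lemma component_eq_current_combination:
  assumes P: "poly P c = 1" 
    and z: "\<And>t u c' w. t \<in> T \<Longrightarrow> u < k \<Longrightarrow> bx s i (t ! u) = Some (c', w) \<Longrightarrow> c' \<noteq> c \<Longrightarrow> poly P c' = 0"
    and t: "t \<in> T" "t \<in> TB"
  shows "(\<Sum>m\<le>degree P. cscale (coeff P m) (DX s i (int m) t)) = component s i c t"
proof -
  have "(\<Sum>m\<le>degree P. cscale (coeff P m) (DX s i (int m) t)) =
    (\<Sum>u<k. \<Sum>m\<le>degree P. cscale (coeff P m) (xu s i (int m) u t))"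
    unfolding DX_sum[OF t(2)] cscale_sum by (rule sum.swap)
  also have "\<dots> = component s i c t"
    unfolding component_def
  proof (rule sum.cong[OF refl])
    fix u assume "u \<in> {..<k}"
    then have u: "u < k" by simp
    show "(\<Sum>m\<le>degree P. cscale (coeff P m) (xu s i (int m) u t)) = 
      (case bx s i (t ! u) of None \<Rightarrow> 0
        | Some (c', v) \<Rightarrow> if c' = c then Poly_Mapping.single (t[u := v]) (amp s i u t c) else 0)"
    proof (cases "bx s i (t ! u)")
      case None
      then show ?thesis by (simp add: xu_None)
    next
      case (Some cv)
      then obtain c' v where x: "bx s i (t ! u) = Some (c', v)" by (cases cv) auto
      have "(\<Sum>m\<le>degree P. cscale (coeff P m) (xu s i (int m) u t)) =
        Poly_Mapping.single (t[u := v]) (\<Sum>m\<le>degree P. amp s i u t c' * (coeff P m * c' ^ m))"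
        by (simp add: xu_Some[OF x] single_sum mult_ac)
      also have "(\<Sum>m\<le>degree P. amp s i u t c' * (coeff P m * c' ^ m)) = amp s i u t c' * poly P c'"
        by (simp add: poly_altdef sum_distrib_left)
      finally show ?thesis
        using z[OF t(1) u x] P by (cases "c' = c") (simp_all add: x)
    qed
  qed
  finally show ?thesis .
qed

text \<open>The modes of a current are the powers of its points. On a vector of finite support finitely
  many points occur, so the part at one of them is a combination of modes, by Lagrange interpolation.\<close>

lemma component_stable:
  assumes N: "cvec.subspace N" "N \<subseteq> free_space TB"
    and stable: "\<And>s i m v. i \<le> n \<Longrightarrow> v \<in> N \<Longrightarrow> lin (DX s i m) v \<in> N"
    and v: "v \<in> N" and i: "i \<le> n"
  shows "lin (component s i c) v \<in> N"
proof -
  define T where "T = Poly_Mapping.keys v"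
  have T: "finite T" "T \<subseteq> TB" using N v by (auto simp: T_def free_space_def)
  define C where "C = (\<Union>t\<in>T. \<Union>u\<in>{..<k}. fst ` set_option (bx s i (t ! u))) - {c}"
  have C: "finite C" using T by (auto simp: C_def)
  \<comment> \<open>The Lagrange polynomial that is 1 at \<open>c\<close> and 0 at all other points that occur.\<close>
  define P where "P = (\<Prod>c'\<in>C. smult (1 / (c - c')) [:- c', 1:])"
  have Pc: "poly P c = 1"
    unfolding P_def poly_prod
  proof (intro prod.neutral ballI)
    fix c' assume "c' \<in> C"
    then have "c - c' \<noteq> 0" by (auto simp: C_def)
    then have "1 / (c - c') * (c - c') = 1" by simp
    then show "poly (smult (1 / (c - c')) [:- c', 1:]) c = 1"
      by (simp only: poly_smult poly_pCons poly_0) (simp add: algebra_simps)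
  qed
  have P0: "poly P c' = 0" if "t \<in> T" "u < k" "bx s i (t ! u) = Some (c', w)" "c' \<noteq> c" for t u c' w
  proof -
    have "c' \<in> C" unfolding C_def using that by force
    then show ?thesis unfolding P_def poly_prod using C by (intro prod_zero) auto
  qed
  have "lin (component s i c) v = lin (\<lambda>t. \<Sum>m\<le>degree P. cscale (coeff P m) (DX s i (int m) t)) v"
  proof -
    have vT: "v \<in> free_space T" by (simp add: free_space_def T_def)
    show ?thesis
    proof (rule lin_cong_on[OF _ vT])
      fix t assume t: "t \<in> T"
      then have "t \<in> TB" using T(2) by blast
      show "component s i c t = (\<Sum>m\<le>degree P. cscale (coeff P m) (DX s i (int m) t))"
        by (rule component_eq_current_combination[symmetric, of P c T s i, OF Pc _ t \<open>t \<in> TB\<close>]) 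
          (rule P0)
    qed
  qed
  also have "\<dots> = (\<Sum>m\<le>degree P. cscale (coeff P m) (lin (DX s i (int m)) v))"
  proof -
    have "lin (\<lambda>t. cscale d (f t)) v = cscale d (lin f v)" for d and f :: "box list \<Rightarrow> box list \<Rightarrow>\<^sub>0 complex"
      unfolding lin_def cscale_sum by (simp add: mult.commute)
    then show ?thesis by (simp add: lin_fun_sum)
  qed
  also have "\<dots> \<in> N"
    by (intro cvec.subspace_sum[OF N(1)] cvec.subspace_scale[OF N(1)] stable[OF i v])
  finally show ?thesis .
qed

text \<open>Points on distinct factors differ, so at most one factor is moved.\<close>

lemma component_Some:
  assumes t: "t \<in> TB" and u: "u < k" and i: "i \<le> n" and x: "bx s i (t ! u) = Some (c, v)"
  shows "component s i c t = Poly_Mapping.single (t[u := v]) (amp s i u t c)"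
proof -
  let ?f = "\<lambda>u. case bx s i (t ! u) of None \<Rightarrow> 0
    | Some (c', v) \<Rightarrow> if c' = c then Poly_Mapping.single (t[u := v]) (amp s i u t c) else 0"
  have "?f u' = 0" if u': "u' < k" "u' \<noteq> u" for u'
  proof (cases "bx s i (t ! u')")
    case (Some cv)
    then obtain c' w where x': "bx s i (t ! u') = Some (c', w)" by (cases cv) auto
    have "c' \<noteq> c"
      using generic_cls[OF as_generic[OF u'(1) u u'(2)] TB_param(1)[OF t u'(1) i x'] TB_param(1)[OF t u i x], of 0] by simp
    then show ?thesis using x' by simp
  qed simp
  then have "component s i c t = (\<Sum>u\<in>{u}. ?f u)"
    unfolding component_def using u by (intro sum.mono_neutral_right) auto
  then show ?thesis using x by simp
qed

lemma component_None:
  assumes "\<And>u v. u < k \<Longrightarrow> bx s i (t ! u) \<noteq> Some (c, v)"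
  shows "component s i c t = 0"
  unfolding component_def using assms by (intro sum.neutral) (auto split: option.split)

text \<open>Moving a box and moving it back is a diagonal operator; its eigenvalue is nonzero exactly when the
  first move is possible.\<close>

lemma component_back:
  assumes t: "t \<in> TB" and i: "i \<le> n"
  shows "\<exists>d. lin (component (opp s) i c) (component s i c t) = Poly_Mapping.single t d \<and>
    (d \<noteq> 0 \<longleftrightarrow> (\<exists>u<k. \<exists>v. bx s i (t ! u) = Some (c, v)))"
proof (cases "\<exists>u<k. \<exists>v. bx s i (t ! u) = Some (c, v)")
  case True
  then obtain u v where u: "u < k" and x: "bx s i (t ! u) = Some (c, v)" by blast
  let ?t = "t[u := v]"
  have t': "?t \<in> TB" using TB_update[OF t u i x] .
  have len: "length t = k" using TB_length[OF t] .
  have x': "bx (opp s) i (?t ! u) = Some (c, t ! u)"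
    using box_x_inverse[OF TB_boxes[OF t u] i x] u len by simp
  have "lin (component (opp s) i c) (component s i c t) = 
    Poly_Mapping.single t (amp s i u t c * amp (opp s) i u ?t c)"
    by (simp add: component_Some[OF t u i x] component_Some[OF t' u i x'])
  moreover have "amp s i u t c * amp (opp s) i u ?t c \<noteq> 0"
    using amp_nz[OF t u i x] amp_nz[OF t' u i x'] by simp
  ultimately show ?thesis using True by (intro exI conjI) auto
next
  case False
  then have "component s i c t = 0" by (intro component_None) auto
  then have "lin (component (opp s) i c) (component s i c t) = Poly_Mapping.single t 0" by simp
  then show ?thesis using False by (intro exI conjI) auto
qed

text \<open>Two distinct basis vectors differ in some factor, whose paths have different extrema; no
  other factor can have an extremum at the same point.\<close>

lemma basis_separation:
  assumes t: "t \<in> TB" "t' \<in> TB" "t \<noteq> t'"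
  obtains s i c where "i \<le> n" 
    "(\<exists>u<k. \<exists>v. bx s i (t ! u) = Some (c, v)) \<noteq> (\<exists>u<k. \<exists>v. bx s i (t' ! u) = Some (c, v))"
proof -
  have "\<exists>u<k. t ! u \<noteq> t' ! u"
    using t TB_length nth_equalityI[of t t'] by metis
  then obtain u where u: "u < k" "t ! u \<noteq> t' ! u" by blast
  have "\<exists>s i c. i \<le> n \<and> (\<exists>v. bx s i (t ! u) = Some (c, v)) \<noteq> (\<exists>v. bx s i (t' ! u) = Some (c, v))"
  proof (rule ccontr)
    assume "\<not> ?thesis"
    then have "t ! u = t' ! u"
      by (intro box_separation[OF TB_boxes[OF t(1) u(1)] TB_boxes[OF t(2) u(1)]]) auto
    then show False using u by simp
  qed
  then obtain s i c where sic: "i \<le> n" 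
    "(\<exists>v. bx s i (t ! u) = Some (c, v)) \<noteq> (\<exists>v. bx s i (t' ! u) = Some (c, v))" by blast
  have only: "u' = u" if "t1 \<in> TB" "t2 \<in> TB" "u' < k" "bx s i (t1 ! u) = Some (c, v)" "bx s i (t2 ! u') = Some (c, v')" 
    for t1 t2 u' v v'
  proof (rule ccontr)
    assume ne: "u' \<noteq> u"
    show False
      using generic_cls[OF as_generic[OF that(3) u(1) ne] TB_param(1)[OF that(2,3) sic(1) that(5)]
          TB_param(1)[OF that(1) u(1) sic(1) that(4)], of 0] by simp
  qed
  have iff: "(\<exists>u'<k. \<exists>v. bx s i (t1 ! u') = Some (c, v)) \<longleftrightarrow> (\<exists>v. bx s i (t1 ! u) = Some (c, v))"
    if t1: "t1 \<in> TB" and t12: "t1 = t \<or> t1 = t'" for t1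
  proof
    assume "\<exists>u'<k. \<exists>v. bx s i (t1 ! u') = Some (c, v)"
    then obtain u' v where u': "u' < k" "bx s i (t1 ! u') = Some (c, v)" by blast
    obtain t2 w where t2: "t2 \<in> TB" "bx s i (t2 ! u) = Some (c, w)" using sic(2) t by blast
    have "u' = u" using only[OF t2(1) t1 u'(1) t2(2) u'(2)] .
    then show "\<exists>v. bx s i (t1 ! u) = Some (c, v)" using u' by blast
  qed (use u in blast)
  show ?thesis
    by (rule that[of i s c]) (use sic iff[OF t(1)] iff[OF t(2)] in auto)
qed

text \<open>In a vector of minimal support, a diagonal operator that separates two vectors of the
  support would cut the support down without killing the vector.\<close>

lemma submodule_contains_basis_vector:
  assumes N: "cvec.subspace N" "N \<subseteq> free_space TB" "N \<noteq> {0}"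
    and stable: "\<And>s i m v. i \<le> n \<Longrightarrow> v \<in> N \<Longrightarrow> lin (DX s i m) v \<in> N"
  obtains t where "t \<in> TB" "Poly_Mapping.single t 1 \<in> N"
proof -
  have "\<exists>v. v \<in> N \<and> v \<noteq> 0" using N cvec.subspace_0[OF N(1)] by blast
  then obtain v where v: "v \<in> N" "v \<noteq> 0"
    and min: "\<And>w. w \<in> N \<Longrightarrow> w \<noteq> 0 \<Longrightarrow> card (Poly_Mapping.keys v) \<le> card (Poly_Mapping.keys w)"
    using ex_has_least_nat[of "\<lambda>v. v \<in> N \<and> v \<noteq> 0" _ "\<lambda>v. card (Poly_Mapping.keys v)"] by metis
  have keys: "Poly_Mapping.keys v \<subseteq> TB" using v N by (auto simp: free_space_def)
  obtain t where t: "t \<in> Poly_Mapping.keys v" using v(2) by (metis keys_eq_empty ex_in_conv)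
  have tTB: "t \<in> TB" using t keys by auto
  have only: "t' = t" if t': "t' \<in> Poly_Mapping.keys v" for t'
  proof (rule ccontr)
    assume ne: "t' \<noteq> t"
    have t'TB: "t' \<in> TB" using t' keys by auto
    obtain s i c where i: "i \<le> n" and
      sep: "(\<exists>u<k. \<exists>v. bx s i (t ! u) = Some (c, v)) \<noteq> (\<exists>u<k. \<exists>v. bx s i (t' ! u) = Some (c, v))"
      by (rule basis_separation[OF tTB t'TB ne[symmetric]])
    have "\<forall>x\<in>TB. \<exists>d. lin (component (opp s) i c) (component s i c x) = Poly_Mapping.single x d \<and>
      (d \<noteq> 0 \<longleftrightarrow> (\<exists>u<k. \<exists>v. bx s i (x ! u) = Some (c, v)))"
      by (intro ballI component_back i)
    from bchoice[OF this] obtain d where 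
      d: "\<And>x. x \<in> TB \<Longrightarrow> lin (component (opp s) i c) (component s i c x) = Poly_Mapping.single x (d x)"
      and d0: "\<And>x. x \<in> TB \<Longrightarrow> d x \<noteq> 0 \<longleftrightarrow> (\<exists>u<k. \<exists>v. bx s i (x ! u) = Some (c, v))" by blast
    define w where "w = lin (component (opp s) i c) (lin (component s i c) v)"
    have wN: "w \<in> N"
      unfolding w_def by (intro component_stable[OF N(1,2) stable _ i] v(1))
    have w: "w = (\<Sum>x\<in>Poly_Mapping.keys v. Poly_Mapping.single x (Poly_Mapping.lookup v x * d x))"
    proof -
      have "w = (\<Sum>x\<in>Poly_Mapping.keys v. cscale (Poly_Mapping.lookup v x) 
          (lin (component (opp s) i c) (component s i c x)))"
        unfolding w_def by (simp add: lin_def[of "component s i c"] lin_sum lin_cscale)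
      also have "\<dots> = (\<Sum>x\<in>Poly_Mapping.keys v. Poly_Mapping.single x (Poly_Mapping.lookup v x * d x))"
        using d keys by (intro sum.cong) auto
      finally show ?thesis .
    qed
    have look: "Poly_Mapping.lookup w x = Poly_Mapping.lookup v x * d x" for x
    proof -
      have "Poly_Mapping.lookup w x = (\<Sum>y\<in>Poly_Mapping.keys v. if y = x then Poly_Mapping.lookup v y * d y else 0)"
        unfolding w lookup_sum by (intro sum.cong) (auto simp: lookup_single when_def)
      then show ?thesis by (simp add: in_keys_iff)
    qed
    have sub: "Poly_Mapping.keys w \<subseteq> Poly_Mapping.keys v"
      by (auto simp: in_keys_iff look)
    have "d t \<noteq> 0 \<and> d t' = 0 \<or> d t = 0 \<and> d t' \<noteq> 0"
      using sep d0[OF tTB] d0[OF t'TB] by blast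
    then obtain y y' where y: "y \<in> Poly_Mapping.keys v" "y' \<in> Poly_Mapping.keys v" "d y \<noteq> 0" "d y' = 0"
      using t t' by blast
    have "y \<in> Poly_Mapping.keys w" "y' \<notin> Poly_Mapping.keys w"
      using y by (auto simp: in_keys_iff look)
    then have "w \<noteq> 0" "Poly_Mapping.keys w \<subset> Poly_Mapping.keys v" using sub y by auto
    then show False
      using min[OF wN] psubset_card_mono[of "Poly_Mapping.keys v" "Poly_Mapping.keys w"] by simp
  qed
  have kv: "Poly_Mapping.keys v = {t}" using only t by blast
  define a where "a = Poly_Mapping.lookup v t"
  have a: "a \<noteq> 0" using t by (simp add: a_def in_keys_iff)
  have "v = Poly_Mapping.single t a"
    using poly_mapping_decompose[of v] by (simp add: kv a_def)
  then have "cscale (1 / a) v = Poly_Mapping.single t 1" using a by simp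
  then have "Poly_Mapping.single t 1 \<in> N"
    using cvec.subspace_scale[OF N(1) v(1), of "1 / a"] by simp
  then show ?thesis using that tTB by blast
qed

lemma submodule_closed_move:
  assumes N: "cvec.subspace N" "N \<subseteq> free_space TB"
    and stable: "\<And>s i m v. i \<le> n \<Longrightarrow> v \<in> N \<Longrightarrow> lin (DX s i m) v \<in> N"
    and t: "t \<in> TB" "Poly_Mapping.single t 1 \<in> N" and u: "u < k" and i: "i \<le> n" and x: "bx s i (t ! u) = Some (c, v)"
  shows "Poly_Mapping.single (t[u := v]) 1 \<in> N"
proof -
  have "lin (component s i c) (Poly_Mapping.single t 1) \<in> N"
    by (rule component_stable[OF N stable t(2) i])
  then have "Poly_Mapping.single (t[u := v]) (amp s i u t c) \<in> N"
    by (simp add: component_Some[OF t(1) u i x])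
  from cvec.subspace_scale[OF N(1) this, of "1 / amp s i u t c"] show ?thesis
    using amp_nz[OF t(1) u i x] by simp
qed

text \<open>Any box of a factor is reached by moves.\<close>

lemma submodule_closed_factor:
  assumes N: "cvec.subspace N" "N \<subseteq> free_space TB"
    and stable: "\<And>s i m v. i \<le> n \<Longrightarrow> v \<in> N \<Longrightarrow> lin (DX s i m) v \<in> N"
    and t: "t \<in> TB" "Poly_Mapping.single t 1 \<in> N" and u: "u < k" and B: "B \<in> V (as ! u)"
  shows "t[u := B] \<in> TB \<and> Poly_Mapping.single (t[u := B]) 1 \<in> N"
proof -
  have len: "length t = k" using TB_length[OF t(1)] .
  have "t ! u \<in> V (as ! u)" using t u by (simp add: TB_iff)
  from V_connected[OF as_nz[OF u] this B] show ?thesis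
  proof (induction rule: rtrancl_induct)
    case base
    then show ?case using t by simp
  next
    case (step B' B'')
    then obtain s i c where x: "i \<le> n" "bx s i B' = Some (c, B'')" by (auto simp: adj_rel_def)
    have IH: "t[u := B'] \<in> TB" "Poly_Mapping.single (t[u := B']) 1 \<in> N" using step by auto
    have x': "bx s i (t[u := B'] ! u) = Some (c, B'')" using x u len by simp
    show ?case
      using submodule_closed_move[OF N stable IH u x(1) x'] TB_update[OF IH(1) u x(1) x'] by simp
  qed
qed

text \<open>The factors are changed one after the other, from left to right.\<close>

lemma submodule_all:
  assumes N: "cvec.subspace N" "N \<subseteq> free_space TB"
    and stable: "\<And>s i m v. i \<le> n \<Longrightarrow> v \<in> N \<Longrightarrow> lin (DX s i m) v \<in> N"
    and t: "t \<in> TB" "Poly_Mapping.single t 1 \<in> N" and t': "t' \<in> TB"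
  shows "Poly_Mapping.single t' 1 \<in> N"
proof -
  have len: "length t = k" "length t' = k" using TB_length t t' by auto
  have "take j t' @ drop j t \<in> TB \<and> Poly_Mapping.single (take j t' @ drop j t) 1 \<in> N" if "j \<le> k" for j
    using that
  proof (induction j)
    case 0
    then show ?case using t by simp
  next
    case (Suc j)
    let ?l = "take j t' @ drop j t"
    have j: "j < k" using Suc.prems by simp
    have IH: "?l \<in> TB" "Poly_Mapping.single ?l 1 \<in> N" using Suc by auto
    have "drop j t = t ! j # drop (Suc j) t" using j len by (simp add: Cons_nth_drop_Suc)
    then have "?l[j := t' ! j] = take j t' @ t' ! j # drop (Suc j) t"
      using j len by (simp add: list_update_append)
    also have "\<dots> = take (Suc j) t' @ drop (Suc j) t"
      using j len by (simp add: take_Suc_conv_app_nth)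
    finally have eq: "?l[j := t' ! j] = take (Suc j) t' @ drop (Suc j) t" .
    have "t' ! j \<in> V (as ! j)" using t' j by (simp add: TB_iff)
    from submodule_closed_factor[OF N stable IH j this] show ?case unfolding eq .
  qed
  from this[of k] show ?thesis using len by simp
qed

lemma TB_nonempty: "TB \<noteq> {}"
proof -
  have "map (\<lambda>a. (low_tab, a)) as \<in> TB"
    using V_memI[OF low_tab_tabs, of _ _ 0] by (auto simp: TB_iff)
  then show ?thesis by blast
qed

lemma drinfeld_module_irreducible:
  assumes "is_drinfeld_module n \<epsilon> \<tau> TB act"
  shows "is_irreducible (U_tor n \<epsilon> \<tau>) (free_space TB) act"
proof -
  have mod: "is_left_module tor.U (\<lambda>c. tor.cl (scal c)) (free_space TB) act"
    and x: "\<And>t s i m. t \<in> TB \<Longrightarrow> i \<le> n \<Longrightarrow> act (tor.cl (xg s i m)) (Poly_Mapping.single t 1) = DX s i m t"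
    using assms unfolding is_drinfeld_module_def U_tor_eq tor_class_eq by auto
  have xg: "xg s i m \<in> carrier tor.FA" if "i \<le> n" for s i m
    using that by (intro carrier_gen) (auto simp: tor_gens_def)
  have act: "act (tor.cl (xg s i m)) v = lin (DX s i m) v" if "i \<le> n" "v \<in> free_space TB" for s i m v
    unfolding tor.module_act_lin[OF mod xg[OF that(1)] that(2)]
    using x that by (intro lin_cong_on[OF _ that(2)]) auto
  obtain t0 where t0: "t0 \<in> TB" using TB_nonempty by blast
  have "Poly_Mapping.single t0 (1 :: complex) \<in> free_space TB" using t0 by (rule free_space_single)
  moreover have "Poly_Mapping.single t0 (1 :: complex) \<noteq> 0"
    by (metis lookup_single_eq lookup_zero zero_neq_one)
  ultimately have nz: "free_space TB \<noteq> {0}" by blast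
  have "N = {0} \<or> N = free_space TB"
    if N: "cvec.subspace N" "N \<subseteq> free_space TB" and st: "\<forall>u\<in>carrier tor.U. \<forall>v\<in>N. act u v \<in> N" for N
  proof (cases "N = {0}")
    case False
    have stable: "lin (DX s i m) v \<in> N" if "i \<le> n" "v \<in> N" for s i m v
      using st tor.cl_carrier[OF xg[OF that(1)]] act[OF that(1)] that(2) N(2) by (metis subsetD)
    obtain t where t: "t \<in> TB" "Poly_Mapping.single t 1 \<in> N"
      using submodule_contains_basis_vector[OF N False stable] by blast
    have all: "Poly_Mapping.single t' 1 \<in> N" if "t' \<in> TB" for t'
      using submodule_all[OF N stable t that] .
    have "v \<in> N" if "v \<in> free_space TB" for v
    proof -
      have "v = (\<Sum>t\<in>Poly_Mapping.keys v. cscale (Poly_Mapping.lookup v t) (Poly_Mapping.single t 1))"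
        using poly_mapping_decompose[of v] by simp
      also have "\<dots> \<in> N"
        using that all by (intro cvec.subspace_sum[OF N(1)] cvec.subspace_scale[OF N(1)]) (auto simp: free_space_def)
      finally show ?thesis .
    qed
    then show ?thesis using N(2) by blast
  qed simp
  then show ?thesis
    unfolding is_irreducible_def U_tor_eq using nz by blast
qed

lemma no_poles: "drinfeld_no_poles n \<epsilon> TB"
  unfolding drinfeld_no_poles_def
proof (intro ballI allI impI)
  fix t s i u c v l
  assume t: "t \<in> TB" and i: "i \<le> n" and u: "u < length t" and x: "bx s i (t ! u) = Some (c, v)"
    and l: "l \<in> spectators s u (length t)"
  show "no_pole_at (bphi i (t ! l)) (inverse c)"
    using spectator_regular(1)[OF t _ _ _ i x] spectators_neq[OF l u] u TB_length[OF t] by auto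
qed

end

section \<open>Dimension and conclusion\<close>

lemma card_listset:
  assumes "\<And>A. A \<in> set As \<Longrightarrow> finite A"
  shows "finite (listset As) \<and> card (listset As) = (\<Prod>A\<leftarrow>As. card A)"
  using assms
proof (induction As)
  case (Cons A As)
  have eq: "listset (A # As) = (\<lambda>(x, xs). x # xs) ` (A \<times> listset As)"
    by (auto simp: set_Cons_def)
  have "inj_on (\<lambda>(x, xs). x # xs) (A \<times> listset As)" by (auto simp: inj_on_def)
  then show ?case
    using Cons unfolding eq by (simp add: card_image card_cartesian_product)
qed simp

lemma free_space_basis:
  fixes B :: "'b set"
  assumes B: "finite B"
  shows "cvec.span ((\<lambda>t. Poly_Mapping.single t (1::complex)) ` B) = free_space B"
    and "cvec.dim (free_space B :: ('b \<Rightarrow>\<^sub>0 complex) set) = card B"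
proof -
  let ?s = "\<lambda>t::'b. Poly_Mapping.single t (1::complex)"
  have inj: "inj ?s" by (rule injI) (metis keys_single singleton_inject zero_neq_one)
  show span: "cvec.span (?s ` B) = free_space B"
  proof
    show "cvec.span (?s ` B) \<subseteq> free_space B"
      by (rule cvec.span_minimal) (auto intro: free_space_single free_space_subspace)
    show "free_space B \<subseteq> cvec.span (?s ` B)"
    proof
      fix v :: "'b \<Rightarrow>\<^sub>0 complex" assume v: "v \<in> free_space B"
      have "v = (\<Sum>t\<in>Poly_Mapping.keys v. cscale (Poly_Mapping.lookup v t) (?s t))"
        using poly_mapping_decompose[of v] by simp
      also have "\<dots> \<in> cvec.span (?s ` B)"
        using v by (intro cvec.span_sum cvec.span_scale cvec.span_base) (auto simp: free_space_def)
      finally show "v \<in> cvec.span (?s ` B)" .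
    qed
  qed
  have "cvec.independent (?s ` B)"
  proof (rule cvec.independent_if_scalars_zero)
    show "finite (?s ` B)" using B by simp
    fix g v assume 0: "(\<Sum>v\<in>?s ` B. cscale (g v) v) = 0" and v: "v \<in> ?s ` B"
    obtain t where t: "t \<in> B" "v = ?s t" using v by auto
    have "(\<Sum>v\<in>?s ` B. cscale (g v) v) = (\<Sum>x\<in>B. cscale (g (?s x)) (?s x))"
      using sum.reindex[OF inj_on_subset[OF inj subset_UNIV], of "\<lambda>v. cscale (g v) v" B] by (simp add: o_def)
    then have "0 = Poly_Mapping.lookup (\<Sum>x\<in>B. cscale (g (?s x)) (?s x)) t" using 0 by simp
    also have "\<dots> = (\<Sum>x\<in>B. if x = t then g (?s x) else 0)"
      unfolding lookup_sum by (intro sum.cong) (auto simp: lookup_single when_def)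
    also have "\<dots> = g v" using B t by simp
    finally show "g v = 0" by simp
  qed
  then have "cvec.dim (free_space B) = card (?s ` B)"
    using cvec.dim_eq_card[of "?s ` B" "free_space B"] span by (metis cvec.span_span)
  then show "cvec.dim (free_space B :: ('b \<Rightarrow>\<^sub>0 complex) set) = card B"
    using card_image[OF inj_on_subset[OF inj subset_UNIV], of B] by simp
qed

theorem theorem5p3:
  fixes r n L k :: nat and \<epsilon> \<tau> :: complex and as :: "complex list"
  assumes "r \<ge> 1" and "n = 2 * r + 1"
    and "L > 1" and "primitive_root (2 * L) \<epsilon>" and "exp \<tau> = \<epsilon>"
    and "k \<ge> 1" and "length as = k" and "\<forall>i<k. as ! i \<noteq> 0"
    and "\<forall>i j. i < j \<and> j < k \<longrightarrow> as ! i / as ! j \<notin> {\<epsilon> powi (2 * m) | m :: int. True}"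
  shows "drinfeld_no_poles n \<epsilon> (tensor_basis r \<epsilon> as)
    \<and> (\<exists>act. is_drinfeld_module n \<epsilon> \<tau> (tensor_basis r \<epsilon> as) act)
    \<and> (\<forall>act. is_drinfeld_module n \<epsilon> \<tau> (tensor_basis r \<epsilon> as) act \<longrightarrow>
          is_irreducible (U_tor n \<epsilon> \<tau>) (tensor_V r \<epsilon> as) act)
    \<and> (\<exists>S. finite S \<and> cvec.span S = tensor_V r \<epsilon> as)
    \<and> cvec.dim (tensor_V r \<epsilon> as) = (L * ((n + 1) choose (r + 1))) ^ k"
proof -
  interpret toroidal r n L \<epsilon> \<tau>
    using assms by unfold_locales
  have lt: "generic (as ! i) (as ! j)" if "i < j" "j < k" for i j
    unfolding generic_def
  proof (intro allI notI)
    fix m :: int assume "as ! i = as ! j * \<epsilon> powi (2 * m)"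
    then have "as ! i / as ! j = \<epsilon> powi (2 * m)" using assms(8) that by simp
    then show False using assms(9) that by blast
  qed
  have "generic (as ! l) (as ! u)" if "l < k" "u < k" "l \<noteq> u" for l u
    using lt[of l u] lt[of u l] generic_sym that by (cases "l < u") auto
  then interpret tensor_setting r n L \<epsilon> \<tau> as
    using assms(7,8) by unfold_locales auto
  let ?V = "map (V_basis r \<epsilon>) as"
  have card: "finite (tensor_basis r \<epsilon> as) \<and> card (tensor_basis r \<epsilon> as) = (\<Prod>A\<leftarrow>?V. card A)"
    unfolding tensor_basis_def by (rule card_listset) (auto simp: V_finite)
  have "map card ?V = map (\<lambda>_. L * ((n + 1) choose (r + 1))) as"
    using V_card as_nz by (auto simp: in_set_conv_nth)
  then have "(\<Prod>A\<leftarrow>?V. card A) = (L * ((n + 1) choose (r + 1))) ^ k"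
    using assms(7) by (simp only: map_map) (simp add: prod_list_replicate map_replicate_const)
  then have dim: "cvec.dim (tensor_V r \<epsilon> as) = (L * ((n + 1) choose (r + 1))) ^ k"
    using card by (simp add: tensor_V_def free_space_basis(2)[OF conjunct1[OF card]])
  have "finite ((\<lambda>t. Poly_Mapping.single t (1::complex)) ` tensor_basis r \<epsilon> as)" using card by simp
  then have "\<exists>S. finite S \<and> cvec.span S = tensor_V r \<epsilon> as"
    unfolding tensor_V_def using free_space_basis(1)[OF conjunct1[OF card]] by blast
  then show ?thesis
    using no_poles drinfeld_module_exists drinfeld_module_irreducible dim
    unfolding tensor_V_def by blast
qed

end
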